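(* Let $x^{\ast}>0$, let $\mu$ be a probability measure supported on the compact interval $[0,x^{\ast}]$, and let $F(z)=\int_0^{x^{\ast}}\frac{1}{z-t}\,d\mu(t)$ be its Stieltjes transform. Suppose that $w(z)=zF(z)$ is an algebraic function with a branch cut on the interval $(0,x^{\ast})$ satisfying an algebraic equation of the form $$P(w)-zQ(w)=0,$$ where $P$ and $Q$ are real polynomials such that $\gcd(P,Q)=1$, $P(t)>0$ for $t\in(0,1]$, $Q'(1)>0$, $\deg P\geq \deg Q+2$, and $\lim_{t\to+\infty}P(t)/Q(t)=+\infty$. Let $\alpha\in(0,\pi/2]$ be a fixed number and let $$S_\alpha=\{z\in\mathbb{C} : z=te^{is},\ t\geq 0,\ -\alpha\leq s\leq\alpha\}.$$ Suppose moreover that for all $x>0$ the polynomial $w\mapsto P(w)-xQ(w)$ has exactly two roots (counted with multiplicities) inside the sector $S_\alpha$ and no roots on the boundary of $S_\alpha$, and that $P$ does not have any roots on the semi-infinite ray $\{te^{i\alpha} : t>0\}$. Then the measure $\mu$ is absolutely continuous with respect to the Lebesgue measure, with a strictly positive density on $(0,x^{\ast})$ given by $$\frac{d\mu}{dx}(x)=\frac{1}{2\pi^2x}\,\mathrm{Re}\int_{\gamma_\alpha}\log\left(1-x\frac{Q(t)}{P(t)}\right)dt ,\qquad 0<x<x^{\ast},$$ where the path of integration $\gamma_\alpha$ is the concatenation $\gamma_\alpha^{(1)}\oplus\gamma_\alpha^{(2)}$ of two semi-infinite rays: $\gamma_\alpha^{(1)}$ is the path $t\mapsto e^{i\alpha}/t$,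 $t>0$ (running from infinity to the origin along the ray of argument $\alpha$), and $\gamma_\alpha^{(2)}$ is the positive real axis (running from the origin to $+\infty$). On each of the two rays the branch of the logarithm is the analytic continuation along the ray of the principal branch, starting at the point at infinity on that ray.
   Context: The function $w(z)=zF(z)$ is analytic on $(\mathbb{C}\cup\{\infty\})\setminus[0,x^{\ast}]$ with $w(\infty)=1$. That $w$ has a branch cut on $(0,x^{\ast})$ means that $w$ is a branch of the algebraic function defined by $P(w)-zQ(w)=0$, with branch points $0$ and $x^{\ast}$ joined by the cut. Branch of the logarithm: since $\deg P\geq\deg Q+2$, for fixed $x$ one has $1-xQ(t)/P(t)\to 1$ as $t\to\infty$ along either ray. The logarithm is the one determined, on each ray, by the continuous choice of the argument of $1-xQ(t)/P(t)$ that tends to $0$ at the point at infinity on that ray. *)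

theory Defs
  imports "HOL-Complex_Analysis.Complex_Analysis" "HOL-Probability.Probability"
    "HOL-Computational_Algebra.Computational_Algebra"
begin

definition stieltjes :: "real measure \<Rightarrow> complex \<Rightarrow> complex" where
  "stieltjes \<mu> z = (\<integral>t. 1 / (z - complex_of_real t) \<partial>\<mu>)"

abbreviation cpoly :: "real poly \<Rightarrow> complex poly" where
  "cpoly \<equiv> map_poly complex_of_real"

text \<open>
  For a function \<open>w\<close> given off the cut \<open>C\<close>, the point \<open>p\<close> is a branch point when the germ of
  \<open>w\<close> near \<open>p\<close> does not continue to a single-valued analytic function on any punctured
  disc around \<open>p\<close>. In particular isolated singularities are not branch points.
\<close>

definition branch_point :: "complex set \<Rightarrow> (complex \<Rightarrow> complex) \<Rightarrow> complex \<Rightarrow> bool" where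
  "branch_point C w p \<longleftrightarrow>
     (\<forall>r>0. \<not> (\<exists>g. g holomorphic_on (ball p r - {p}) \<and> (\<forall>z \<in> ball p r - C. g z = w z)))"

text \<open>
  \<open>w\<close> is a branch of the algebraic function \<open>P(w) - z Q(w) = 0\<close> whose branch points \<open>0\<close> and
  \<open>xs\<close> are joined by the cut \<open>[0, xs]\<close>. Nothing is required of \<open>w\<close> at the inner points of
  the cut.
\<close>

definition algebraic_with_cut ::
    "real poly \<Rightarrow> real poly \<Rightarrow> real \<Rightarrow> (complex \<Rightarrow> complex) \<Rightarrow> bool" where
  "algebraic_with_cut P Q xs w \<longleftrightarrow>
     (let C = complex_of_real ` {0..xs} in
        w holomorphic_on (- C) \<and>
        (\<forall>z \<in> - C. poly (cpoly P) (w z) - z * poly (cpoly Q) (w z) = 0) \<and>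
        branch_point C w 0 \<and> branch_point C w (complex_of_real xs))"

definition sector :: "real \<Rightarrow> complex set" where
  "sector \<alpha> = {complex_of_real t * cis s | t s. t \<ge> 0 \<and> - \<alpha> \<le> s \<and> s \<le> \<alpha>}"

definition open_ray :: "real \<Rightarrow> complex set" where
  "open_ray \<theta> = {complex_of_real t * cis \<theta> | t. t > 0}"

text \<open>
  \<open>L\<close> is the logarithm of \<open>f\<close> along the ray of argument \<open>\<theta>\<close> whose imaginary part, a continuous
  choice of the argument of \<open>f\<close>, tends to \<open>0\<close> at the infinite end of the ray. On the ray there
  is at most one such \<open>L\<close>, since two of them differ by a constant in \<open>2\<pi>i\<int>\<close>; so the choice in
  \<open>ray_log\<close> below does not affect its values on the ray.
\<close>

definition is_ray_log ::
    "real \<Rightarrow> (complex \<Rightarrow> complex) \<Rightarrow> (complex \<Rightarrow> complex) \<Rightarrow> bool" where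
  "is_ray_log \<theta> f L \<longleftrightarrow>
     continuous_on (open_ray \<theta>) L \<and>
     (\<forall>z \<in> open_ray \<theta>. exp (L z) = f z) \<and>
     ((\<lambda>t. Im (L (complex_of_real t * cis \<theta>))) \<longlongrightarrow> 0) at_top"

definition ray_log :: "real \<Rightarrow> (complex \<Rightarrow> complex) \<Rightarrow> complex \<Rightarrow> complex" where
  "ray_log \<theta> f = (SOME L. is_ray_log \<theta> f L)"

text \<open>Integration along paths parametrised by the open half-line \<open>t > 0\<close>.\<close>

definition path_integrable :: "(real \<Rightarrow> complex) \<Rightarrow> (complex \<Rightarrow> complex) \<Rightarrow> bool" where
  "path_integrable \<gamma> f \<longleftrightarrow>
     set_integrable lborel {0<..} (\<lambda>t. f (\<gamma> t) * vector_derivative \<gamma> (at t))"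

definition path_int :: "(real \<Rightarrow> complex) \<Rightarrow> (complex \<Rightarrow> complex) \<Rightarrow> complex" where
  "path_int \<gamma> f = (LINT t:{0<..}|lborel. f (\<gamma> t) * vector_derivative \<gamma> (at t))"

definition gamma1 :: "real \<Rightarrow> real \<Rightarrow> complex" where
  "gamma1 \<alpha> t = cis \<alpha> / complex_of_real t"

definition gamma2 :: "real \<Rightarrow> complex" where
  "gamma2 t = complex_of_real t"

text \<open>
  The integral of \<open>log f\<close> over the concatenation of \<open>gamma1 \<alpha>\<close> and \<open>gamma2\<close>, with the
  logarithm chosen on each ray separately, and the assertion that it is meaningful.
\<close>

definition log_integral_exists :: "real \<Rightarrow> (complex \<Rightarrow> complex) \<Rightarrow> bool" where
  "log_integral_exists \<alpha> f \<longleftrightarrow>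
     (\<exists>L. is_ray_log \<alpha> f L) \<and> path_integrable (gamma1 \<alpha>) (ray_log \<alpha> f) \<and>
     (\<exists>L. is_ray_log 0 f L) \<and> path_integrable gamma2 (ray_log 0 f)"

definition log_integral :: "real \<Rightarrow> (complex \<Rightarrow> complex) \<Rightarrow> complex" where
  "log_integral \<alpha> f =
     path_int (gamma1 \<alpha>) (ray_log \<alpha> f) + path_int gamma2 (ray_log 0 f)"

definition log_arg :: "real poly \<Rightarrow> real poly \<Rightarrow> real \<Rightarrow> complex \<Rightarrow> complex" where
  "log_arg P Q x t = 1 - complex_of_real x * (poly (cpoly Q) t / poly (cpoly P) t)"

definition density_fun :: "real poly \<Rightarrow> real poly \<Rightarrow> real \<Rightarrow> real \<Rightarrow> real" where
  "density_fun P Q \<alpha> x = 1 / (2 * pi\<^sup>2 * x) * Re (log_integral \<alpha> (log_arg P Q x))"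

end

theory Submission
  imports Defs "HOL-Real_Asymp.Real_Asymp"
begin

text \<open>
  Write \<open>w(z) = z F(z)\<close> for the branch \<open>branch\<close>, so that \<open>P(w) = z Q(w)\<close>. The density of \<open>\<mu>\<close> at
  \<open>x\<close> is the limit of \<open>- Im F(x + i\<epsilon>) / \<pi>\<close>, hence it is known once \<open>w(x + i0)\<close> is. The proof
  identifies \<open>w(x + i0)\<close> for \<open>0 < x < xs\<close> as the root of \<open>P - x Q\<close> in the lower half of the sector
  \<open>S\<^sub>\<alpha>\<close>, and recognises the imaginary part of its conjugate \<open>v\<close> in the logarithmic integral.

  \<^emph>\<open>Location of the roots.\<close> Since \<open>deg Q < deg P\<close>, roots of \<open>P - z Q\<close> stay bounded and depend on
  \<open>z\<close> continuously. On a horizontal segment close to the positive axis no root of \<open>P - z Q\<close> meets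
  the boundary of \<open>S\<^sub>\<alpha>\<close>; to the right of \<open>xs\<close> the value of \<open>w\<close> is close to a positive real number,
  so \<open>w\<close> stays in \<open>S\<^sub>\<alpha>\<close> all along the segment (\<open>branch_in_sector\<close>). On the negative axis
  \<open>0 < w \<le> 1\<close>, and \<open>P > 0\<close> on \<open>(0, 1]\<close> forces \<open>w(z) \<rightarrow> 0\<close> as \<open>z \<rightarrow> 0\<close>, \<open>P(0) = 0\<close>, \<open>Q(0) < 0\<close>, and
  \<open>\<mu>{0} = 0\<close> (\<open>left_limit\<close>). So for small \<open>x > 0\<close> one root in \<open>S\<^sub>\<alpha>\<close> is near \<open>0\<close>; it is not real,
  because \<open>P > 0 > Q\<close> on the axis just to the right of \<open>0\<close>, and the two roots in \<open>S\<^sub>\<alpha>\<close> are this root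
  and its conjugate. Hence \<open>P\<close> has no root in \<open>S\<^sub>\<alpha>\<close> apart from \<open>0\<close> (\<open>P_nonzero_in_sector\<close>). If
  \<open>P - x Q\<close> had a positive root for some \<open>x < xs\<close>, then \<open>P - xs Q\<close> would have two distinct ones,
  both simple, and \<open>w\<close> would continue analytically to a neighbourhood of the branch point \<open>xs\<close>
  (\<open>no_positive_root\<close>). So the roots in \<open>S\<^sub>\<alpha>\<close> form a pair \<open>v\<close>, \<open>cnj v\<close> of simple nonreal
  roots for all \<open>0 < x < xs\<close>, and \<open>Im w(x + i\<epsilon>) \<le> 0\<close> selects \<open>cnj v\<close> (\<open>branch_boundary_value\<close>).

  \<^emph>\<open>The integral.\<close> Put \<open>f = 1 - x Q / P\<close>. Integration by parts on each ray turns the integral of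
  \<open>log f\<close> into minus the integral of the rational function \<open>t f'(t) / f(t)\<close>, which is \<open>O(t\<^sup>-\<^sup>2)\<close> at
  infinity and bounded at \<open>0\<close>. Its only pole in the closed wedge between the two rays is \<open>v\<close>, with
  residue \<open>v\<close>; so the integral of \<open>log f\<close> is \<open>- 2 \<pi> i v\<close> (\<open>log_integral_eq\<close>), with real part
  \<open>2 \<pi> Im v\<close>.

  \<^emph>\<open>The measure.\<close> In the upper half-plane \<open>F\<close> is bounded near every compact subset of the positive half-axis,
  and \<open>Im F(x + i\<epsilon>) \<rightarrow> 0\<close> for \<open>x > xs\<close>. Stieltjes inversion (\<open>stieltjes_inversion\<close>) then
  shows that \<open>\<mu>\<close> is the measure with the limiting density; there is no atom at \<open>0\<close> by the first
  part, and none at \<open>xs\<close> because of the boundedness of \<open>F\<close>.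
\<close>

section \<open>Rational decay and an integrable majorant\<close>

lemma poly_ratio_bound:
  fixes A B :: "complex poly"
  assumes deg: "degree A + 2 \<le> degree B"
  obtains C R where "R > 0" "C \<ge> 0"
    "\<And>z. norm z \<ge> R \<Longrightarrow> norm (poly A z / poly B z) \<le> C / (norm z)\<^sup>2"
proof -
  have B0: "lead_coeff B \<noteq> 0" using deg by auto
  define q where "q z = (poly A z / z ^ degree A) / (poly B z / z ^ degree B)" for z
  have "(q \<longlongrightarrow> lead_coeff A / lead_coeff B) at_infinity"
    unfolding q_def by (intro tendsto_divide poly_divide_tendsto_aux B0)
  then have "((\<lambda>z. norm (q z)) \<longlongrightarrow> norm (lead_coeff A / lead_coeff B)) at_infinity"
    by (rule tendsto_norm)
  then have "\<forall>\<^sub>F z in at_infinity. norm (q z) < norm (lead_coeff A / lead_coeff B) + 1"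
    by (rule order_tendstoD) simp
  moreover define C where "C = norm (lead_coeff A / lead_coeff B) + 1"
  ultimately have C: "C > 0" "\<forall>\<^sub>F z in at_infinity. norm (q z) \<le> C"
    by (auto simp: add_nonneg_pos elim: eventually_mono)
  then obtain b where b: "\<And>z. norm z \<ge> b \<Longrightarrow> norm (q z) \<le> C"
    by (auto simp: eventually_at_infinity)
  have bnd: "norm (poly A z / poly B z) \<le> C / (norm z)\<^sup>2" if z: "norm z \<ge> max 1 b" for z
  proof -
    have nz: "z \<noteq> 0" "norm z \<ge> 1" using z by auto
    have pw: "z ^ degree B = z ^ degree A * z ^ (degree B - degree A)"
      using deg by (simp flip: power_add)
    have "q z = poly A z / poly B z * z ^ (degree B - degree A)"
      unfolding q_def using nz by (simp add: pw)
    then have "norm (q z) = norm (poly A z / poly B z) * norm z ^ (degree B - degree A)"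
      by (metis norm_mult norm_power)
    then have "norm (poly A z / poly B z) * norm z ^ (degree B - degree A) \<le> C"
      using b[of z] z by simp
    moreover have "norm z ^ 2 \<le> norm z ^ (degree B - degree A)"
      using nz deg by (intro power_increasing) auto
    ultimately have "norm (poly A z / poly B z) * (norm z)\<^sup>2 \<le> C"
      by (meson mult_left_mono norm_ge_zero order_trans)
    then show ?thesis using nz by (simp add: pos_le_divide_eq)
  qed
  show ?thesis by (rule that[of "max 1 b" C]) (use bnd C in auto)
qed

lemma poly_ratio_ray_bound:
  fixes A B :: "complex poly"
  assumes deg: "degree A + 2 \<le> degree B"
    and nz: "\<And>s. s \<ge> 0 \<Longrightarrow> poly B (complex_of_real s * cis \<theta>) \<noteq> 0"
  obtains C where "C \<ge> 0" "\<And>s. s \<ge> 0 \<Longrightarrow>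
    norm (poly A (complex_of_real s * cis \<theta>) / poly B (complex_of_real s * cis \<theta>)) \<le> C / (1 + s\<^sup>2)"
proof -
  obtain C R where CR: "R > 0" "C \<ge> 0"
    "\<And>z. norm z \<ge> R \<Longrightarrow> norm (poly A z / poly B z) \<le> C / (norm z)\<^sup>2"
    using poly_ratio_bound[OF deg] by metis
  define q where "q s = poly A (complex_of_real s * cis \<theta>) / poly B (complex_of_real s * cis \<theta>)" for s
  define R' where "R' = max 1 R"
  have "compact (q ` {0..R'})"
    unfolding q_def using nz by (intro compact_continuous_image continuous_intros) auto
  then have "bounded (q ` {0..R'})" by (rule compact_imp_bounded)
  then obtain D where D: "\<And>s. s \<in> {0..R'} \<Longrightarrow> norm (q s) \<le> D" unfolding bounded_iff by blast
  have D0: "D \<ge> 0" by (rule order_trans[OF norm_ge_zero D[of 0]]) (simp add: R'_def)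
  define E where "E = 2 * C + D * (1 + R'\<^sup>2)"
  have E0: "E \<ge> 0" unfolding E_def using CR(2) D0 by simp
  have "norm (q s) * (1 + s\<^sup>2) \<le> E" if s: "s \<ge> 0" for s
  proof (cases "s \<le> R'")
    case True
    then have "norm (q s) * (1 + s\<^sup>2) \<le> D * (1 + R'\<^sup>2)"
      using s D[of s] D0 by (intro mult_mono) (auto intro!: power_mono)
    then show ?thesis unfolding E_def using CR(2) by linarith
  next
    case False
    then have s1: "s \<ge> R" "s \<ge> 1" unfolding R'_def by auto
    have "norm (complex_of_real s * cis \<theta>) = s" using s1 by (simp add: norm_mult)
    then have "norm (q s) \<le> C / s\<^sup>2" unfolding q_def using CR(3)[of "complex_of_real s * cis \<theta>"] s1
      by (metis)
    then have "norm (q s) * (1 + s\<^sup>2) \<le> C / s\<^sup>2 * (1 + s\<^sup>2)" by (intro mult_right_mono) auto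
    also have "\<dots> = C * (1 / s\<^sup>2 + 1)" using s1 by (simp add: field_simps)
    also have "\<dots> \<le> C * 2" using CR(2) s1 by (intro mult_left_mono) auto
    also have "\<dots> \<le> E" unfolding E_def using D0 by simp
    finally show ?thesis .
  qed
  moreover have "1 + s\<^sup>2 > (0::real)" for s by (smt (verit) zero_le_power2)
  ultimately have "norm (q s) \<le> E / (1 + s\<^sup>2)" if "s \<ge> 0" for s
    using that by (simp add: pos_le_divide_eq)
  then show ?thesis using that[of E] E0 unfolding q_def by blast
qed

lemma integrable_inverse_one_plus_square: "set_integrable lborel {0<..} (\<lambda>s::real. 1 / (1 + s\<^sup>2))"
proof -
  have "set_integrable lborel (einterval 0 \<infinity>) (\<lambda>s::real. 1 / (1 + s\<^sup>2))"
  proof (rule interval_integral_FTC_nonneg)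
    show "DERIV arctan x :> 1 / (1 + x\<^sup>2)" for x :: real
      by (auto intro!: derivative_eq_intros simp: field_simps)
    show "isCont (\<lambda>s. 1 / (1 + s\<^sup>2)) x" for x :: real
      by (intro continuous_intros) (smt (verit) zero_le_power2)
    show "((arctan \<circ> real_of_ereal) \<longlongrightarrow> 0) (at_right 0)"
      unfolding zero_ereal_def ereal_tendsto_simps1 by real_asymp
    show "((arctan \<circ> real_of_ereal) \<longlongrightarrow> pi / 2) (at_left \<infinity>)"
      unfolding ereal_tendsto_simps1 by real_asymp
  qed (auto simp: add_nonneg_nonneg)
  also have "einterval 0 \<infinity> = {0<..}" by (auto simp: einterval_def)
  finally show ?thesis .
qed

text \<open>
  The antiderivative of \<open>- 1 / (s (1 + s\<^sup>2))\<close> that vanishes at infinity. It majorises, up to a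
  constant factor, the logarithms considered below, and it is integrable over the whole half-line:
  its singularity at \<open>0\<close> is logarithmic and its decay at infinity quadratic.
\<close>

definition tail_log :: "real \<Rightarrow> real" where
  "tail_log s = ln (1 + 1 / s\<^sup>2) / 2"

lemma tail_log_has_derivative:
  "s > 0 \<Longrightarrow> (tail_log has_real_derivative - 1 / (s * (1 + s\<^sup>2))) (at s)"
proof -
  assume s: "s > 0"
  have p: "1 + 1 / s\<^sup>2 > 0" "1 + s\<^sup>2 > 0" using s by (auto simp: add_pos_pos)
  show ?thesis
    unfolding tail_log_def using s p
    apply (auto intro!: derivative_eq_intros)
    apply (simp add: divide_simps)
    apply (simp add: power2_eq_square power4_eq_xxxx algebra_simps add_eq_0_iff)
    done
qed

lemma tail_log_nonneg: "tail_log s \<ge> 0"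
  unfolding tail_log_def by (intro divide_nonneg_pos ln_ge_zero) auto

lemma tail_log_at_top: "(tail_log \<longlongrightarrow> 0) at_top"
  unfolding tail_log_def by real_asymp

lemma integrable_tail_log: "set_integrable lborel {0<..} tail_log"
proof -
  have "set_integrable lborel (einterval 0 \<infinity>) tail_log"
  proof (rule interval_integral_FTC_nonneg)
    fix x :: real assume "0 < ereal x"
    then have x: "x > 0" by simp
    have "1 + x\<^sup>2 > 0" by (smt (verit) zero_le_power2)
    then show "DERIV (\<lambda>s. s * tail_log s + arctan s) x :> tail_log x"
      using x by (auto intro!: derivative_eq_intros tail_log_has_derivative simp: divide_simps)
    show "isCont tail_log x" using tail_log_has_derivative[OF x] by (rule DERIV_isCont)
  next
    show "(((\<lambda>s. s * tail_log s + arctan s) \<circ> real_of_ereal) \<longlongrightarrow> 0) (at_right 0)"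
      unfolding zero_ereal_def ereal_tendsto_simps1 tail_log_def by real_asymp
    show "(((\<lambda>s. s * tail_log s + arctan s) \<circ> real_of_ereal) \<longlongrightarrow> pi / 2) (at_left \<infinity>)"
      unfolding ereal_tendsto_simps1 tail_log_def by real_asymp
  qed (auto simp: tail_log_nonneg)
  also have "einterval 0 \<infinity> = {0<..}" by (auto simp: einterval_def)
  finally show ?thesis .
qed

section \<open>Continuous logarithms along a ray\<close>

lemma continuous_log_has_vector_derivative:
  fixes L F :: "real \<Rightarrow> complex"
  assumes L: "isCont L s" and F: "(F has_vector_derivative F') (at s)"
    and ex: "\<forall>\<^sub>F t in nhds s. exp (L t) = F t"
  shows "(L has_vector_derivative F' / F s) (at s)"
proof -
  have Fs: "exp (L s) = F s" using ex by (rule eventually_nhds_x_imp_x)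
  then have nz: "F s \<noteq> 0" by (metis exp_not_eq_zero)
  have cF: "isCont F s" using F by (rule has_vector_derivative_continuous)
  define D where "D t = L t - L s - Ln (F t / F s)" for t
  have "isCont D s"
    unfolding D_def using nz by (intro continuous_intros L cF) auto
  moreover have "D s = 0" using nz by (simp add: D_def)
  ultimately have "\<forall>\<^sub>F t in nhds s. norm (D t) < 1"
    by (metis isCont_def order_tendstoD(2) tendsto_at_iff_tendsto_nhds tendsto_norm norm_zero zero_less_one)
  with ex have "\<forall>\<^sub>F t in nhds s. L t = L s + Ln (F t / F s)"
  proof eventually_elim
    case (elim t)
    have "F t \<noteq> 0" using elim(1) by (metis exp_not_eq_zero)
    then have "exp (D t) = 1"
      using nz elim(1) Fs by (simp add: D_def exp_diff)
    then obtain n :: int where n: "Re (D t) = 0" "Im (D t) = of_int (2 * n) * pi"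
      unfolding exp_eq_1 by auto
    have "\<bar>Im (D t)\<bar> < 1" using elim(2) abs_Im_le_cmod[of "D t"] by linarith
    \<comment> \<open>Near \<open>s\<close> the difference of the two logarithms is a multiple of \<open>2 \<pi> i\<close> of modulus less
      than \<open>1\<close>.\<close>
    have "n = 0"
    proof (rule ccontr)
      assume "n \<noteq> 0"
      then have "\<bar>real_of_int n\<bar> \<ge> 1" by linarith
      then have "\<bar>real_of_int n\<bar> * pi \<ge> 1 * 1" using pi_ge_two by (intro mult_mono) auto
      then show False using \<open>\<bar>Im (D t)\<bar> < 1\<close> n(2) by (simp add: abs_mult)
    qed
    then have "D t = 0" using n by (simp add: complex_eq_iff)
    then show ?case by (simp add: D_def algebra_simps)
  qed
  moreover have "((\<lambda>t. L s + Ln (F t / F s)) has_vector_derivative F' / F s) (at s)"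
  proof -
    have "((\<lambda>t. F t / F s) has_vector_derivative F' / F s) (at s)"
      using F by (rule has_vector_derivative_divide)
    moreover have "(Ln has_field_derivative inverse 1) (at (F s / F s))"
      using nz by (auto intro!: derivative_eq_intros)
    ultimately have "((Ln \<circ> (\<lambda>t. F t / F s)) has_vector_derivative F' / F s * inverse 1) (at s)"
      by (rule field_vector_diff_chain_at)
    then show ?thesis
      unfolding o_def by (auto intro!: derivative_eq_intros)
  qed
  ultimately show ?thesis
    by (subst has_vector_derivative_cong_ev[where g = "\<lambda>t. L s + Ln (F t / F s)"])
      (use Fs nz in \<open>auto elim: eventually_mono\<close>)
qed

lemma limit_at_top_with_tail_bound:
  fixes K K' :: "real \<Rightarrow> complex"
  assumes K: "\<And>s. s > 0 \<Longrightarrow> (K has_vector_derivative K' s) (at s)"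
    and bnd: "\<And>s. s > 0 \<Longrightarrow> norm (K' s) \<le> C / (s * (1 + s\<^sup>2))"
    and C: "C \<ge> 0"
  obtains l where "\<And>T. T > 0 \<Longrightarrow> norm (K T - l) \<le> C * tail_log T" "(K \<longlongrightarrow> l) at_top"
proof -
  have dif: "norm (K t - K s) \<le> C * tail_log s" if st: "0 < s" "s \<le> t" for s t
  proof (cases "s = t")
    case False
    then have "s < t" using st by simp
    have "norm (K t - K s) \<le> - C * tail_log t - - C * tail_log s"
    proof (rule differentiable_bound_general[OF \<open>s < t\<close>])
      show "continuous_on {s..t} K"
        using st by (intro continuous_at_imp_continuous_on ballI has_vector_derivative_continuous[OF K]) auto
      show "continuous_on {s..t} (\<lambda>x. - C * tail_log x)"
        using st by (intro continuous_at_imp_continuous_on ballI continuous_intros DERIV_isCont[OF tail_log_has_derivative]) auto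
      fix x assume x: "s < x" "x < t"
      then have "x > 0" using st by simp
      show "(K has_vector_derivative K' x) (at x)" by (rule K) fact
      show "((\<lambda>x. - C * tail_log x) has_vector_derivative C / (x * (1 + x\<^sup>2))) (at x)"
        using DERIV_cmult[OF tail_log_has_derivative[OF \<open>x > 0\<close>], of "- C"]
        by (simp add: has_real_derivative_iff_has_vector_derivative)
      show "norm (K' x) \<le> C / (x * (1 + x\<^sup>2))" by (rule bnd) fact
    qed
    also have "\<dots> \<le> C * tail_log s" using C tail_log_nonneg[of t] by simp
    finally show ?thesis .
  qed (use C tail_log_nonneg in auto)
  have lim0: "((\<lambda>T. C * tail_log T) \<longlongrightarrow> 0) at_top"
    using tendsto_mult_left[OF tail_log_at_top, of C] by simp
  have "Cauchy (\<lambda>n. K (real (Suc n)))"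
  proof (rule metric_CauchyI)
    fix e :: real assume "e > 0"
    have "(\<lambda>n. C * tail_log (real (Suc n))) \<longlonglongrightarrow> 0"
      by (rule filterlim_compose[OF lim0]) real_asymp
    then obtain N where N: "\<And>n. n \<ge> N \<Longrightarrow> C * tail_log (real (Suc n)) < e / 2"
      using \<open>e > 0\<close> by (metis (no_types, lifting) eventually_sequentially half_gt_zero order_tendstoD(2))
    have "dist (K (real (Suc n))) (K (real (Suc N))) < e / 2" if "n \<ge> N" for n
      using dif[of "real (Suc N)" "real (Suc n)"] N[of N] that by (simp add: dist_norm)
    then have "dist (K (real (Suc m))) (K (real (Suc n))) < e" if "m \<ge> N" "n \<ge> N" for m n
      using that dist_triangle_half_l by blast
    then show "\<exists>M. \<forall>m\<ge>M. \<forall>n\<ge>M. dist (K (real (Suc m))) (K (real (Suc n))) < e" by blast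
  qed
  then obtain l where l: "(\<lambda>n. K (real (Suc n))) \<longlonglongrightarrow> l" using Cauchy_convergent_iff convergent_def by blast
  have le: "norm (K T - l) \<le> C * tail_log T" if "T > 0" for T
  proof (rule tendsto_upperbound)
    show "(\<lambda>n. norm (K (real (Suc n)) - K T)) \<longlonglongrightarrow> norm (K T - l)"
      by (subst norm_minus_commute) (intro tendsto_intros l)
    have "norm (K (real (Suc n)) - K T) \<le> C * tail_log T" if "n \<ge> nat \<lceil>T\<rceil>" for n
      using \<open>T > 0\<close> that by (intro dif) linarith+
    then show "\<forall>\<^sub>F n in sequentially. norm (K (real (Suc n)) - K T) \<le> C * tail_log T"
      using eventually_ge_at_top by (rule eventually_mono[rotated])
  qed simp
  moreover have "(K \<longlongrightarrow> l) at_top"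
  proof -
    have "\<forall>\<^sub>F T in at_top. norm (K T - l) \<le> C * tail_log T"
      using eventually_gt_at_top[of 0] by (rule eventually_mono) (rule le)
    then have "((\<lambda>T. K T - l) \<longlongrightarrow> 0) at_top" by (rule Lim_null_comparison[OF _ lim0])
    then show ?thesis by (simp add: LIM_zero_iff)
  qed
  ultimately show ?thesis using that by blast
qed

text \<open>
  The bound on \<open>z f'(z) / f(z)\<close> says that the derivative \<open>f' / f\<close> of a logarithm of \<open>f\<close> along the
  ray is dominated by a multiple of the derivative of \<open>tail_log\<close>. A continuous logarithm therefore has a limit at
  infinity, a multiple of \<open>2 \<pi> i\<close>; subtracting it gives the logarithm of the ray, which is in turn
  dominated by \<open>tail_log\<close>.
\<close>

lemma ray_continuous_log:
  fixes f f' :: "complex \<Rightarrow> complex"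
  assumes der: "\<And>z. z \<in> open_ray \<theta> \<Longrightarrow> (f has_field_derivative f' z) (at z)"
    and nz: "\<And>z. z \<in> open_ray \<theta> \<Longrightarrow> f z \<noteq> 0"
    and lim: "((\<lambda>s. f (of_real s * cis \<theta>)) \<longlongrightarrow> 1) at_top"
    and C: "C \<ge> 0"
    and bnd: "\<And>z. z \<in> open_ray \<theta> \<Longrightarrow> norm (z * f' z / f z) \<le> C / (1 + (norm z)\<^sup>2)"
  shows ray_log_exists: "\<exists>L. is_ray_log \<theta> f L"
    and ray_log_has_vector_derivative: "\<And>L s. is_ray_log \<theta> f L \<Longrightarrow> s > 0 \<Longrightarrow>
      ((\<lambda>s. L (of_real s * cis \<theta>)) has_vector_derivative
        cis \<theta> * f' (of_real s * cis \<theta>) / f (of_real s * cis \<theta>)) (at s)"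
    and ray_log_bound: "\<And>L s. is_ray_log \<theta> f L \<Longrightarrow> s > 0 \<Longrightarrow>
      norm (L (of_real s * cis \<theta>)) \<le> C * tail_log s"
proof -
  define r where "r s = complex_of_real s * cis \<theta>" for s
  have r_in: "r s \<in> open_ray \<theta>" if "s > 0" for s using that by (auto simp: r_def open_ray_def)
  have r_norm: "norm (r s) = s" if "s > 0" for s using that by (simp add: r_def norm_mult)
  define F where "F s = f (r s)" for s
  define K' where "K' s = cis \<theta> * f' (r s) / f (r s)" for s
  have dr: "(r has_vector_derivative cis \<theta>) (at s)" for s
    unfolding r_def by (auto intro!: derivative_eq_intros simp: has_vector_derivative_def scaleR_conv_of_real)
  have dF: "(F has_vector_derivative cis \<theta> * f' (r s)) (at s)" if "s > 0" for s
    using field_vector_diff_chain_at[OF dr der[OF r_in[OF that]]] unfolding F_def o_def .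
  have F0: "F s \<noteq> 0" if "s > 0" for s unfolding F_def using nz r_in that by blast
  have dlog: "(K has_vector_derivative K' s) (at s)"
    if "s > 0" "continuous_on {0<..} K" "\<And>s. s > 0 \<Longrightarrow> exp (K s) = F s" for K :: "real \<Rightarrow> complex" and s
  proof -
    have "\<forall>\<^sub>F t in nhds s. t \<in> {0<..}" using that(1) by (intro eventually_nhds_in_open) auto
    then have "\<forall>\<^sub>F t in nhds s. exp (K t) = F t" by eventually_elim (use that(3) in auto)
    then show ?thesis
      unfolding K'_def F_def[symmetric]
      by (intro continuous_log_has_vector_derivative dF that)
        (use that(1,2) continuous_on_eq_continuous_at[of "{0<..}" K] in auto)
  qed
  have K'_bnd: "norm (K' s) \<le> C / (s * (1 + s\<^sup>2))" if s: "s > 0" for s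
  proof -
    have "norm (r s * f' (r s) / f (r s)) \<le> C / (1 + s\<^sup>2)" using bnd[OF r_in[OF s]] r_norm[OF s] by simp
    moreover have "r s * f' (r s) / f (r s) = of_real s * K' s" by (simp add: K'_def r_def)
    ultimately have "norm (K' s) * s \<le> C / (1 + s\<^sup>2)" using s by (simp add: norm_mult mult.commute)
    then have "norm (K' s) \<le> C / (1 + s\<^sup>2) / s" by (simp only: pos_le_divide_eq[OF s])
    then show ?thesis by (simp add: mult.commute)
  qed
  have lim_log: "\<exists>l. (\<forall>s>0. norm (K s - l) \<le> C * tail_log s) \<and> (K \<longlongrightarrow> l) at_top \<and> exp l = 1"
    if "continuous_on {0<..} K" "\<And>s. s > 0 \<Longrightarrow> exp (K s) = F s" for K :: "real \<Rightarrow> complex"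
  proof -
    obtain l where l: "\<And>T. T > 0 \<Longrightarrow> norm (K T - l) \<le> C * tail_log T" "(K \<longlongrightarrow> l) at_top"
    proof (rule limit_at_top_with_tail_bound[of K K' C])
      show "(K has_vector_derivative K' s) (at s)" if "s > 0" for s
        using dlog[OF \<open>s > 0\<close>] \<open>continuous_on {0<..} K\<close> \<open>\<And>s. s > 0 \<Longrightarrow> exp (K s) = F s\<close> by blast
    qed (use K'_bnd C in auto)
    have "((\<lambda>s. exp (K s)) \<longlongrightarrow> exp l) at_top" by (intro tendsto_intros l)
    moreover have "((\<lambda>s. exp (K s)) \<longlongrightarrow> 1) at_top"
    proof (rule Lim_transform_eventually[OF lim])
      show "\<forall>\<^sub>F s in at_top. f (of_real s * cis \<theta>) = exp (K s)"
        using eventually_gt_at_top[of 0] by eventually_elim (simp add: that(2) F_def r_def)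
    qed
    ultimately have "exp l = 1" by (intro tendsto_unique) auto
    then show ?thesis using l by blast
  qed
  show "\<exists>L. is_ray_log \<theta> f L"
  proof -
    have "continuous_on {0<..} F"
      using dF by (intro continuous_at_imp_continuous_on ballI has_vector_derivative_continuous[OF dF]) auto
    moreover have "contractible {0::real<..}" by (intro convex_imp_contractible convex_real_interval)
    ultimately obtain G where G: "continuous_on {0<..} G" "\<And>s. s \<in> {0<..} \<Longrightarrow> F s = exp (G s)"
      using F0 by (rule continuous_logarithm_on_contractible) auto
    obtain l where l: "(G \<longlongrightarrow> l) at_top" "exp l = 1" using lim_log[of G] G by auto
    define L where "L z = G (norm z) - l" for z :: complex
    have "continuous_on (open_ray \<theta>) L"
      unfolding L_def by (intro continuous_intros continuous_on_compose2[OF G(1)])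
        (auto simp: open_ray_def norm_mult)
    moreover have "exp (L z) = f z" if "z \<in> open_ray \<theta>" for z
    proof -
      obtain s where s: "s > 0" "z = r s" using \<open>z \<in> open_ray \<theta>\<close> by (auto simp: open_ray_def r_def)
      then show ?thesis using G(2)[of s] l(2) by (simp add: L_def r_norm exp_diff F_def)
    qed
    moreover have "((\<lambda>s. Im (L (r s))) \<longlongrightarrow> 0) at_top"
    proof -
      have *: "((\<lambda>s. Im (G s - l)) \<longlongrightarrow> 0) at_top"
        using tendsto_Im[OF tendsto_diff[OF l(1) tendsto_const[of l]]] by simp
      show "((\<lambda>s. Im (L (r s))) \<longlongrightarrow> 0) at_top"
      proof (rule Lim_transform_eventually[OF *])
        show "\<forall>\<^sub>F s in at_top. Im (G s - l) = Im (L (r s))"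
          using eventually_gt_at_top[of 0] by eventually_elim (simp add: L_def r_norm)
      qed
    qed
    ultimately show ?thesis unfolding is_ray_log_def r_def by blast
  qed
  fix L :: "complex \<Rightarrow> complex" and s :: real
  assume L: "is_ray_log \<theta> f L" and s: "s > 0"
  have K: "continuous_on {0<..} (\<lambda>s. L (r s))"
  proof (rule continuous_on_compose2[of "open_ray \<theta>" L _ r])
    show "continuous_on (open_ray \<theta>) L" using L by (simp add: is_ray_log_def)
    show "continuous_on {0<..} r" unfolding r_def by (intro continuous_intros)
  qed (use r_in in auto)
  have expK: "exp (L (r s)) = F s" if "s > 0" for s
    using L r_in[OF that] by (simp add: is_ray_log_def F_def)
  show "((\<lambda>s. L (of_real s * cis \<theta>)) has_vector_derivative
        cis \<theta> * f' (of_real s * cis \<theta>) / f (of_real s * cis \<theta>)) (at s)"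
    using dlog[OF s K expK] by (simp add: r_def K'_def)
  obtain l where l: "\<And>s. s>0 \<Longrightarrow> norm (L (r s) - l) \<le> C * tail_log s"
    "((\<lambda>s. L (r s)) \<longlongrightarrow> l) at_top" "exp l = 1"
    using lim_log[OF K expK] by blast
  have "((\<lambda>s. Im (L (r s))) \<longlongrightarrow> Im l) at_top" by (intro tendsto_intros l)
  moreover have "((\<lambda>s. Im (L (r s))) \<longlongrightarrow> 0) at_top" using L by (simp add: is_ray_log_def r_def)
  ultimately have "Im l = 0" by (rule tendsto_unique[rotated]) auto
  moreover have "Re l = 0" using l(3) unfolding exp_eq_1 by simp
  ultimately have "l = 0" by (simp add: complex_eq_iff)
  then show "norm (L (of_real s * cis \<theta>)) \<le> C * tail_log s" using l(1)[OF s] by (simp add: r_def)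
qed

text \<open>
  Integration by parts on a ray: \<open>s L(s)\<close> has the derivative \<open>L + z f' / f\<close> and tends to \<open>0\<close> at both
  ends of the ray, by the majorant \<open>tail_log\<close>.
\<close>

lemma ray_log_integral:
  fixes f f' :: "complex \<Rightarrow> complex"
  assumes der: "\<And>z. z \<in> open_ray \<theta> \<Longrightarrow> (f has_field_derivative f' z) (at z)"
    and cont: "continuous_on (open_ray \<theta>) f'"
    and nz: "\<And>z. z \<in> open_ray \<theta> \<Longrightarrow> f z \<noteq> 0"
    and lim: "((\<lambda>s. f (of_real s * cis \<theta>)) \<longlongrightarrow> 1) at_top"
    and C: "C \<ge> 0"
    and bnd: "\<And>z. z \<in> open_ray \<theta> \<Longrightarrow> norm (z * f' z / f z) \<le> C / (1 + (norm z)\<^sup>2)"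
    and L: "is_ray_log \<theta> f L"
  defines "r \<equiv> (\<lambda>s. complex_of_real s * cis \<theta>)"
  shows "continuous_on {0<..} (\<lambda>s. L (r s))"
    and "set_integrable lborel {0<..} (\<lambda>s. L (r s))"
    and "set_integrable lborel {0<..} (\<lambda>s. r s * f' (r s) / f (r s))"
    and "(LINT s:{0<..}|lborel. L (r s)) = - (LINT s:{0<..}|lborel. r s * f' (r s) / f (r s))"
proof -
  define K where "K s = L (r s)" for s
  define g where "g s = r s * f' (r s) / f (r s)" for s
  have r_in: "r s \<in> open_ray \<theta>" if "s > 0" for s using that by (auto simp: r_def open_ray_def)
  have cr: "continuous_on {0<..} r" unfolding r_def by (intro continuous_intros)
  have cf: "continuous_on (open_ray \<theta>) f"
    by (intro continuous_at_imp_continuous_on ballI DERIV_isCont[OF der])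
  have dK: "(K has_vector_derivative cis \<theta> * f' (r s) / f (r s)) (at s)" if "s > 0" for s
    using ray_log_has_vector_derivative[OF der nz lim C bnd L that] by (simp add: K_def[abs_def] r_def)
  have K_bnd: "norm (K s) \<le> C * tail_log s" if "s > 0" for s
    using ray_log_bound[OF der nz lim C bnd L that] by (simp add: K_def r_def)
  have cK: "continuous_on {0<..} K"
    using dK by (intro continuous_at_imp_continuous_on ballI has_vector_derivative_continuous[OF dK]) auto
  then show "continuous_on {0<..} (\<lambda>s. L (r s))" by (simp add: K_def[abs_def])
  have cg: "continuous_on {0<..} g"
    unfolding g_def
    by (intro continuous_intros cr continuous_on_compose2[OF cont cr] continuous_on_compose2[OF cf cr])
      (use r_in nz in auto)
  have iK: "set_integrable lborel {0<..} K"
  proof (rule set_integrable_bound)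
    show "set_integrable lborel {0<..} (\<lambda>s. C * tail_log s)" using integrable_tail_log by simp
    show "set_borel_measurable lborel {0<..} K"
      using set_measurable_continuous_on[OF _ cK] by (simp add: set_borel_measurable_def)
    show "AE s in lborel. s \<in> {0<..} \<longrightarrow> norm (K s) \<le> norm (C * tail_log s)"
      using K_bnd C tail_log_nonneg by (auto simp: abs_of_nonneg)
  qed
  then show "set_integrable lborel {0<..} (\<lambda>s. L (r s))" by (simp add: K_def[abs_def])
  have ig: "set_integrable lborel {0<..} g"
  proof (rule set_integrable_bound)
    show "set_integrable lborel {0<..} (\<lambda>s. C * (1 / (1 + s\<^sup>2)))"
      using integrable_inverse_one_plus_square by (intro set_integrable_mult_right)
    show "set_borel_measurable lborel {0<..} g"
      using set_measurable_continuous_on[OF _ cg] by (simp add: set_borel_measurable_def)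
    have "norm (g s) \<le> norm (C * (1 / (1 + s\<^sup>2)))" if "s > 0" for s
      using bnd[OF r_in[OF that]] that C unfolding g_def
      by (simp add: r_def norm_mult norm_divide add_nonneg_nonneg)
    then show "AE s in lborel. s \<in> {0<..} \<longrightarrow> norm (g s) \<le> norm (C * (1 / (1 + s\<^sup>2)))" by auto
  qed
  then show "set_integrable lborel {0<..} (\<lambda>s. r s * f' (r s) / f (r s))" by (simp add: g_def[abs_def])
  have ei: "einterval 0 \<infinity> = {0<..}" by (auto simp: einterval_def)
  have lims: "((\<lambda>s. of_real s * K s) \<longlongrightarrow> 0) F"
    if "((\<lambda>s. s * (C * tail_log s)) \<longlongrightarrow> 0) F" "\<forall>\<^sub>F s in F. s > 0" for F
  proof (rule Lim_null_comparison[OF _ that(1)])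
    show "\<forall>\<^sub>F s in F. norm (of_real s * K s) \<le> s * (C * tail_log s)"
      using that(2) by eventually_elim (auto simp: norm_mult intro: K_bnd)
  qed
  have "(LBINT s=0..\<infinity>. K s + g s) = 0 - 0"
  proof (rule interval_integral_FTC_integrable)
    fix x :: real assume "0 < ereal x"
    then have x: "x > 0" by simp
    show "((\<lambda>s. of_real s * K s) has_vector_derivative K x + g x) (at x)"
      using dK[OF x] by (auto intro!: derivative_eq_intros simp: g_def r_def has_vector_derivative_def fun_eq_iff scaleR_conv_of_real algebra_simps)
    show "isCont (\<lambda>s. K s + g s) x"
      using continuous_on_add[OF cK cg] x by (simp add: continuous_on_eq_continuous_at)
  next
    show "set_integrable lborel (einterval 0 \<infinity>) (\<lambda>s. K s + g s)"
      unfolding ei using iK ig by (rule set_integral_add)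
    show "(((\<lambda>s. of_real s * K s) \<circ> real_of_ereal) \<longlongrightarrow> 0) (at_right 0)"
      unfolding zero_ereal_def ereal_tendsto_simps1
      by (rule lims) (unfold tail_log_def, real_asymp, simp add: eventually_at_right_less)
    show "(((\<lambda>s. of_real s * K s) \<circ> real_of_ereal) \<longlongrightarrow> 0) (at_left \<infinity>)"
      unfolding ereal_tendsto_simps1
      by (rule lims) (unfold tail_log_def, real_asymp, simp add: eventually_gt_at_top)
  qed simp
  then have "(LINT s:{0<..}|lborel. K s + g s) = 0"
    unfolding interval_lebesgue_integral_def ei by simp
  then have "(LINT s:{0<..}|lborel. K s) + (LINT s:{0<..}|lborel. g s) = 0"
    by (simp add: set_integral_add(2)[OF iK ig])
  then show "(LINT s:{0<..}|lborel. L (r s)) = - (LINT s:{0<..}|lborel. r s * f' (r s) / f (r s))"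
    by (simp add: K_def g_def eq_neg_iff_add_eq_0)
qed

section \<open>Integrals along the two sides of a wedge\<close>

lemma set_integral_inverse_substitution:
  fixes h :: "real \<Rightarrow> complex"
  assumes cont: "continuous_on {0<..} h" and int: "set_integrable lborel {0<..} h"
  shows "set_integrable lborel {0<..} (\<lambda>t. h (1 / t) / of_real (t\<^sup>2))"
    and "(LINT t:{0<..}|lborel. h (1 / t) / of_real (t\<^sup>2)) = (LINT s:{0<..}|lborel. h s)"
proof -
  define f where "f t = h (1 / t) / of_real (t\<^sup>2)" for t :: real
  have e1: "einterval (-\<infinity>) 0 = {..<0}" "einterval 0 \<infinity> = {0<..}" by (auto simp: einterval_def)
  have cf: "isCont f t" if "t > 0" for t
  proof -
    have "continuous_on {0<..} f"
      unfolding f_def by (intro continuous_intros continuous_on_compose2[OF cont]) auto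
    then show ?thesis using that by (simp add: continuous_on_eq_continuous_at)
  qed
  have refl: "set_integrable lborel {..<0} (\<lambda>x. h (- x))"
    using lborel_integrable_real_affine[OF int[unfolded set_integrable_def], of "-1" 0]
    by (simp add: set_integrable_def indicator_def of_bool_def)
  have hf: "f (- 1 / x) * of_real (1 / x\<^sup>2) = h (- x)" if "x < 0" for x
    using that by (simp add: f_def power_divide)
  have lims: "((ereal \<circ> (\<lambda>x. - 1 / x) \<circ> real_of_ereal) \<longlongrightarrow> 0) (at_right (-\<infinity>))"
    "((ereal \<circ> (\<lambda>x. - 1 / x) \<circ> real_of_ereal) \<longlongrightarrow> \<infinity>) (at_left 0)"
    unfolding zero_ereal_def ereal_tendsto_simps by real_asymp+
  have dg: "DERIV (\<lambda>x. - 1 / x) x :> 1 / x\<^sup>2" if "x < 0" for x :: real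
    using that by (auto intro!: derivative_eq_intros simp: power2_eq_square)
  \<comment> \<open>The substitution rules ask for an increasing map; so \<open>x \<mapsto> - 1 / x\<close> on the negative axis is used,
    combined with the reflection \<open>x \<mapsto> - x\<close>.\<close>
  have "set_integrable lborel (einterval 0 \<infinity>) (\<lambda>t. norm (f t))"
  proof (rule interval_integral_substitution_nonneg(1)[where a = "-\<infinity>" and b = 0 and g = "\<lambda>x. - 1 / x" and g' = "\<lambda>x. 1 / x\<^sup>2"])
    have "set_integrable lborel {..<0} (\<lambda>x. norm (h (- x)))"
      using refl by (rule set_integrable_norm)
    also have "set_integrable lborel {..<0} (\<lambda>x. norm (h (- x))) \<longleftrightarrow>
      set_integrable lborel {..<0} (\<lambda>x. norm (f (- 1 / x)) * (1 / x\<^sup>2))"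
    proof (rule set_integrable_cong)
      fix x :: real assume "x \<in> {..<0}"
      then have "norm (h (- x)) = norm (f (- 1 / x) * of_real (1 / x\<^sup>2))" using hf[of x] by simp
      then show "norm (h (- x)) = norm (f (- 1 / x)) * (1 / x\<^sup>2)" by (simp add: norm_mult norm_divide norm_power)
    qed auto
    finally show "set_integrable lborel (einterval (- \<infinity>) 0) (\<lambda>x. norm (f (- 1 / x)) * (1 / x\<^sup>2))"
      unfolding e1 .
    show "isCont (\<lambda>t. norm (f t)) (- 1 / x)" if "ereal x < 0" for x
      using cf[of "- 1 / x"] that by (intro continuous_intros) (auto simp: divide_simps)
  qed (use dg lims in \<open>auto intro!: continuous_intros\<close>)
  then have nf: "set_integrable lborel {0<..} (\<lambda>t. norm (f t))" unfolding e1 .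
  have "continuous_on {0<..} f" using cf by (simp add: continuous_at_imp_continuous_on)
  then have mf: "set_borel_measurable lborel {0<..} f"
    using set_measurable_continuous_on[of "{0<..}" f] by (simp add: set_borel_measurable_def)
  have fi: "set_integrable lborel {0<..} f"
    by (rule set_integrable_bound[OF nf mf]) auto
  then show "set_integrable lborel {0<..} (\<lambda>t. h (1 / t) / of_real (t\<^sup>2))"
    by (simp add: f_def[abs_def])
  have "(LBINT x=0..\<infinity>. f x) = (LBINT x=-\<infinity>..0. (1 / x\<^sup>2) *\<^sub>R f (- 1 / x))"
  proof (rule interval_integral_substitution_integrable[where g = "\<lambda>x. - 1 / x" and g' = "\<lambda>x. 1 / x\<^sup>2"])
    have "set_integrable lborel {..<0} (\<lambda>x. (1 / x\<^sup>2) *\<^sub>R f (- 1 / x)) \<longleftrightarrow> set_integrable lborel {..<0} (\<lambda>x. h (- x))"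
      using hf by (intro set_integrable_cong) (auto simp: scaleR_conv_of_real mult.commute)
    then show "set_integrable lborel (einterval (- \<infinity>) 0) (\<lambda>x. (1 / x\<^sup>2) *\<^sub>R f (- 1 / x))"
      unfolding e1 using refl by simp
    show "set_integrable lborel (einterval 0 \<infinity>) f" unfolding e1 by (rule fi)
    show "isCont f (- 1 / x)" if "ereal x < 0" for x
      using cf[of "- 1 / x"] that by (auto simp: divide_simps)
  qed (use dg lims in \<open>auto intro!: continuous_intros\<close>)
  then have "(LINT t:{0<..}|lborel. f t) = (LINT x:{..<0}|lborel. (1 / x\<^sup>2) *\<^sub>R f (- 1 / x))"
    by (simp add: interval_lebesgue_integral_def e1)
  also have "\<dots> = (LINT x:{..<0}|lborel. h (- x))"
    using hf by (intro set_lebesgue_integral_cong) (auto simp: scaleR_conv_of_real mult.commute)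
  also have "\<dots> = (LINT s:{0<..}|lborel. h s)"
    by (subst (2) set_integral_reflect) (simp add: lessThan_def)
  finally show "(LINT t:{0<..}|lborel. h (1 / t) / of_real (t\<^sup>2)) = (LINT s:{0<..}|lborel. h s)"
    by (simp add: f_def)
qed

lemma contour_integral_linepath_ray:
  assumes "R > 0"
  shows "contour_integral (linepath 0 (of_real R * c)) g = c * integral {0..R} (\<lambda>s. g (of_real s * c))"
proof -
  have im: "(\<lambda>x. x / R) ` {0..R} = {0..1}"
    using assms by (auto simp: image_iff intro!: bexI[of _ "_ * R"] mult_left_le_one_le)
  have "integral {0..1} (\<lambda>x. g (of_real (R * x) * c)) = (1 / R) *\<^sub>R integral {0..R} (\<lambda>s. g (of_real s * c))"
    using integral_stretch_real[of R 0 R "\<lambda>s. g (of_real s * c)"] assms im by simp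
  then show ?thesis
    using assms
    by (simp add: contour_integral_integral linepath_def scaleR_conv_of_real mult_ac)
qed

text \<open>
  The closed wedge of all points with argument between \<open>0\<close> and \<open>\<alpha>\<close>, described by inequalities;
  this description is meant for \<open>0 < \<alpha> \<le> \<pi>/2\<close>.
\<close>

definition wedge :: "real \<Rightarrow> complex set" where
  "wedge \<alpha> = {z. Im z \<ge> 0 \<and> cos \<alpha> * Im z \<le> sin \<alpha> * Re z}"

lemma convex_wedge: "convex (wedge \<alpha>)"
proof -
  have "wedge \<alpha> = {z. \<i> \<bullet> z \<ge> 0} \<inter> {z. Complex (- sin \<alpha>) (cos \<alpha>) \<bullet> z \<le> 0}"
    by (auto simp: wedge_def inner_complex_def)
  then show ?thesis by (simp only:) (intro convex_Int convex_halfspace_ge convex_halfspace_le)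
qed

lemma ray_in_wedge:
  assumes "s \<ge> 0" "0 \<le> \<theta>" "\<theta> \<le> \<alpha>" "\<alpha> \<le> pi / 2"
  shows "of_real s * cis \<theta> \<in> wedge \<alpha>"
proof -
  have "sin (\<alpha> - \<theta>) \<ge> 0" "sin \<theta> \<ge> 0" using assms by (auto intro!: sin_ge_zero)
  then have "s * sin (\<alpha> - \<theta>) \<ge> 0" "s * sin \<theta> \<ge> 0" using assms by auto
  then show ?thesis by (auto simp: wedge_def sin_diff algebra_simps)
qed

lemma wedge_triangle_subset:
  assumes "0 < \<alpha>" "\<alpha> \<le> pi / 2" "R \<ge> 0"
  shows "convex hull {0, of_real R, of_real R * cis \<alpha>} \<subseteq> wedge \<alpha>"
proof (rule hull_minimal)
  show "{0, of_real R, of_real R * cis \<alpha>} \<subseteq> wedge \<alpha>"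
    using ray_in_wedge[of 0 0 \<alpha>] ray_in_wedge[of R 0 \<alpha>] ray_in_wedge[of R \<alpha> \<alpha>] assms by auto
qed (rule convex_wedge)

text \<open>
  The condition on \<open>R\<close> says \<open>R > a + b\<close> for the oblique coordinates \<open>v = a + b e\<^bsup>i\<alpha>\<^esup>\<close>.
\<close>

lemma winding_number_wedge_triangle:
  fixes v :: complex
  assumes \<alpha>: "0 < \<alpha>" "\<alpha> \<le> pi / 2"
    and v: "Im v > 0" "cos \<alpha> * Im v < sin \<alpha> * Re v"
    and R: "R * sin \<alpha> > Re v * sin \<alpha> + Im v * (1 - cos \<alpha>)"
  shows "v \<in> interior (convex hull {0, of_real R, of_real R * cis \<alpha>})"
    and "winding_number (linepath 0 (of_real R) +++ linepath (of_real R) (of_real R * cis \<alpha>) +++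
      linepath (of_real R * cis \<alpha>) 0) v = 1"
proof -
  have s: "sin \<alpha> > 0" using \<alpha> pi_gt_zero by (intro sin_gt_zero) auto
  define b where "b = Im v / sin \<alpha>"
  define a where "a = Re v - b * cos \<alpha>"
  have b: "b > 0" using v s by (simp add: b_def)
  have a: "a > 0" using v s by (simp add: a_def b_def field_simps)
  have bs: "b * sin \<alpha> = Im v" using s by (simp add: b_def)
  have "sin \<alpha> * (a + b) = Re v * sin \<alpha> - (b * sin \<alpha>) * cos \<alpha> + b * sin \<alpha>"
    by (simp add: a_def algebra_simps)
  then have "sin \<alpha> * (a + b) < sin \<alpha> * R" using R unfolding bs by (simp add: algebra_simps)
  then have ab: "a + b < R" using s by simp
  then have R0: "R > 0" using a b by simp
  have veq: "v = of_real a + of_real b * cis \<alpha>"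
    using s by (simp add: complex_eq_iff a_def b_def)
  have ncol: "\<not> collinear {0, complex_of_real R, of_real R * cis \<alpha>}"
  proof
    assume "collinear {0, complex_of_real R, of_real R * cis \<alpha>}"
    then have "\<exists>c. of_real R * cis \<alpha> = c *\<^sub>R complex_of_real R"
      using R0 by (auto simp: collinear_lemma)
    then obtain c where "of_real R * cis \<alpha> = c *\<^sub>R complex_of_real R" by blast
    then have "Im (of_real R * cis \<alpha>) = Im (c *\<^sub>R complex_of_real R)" by simp
    then show False using s R0 by simp
  qed
  show int: "v \<in> interior (convex hull {0, of_real R, of_real R * cis \<alpha>})"
    unfolding interior_convex_hull_3_minimal[OF ncol DIM_complex]
  proof (intro CollectI exI conjI)
    have "(a + b) / R < 1" using ab R0 by simp
    then show "0 < 1 - a / R - b / R" by (simp add: add_divide_distrib)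
    show "0 < a / R" "0 < b / R" using a b R0 by auto
    show "(1 - a / R - b / R) *\<^sub>R 0 + (a / R) *\<^sub>R complex_of_real R + (b / R) *\<^sub>R (of_real R * cis \<alpha>) = v"
      using R0 by (simp add: veq scaleR_conv_of_real)
  qed simp
  have "Im ((of_real R - 0) * cnj (of_real R - v)) = R * Im v" by simp
  then show "winding_number (linepath 0 (of_real R) +++ linepath (of_real R) (of_real R * cis \<alpha>) +++
      linepath (of_real R * cis \<alpha>) 0) v = 1"
    using winding_number_triangle[OF int] R0 v by simp
qed

text \<open>
  Cauchy's integral formula on the triangle with corners \<open>0\<close>, \<open>R\<close>, \<open>R e\<^bsup>i\<alpha>\<^esup>\<close>. On the third side the
  integrand is \<open>O(R\<^sup>-\<^sup>2)\<close>, because that side keeps a distance of at least \<open>R / \<surd>2\<close> from the origin; so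
  this side contributes \<open>O(1 / R)\<close>.
\<close>

lemma wedge_ray_integral:
  fixes A M :: "complex poly" and v :: complex
  assumes \<alpha>: "0 < \<alpha>" "\<alpha> \<le> pi / 2"
    and v: "Im v > 0" "cos \<alpha> * Im v < sin \<alpha> * Re v"
    and deg: "degree A + 2 \<le> degree ([:- v, 1:] * M)"
    and M: "\<And>z. z \<in> wedge \<alpha> \<Longrightarrow> poly M z \<noteq> 0"
  defines "g \<equiv> (\<lambda>z. poly A z / poly ([:- v, 1:] * M) z)"
  assumes int: "\<And>\<theta>. \<theta> \<in> {0, \<alpha>} \<Longrightarrow> set_integrable lborel {0<..} (\<lambda>s. g (of_real s * cis \<theta>))"
  shows "(LINT s:{0<..}|lborel. g (of_real s)) - cis \<alpha> * (LINT s:{0<..}|lborel. g (of_real s * cis \<alpha>))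
    = 2 * pi * \<i> * (poly A v / poly M v)"
proof -
  define h where "h z = poly A z / poly M z" for z
  have gh: "g = (\<lambda>z. h z / (z - v))"
    by (simp add: g_def h_def fun_eq_iff algebra_simps)
  have s: "sin \<alpha> > 0" using \<alpha> pi_gt_zero by (intro sin_gt_zero) auto
  obtain C R0 where CR: "R0 > 0" "C \<ge> 0" "\<And>z. norm z \<ge> R0 \<Longrightarrow> norm (g z) \<le> C / (norm z)\<^sup>2"
    using poly_ratio_bound[OF deg] unfolding g_def by metis
  define J where "J \<theta> R = integral {0..R} (\<lambda>s. g (of_real s * cis \<theta>))" for \<theta> R
  have J_lim: "(J \<theta> \<longlongrightarrow> (LINT s:{0<..}|lborel. g (of_real s * cis \<theta>))) at_top" if "\<theta> \<in> {0, \<alpha>}" for \<theta>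
  proof -
    have eq1: "(LINT s:{0..}|lborel. k s) = (LINT s:{0<..}|lborel. k s)" for k :: "real \<Rightarrow> complex"
      by (rule set_integral_discrete_difference[where X = "{0}"]) auto
    have eq2: "set_integrable lborel {0..} k = set_integrable lborel {0<..} k" for k :: "real \<Rightarrow> complex"
      by (rule set_integrable_discrete_difference[where X = "{0}"]) auto
    have i0: "set_integrable lborel {0..} (\<lambda>s. g (of_real s * cis \<theta>))" using int[OF that] eq2 by simp
    have "((\<lambda>R. LINT s:{0..R}|lborel. g (of_real s * cis \<theta>)) \<longlongrightarrow> (LINT s:{0..}|lborel. g (of_real s * cis \<theta>))) at_top"
      by (intro tendsto_set_lebesgue_integral_at_top i0) auto
    moreover have "(LINT s:{0..R}|lborel. g (of_real s * cis \<theta>)) = J \<theta> R" for R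
      unfolding J_def
      by (intro set_borel_integral_eq_integral set_integrable_subset[OF i0]) auto
    ultimately show ?thesis by (simp add: eq1)
  qed
  have key: "norm (J 0 R - cis \<alpha> * J \<alpha> R - 2 * pi * \<i> * h v) \<le> 4 * C / R"
    if R: "R > 2 * R0" "R * sin \<alpha> > Re v * sin \<alpha> + Im v * (1 - cos \<alpha>)" for R
  proof -
    have Rpos: "R > 0" using R CR by simp
    let ?a = "complex_of_real R" and ?b = "of_real R * cis \<alpha>"
    let ?S = "convex hull {0, ?a, ?b}"
    let ?p = "linepath 0 ?a +++ linepath ?a ?b +++ linepath ?b 0"
    have vint: "v \<in> interior ?S" and wn: "winding_number ?p v = 1"
      using winding_number_wedge_triangle[OF \<alpha> v R(2)] by auto
    have hol: "h holomorphic_on ?S"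
      unfolding h_def using M wedge_triangle_subset[OF \<alpha>, of R] Rpos
      by (intro holomorphic_intros) auto
    have nv: "v \<notin> closed_segment 0 ?a" "v \<notin> closed_segment ?a ?b" "v \<notin> closed_segment ?b 0"
      using vint unfolding interior_of_triangle[OF DIM_complex] by auto
    have sub: "closed_segment 0 ?a \<subseteq> ?S" "closed_segment ?a ?b \<subseteq> ?S" "closed_segment ?b 0 \<subseteq> ?S"
      by (auto simp: segment_convex_hull intro!: hull_mono)
    have cg: "continuous_on (?S - {v}) g"
      unfolding gh using holomorphic_on_imp_continuous_on[OF hol]
      by (intro continuous_intros) (auto intro: continuous_on_subset)
    have ci: "g contour_integrable_on linepath 0 ?a" "g contour_integrable_on linepath ?a ?b"
       "g contour_integrable_on linepath ?b 0"
      using sub nv by (auto intro!: contour_integrable_continuous_linepath continuous_on_subset[OF cg])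
    have "(g has_contour_integral (2 * pi * \<i> * winding_number ?p v * h v)) ?p"
      unfolding gh
    proof (rule Cauchy_integral_formula_convex_simple[OF convex_convex_hull hol vint])
      show "path_image ?p \<subseteq> ?S - {v}" using sub nv by (auto simp: path_image_join)
    qed (auto simp: valid_path_join)
    then have "contour_integral ?p g = 2 * pi * \<i> * h v" using wn contour_integral_unique by force
    moreover have "contour_integral ?p g =
        contour_integral (linepath 0 ?a) g + (contour_integral (linepath ?a ?b) g + contour_integral (linepath ?b 0) g)"
      using ci by (subst contour_integral_join contour_integrable_joinI; simp)+
    moreover have "contour_integral (linepath ?b 0) g = - contour_integral (linepath 0 ?b) g"
      using ci(3) contour_integral_reverse_linepath sub nv cg
      by (metis closed_segment_commute continuous_on_subset subset_Diff_insert Diff_empty)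
    moreover have "contour_integral (linepath 0 ?a) g = J 0 R"
      using contour_integral_linepath_ray[OF Rpos, of 1 g] by (simp add: J_def)
    moreover have "contour_integral (linepath 0 ?b) g = cis \<alpha> * J \<alpha> R"
      using contour_integral_linepath_ray[OF Rpos, of "cis \<alpha>" g] by (simp add: J_def)
    ultimately have eq: "J 0 R - cis \<alpha> * J \<alpha> R - 2 * pi * \<i> * h v = - contour_integral (linepath ?a ?b) g"
      by (simp add: algebra_simps)
    have "norm (contour_integral (linepath ?a ?b) g) \<le> 2 * C / R\<^sup>2 * norm (?b - ?a)"
    proof (rule contour_integral_bound_linepath[OF ci(2)])
      fix z assume "z \<in> closed_segment ?a ?b"
      then obtain u where u: "0 \<le> u" "u \<le> 1" "z = (1 - u) *\<^sub>R ?a + u *\<^sub>R ?b"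
        by (auto simp: in_segment)
      have cs: "cos \<alpha> \<ge> 0" using \<alpha> by (intro cos_ge_zero) auto
      have "(norm z)\<^sup>2 = R\<^sup>2 * ((1 - u)\<^sup>2 + u\<^sup>2 + 2 * u * (1 - u) * cos \<alpha>)"
      proof -
        have "(norm z)\<^sup>2 = (R * (1 - u) + R * u * cos \<alpha>)\<^sup>2 + (R * u * sin \<alpha>)\<^sup>2"
          unfolding cmod_power2 u by (simp add: algebra_simps)
        also have "\<dots> = R\<^sup>2 * ((1 - u)\<^sup>2 + u\<^sup>2 * ((cos \<alpha>)\<^sup>2 + (sin \<alpha>)\<^sup>2) + 2 * u * (1 - u) * cos \<alpha>)"
          by algebra
        finally show ?thesis by simp
      qed
      moreover have "(1 - u)\<^sup>2 + u\<^sup>2 \<ge> 1 / 2"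
        using zero_le_power2[of "2 * u - 1"] by (simp add: power2_eq_square algebra_simps)
      moreover have "2 * u * (1 - u) * cos \<alpha> \<ge> 0" using u cs by simp
      ultimately have "(norm z)\<^sup>2 = R\<^sup>2 * ((1 - u)\<^sup>2 + u\<^sup>2 + 2 * u * (1 - u) * cos \<alpha>)"
        "1 / 2 \<le> (1 - u)\<^sup>2 + u\<^sup>2 + 2 * u * (1 - u) * cos \<alpha>" by linarith+
      then have nz: "(norm z)\<^sup>2 \<ge> R\<^sup>2 * (1 / 2)"
        by (simp only: mult_left_mono zero_le_power2)
      have "R0\<^sup>2 \<le> R\<^sup>2 * (1 / 2)"
      proof -
        have "(2 * R0)\<^sup>2 \<le> R\<^sup>2" using R CR by (intro power_mono) auto
        moreover have "(2 * R0)\<^sup>2 = 4 * R0\<^sup>2" by (simp add: power_mult_distrib)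
        ultimately show ?thesis using zero_le_power2[of R0] by linarith
      qed
      then have "R0 \<le> norm z" using nz by (intro power2_le_imp_le[of R0]) auto
      then have "norm (g z) \<le> C / (norm z)\<^sup>2" by (rule CR)
      also have "\<dots> \<le> C / (R\<^sup>2 * (1 / 2))" using nz Rpos CR by (intro divide_left_mono) (auto intro!: mult_pos_pos)
      finally show "norm (g z) \<le> 2 * C / R\<^sup>2" by (simp add: mult.commute)
    qed (use CR in auto)
    also have "\<dots> \<le> 2 * C / R\<^sup>2 * (2 * R)"
    proof (rule mult_left_mono)
      show "norm (?b - ?a) \<le> 2 * R" using norm_triangle_ineq4[of ?b ?a] Rpos by (simp add: norm_mult)
    qed (use CR in auto)
    also have "\<dots> = 4 * C / R" using Rpos by (simp add: power2_eq_square)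
    finally show ?thesis unfolding eq norm_minus_cancel .
  qed
  have "((\<lambda>R. J 0 R - cis \<alpha> * J \<alpha> R - 2 * pi * \<i> * h v) \<longlongrightarrow> 0) at_top"
  proof (rule Lim_null_comparison)
    show "((\<lambda>R. 4 * C / R) \<longlongrightarrow> 0) at_top" by real_asymp
    have "\<forall>\<^sub>F R in at_top. R > (Re v * sin \<alpha> + Im v * (1 - cos \<alpha>)) / sin \<alpha>" by (rule eventually_gt_at_top)
    then show "\<forall>\<^sub>F R in at_top. norm (J 0 R - cis \<alpha> * J \<alpha> R - 2 * pi * \<i> * h v) \<le> 4 * C / R"
      using eventually_gt_at_top[of "2 * R0"]
      by eventually_elim (rule key, auto simp: pos_divide_less_eq[OF s])
  qed
  moreover have "((\<lambda>R. J 0 R - cis \<alpha> * J \<alpha> R - 2 * pi * \<i> * h v) \<longlongrightarrow>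
     (LINT s:{0<..}|lborel. g (of_real s * cis 0)) - cis \<alpha> * (LINT s:{0<..}|lborel. g (of_real s * cis \<alpha>)) - 2 * pi * \<i> * h v) at_top"
    by (intro tendsto_intros J_lim) auto
  ultimately have "(LINT s:{0<..}|lborel. g (of_real s * cis 0)) - cis \<alpha> * (LINT s:{0<..}|lborel. g (of_real s * cis \<alpha>)) - 2 * pi * \<i> * h v = 0"
    by (rule tendsto_unique[rotated, symmetric]) simp
  then show ?thesis by (simp add: h_def)
qed

section \<open>The logarithmic integral as a residue\<close>

lemma degree_times_pderiv_le: "degree ([:0, 1:] * pderiv q) \<le> degree (q :: 'a :: {idom, semiring_char_0} poly)"
proof (cases "degree q = 0")
  case False
  have "degree ([:0, 1:] * pderiv q) \<le> degree [:0, 1 :: 'a:] + degree (pderiv q)" by (rule degree_mult_le)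
  then show ?thesis using False by (simp add: degree_pderiv)
qed (auto simp: pderiv_eq_0_iff)

lemma poly_pderiv_power_mult:
  "z * poly (pderiv ([:0, 1:] ^ k * p)) z = z ^ k * (of_nat k * poly p z + z * poly (pderiv p) z)"
  for p :: "complex poly"
proof (cases k)
  case (Suc m)
  then show ?thesis
    by (simp add: pderiv_mult pderiv_power_Suc pderiv_pCons algebra_simps del: power_Suc)
      (simp add: algebra_simps)
qed simp

text \<open>
  With \<open>f = N / P\<close> the rational function \<open>g(z) = z f'(z) / f(z)\<close> is \<open>A / ((z - v) M)\<close> with
  polynomials \<open>A\<close> and \<open>M\<close>, where a possible zero of \<open>P\<close> of order \<open>k\<close> at the origin has been
  cancelled. The hypothesis \<open>deg P \<ge> deg Q + 2\<close> gives \<open>g = O(z\<^sup>-\<^sup>2)\<close>, and the residue of \<open>g\<close> at the simple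
  zero \<open>v\<close> of \<open>f\<close> is \<open>v\<close>.
\<close>

lemma log_integral_eq:
  fixes P Q :: "real poly" and x \<alpha> :: real and v :: complex
  defines "N \<equiv> cpoly (P - smult x Q)"
  assumes \<alpha>: "0 < \<alpha>" "\<alpha> \<le> pi / 2"
    and deg: "degree P \<ge> degree Q + 2"
    and v: "Im v > 0" "cos \<alpha> * Im v < sin \<alpha> * Re v"
    and Nv: "poly N v = 0" "poly (pderiv N) v \<noteq> 0"
    and Nz: "\<And>z. z \<in> wedge \<alpha> \<Longrightarrow> z \<noteq> v \<Longrightarrow> poly N z \<noteq> 0"
    and Pz: "\<And>z. z \<in> wedge \<alpha> \<Longrightarrow> z \<noteq> 0 \<Longrightarrow> poly (cpoly P) z \<noteq> 0"
  shows "log_integral_exists \<alpha> (log_arg P Q x)"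
    and "log_integral \<alpha> (log_arg P Q x) = - 2 * pi * \<i> * v"
proof -
  define p where "p = cpoly P"
  define q where "q = cpoly Q"
  let ?x = "complex_of_real x"
  have N: "N = p - smult ?x q"
    by (intro poly_eqI) (simp add: N_def p_def q_def coeff_map_poly)
  have degp: "degree p = degree P" "degree q = degree Q" by (simp_all add: p_def q_def degree_map_poly)
  have p0: "p \<noteq> 0" using deg degp by auto
  obtain p1 where p1: "p = [:0, 1:] ^ order 0 p * p1" "poly p1 0 \<noteq> 0"
    using order_decomp[OF p0, of 0] by (auto simp: poly_eq_0_iff_dvd)
  define k where "k = order 0 p"
  have pk: "p = [:0, 1:] ^ k * p1" using p1 by (simp add: k_def)
  have p_eq: "poly p z = z ^ k * poly p1 z" for z by (simp add: pk)
  have p'_eq: "z * poly (pderiv p) z = z ^ k * (of_nat k * poly p1 z + z * poly (pderiv p1) z)" for z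
    unfolding pk by (rule poly_pderiv_power_mult)
  have p1z: "poly p1 z \<noteq> 0" if "z \<in> wedge \<alpha>" for z
    using Pz[OF that] p1(2) p_eq[of z] by (cases "z = 0") (auto simp: p_def)
  obtain N1 where N1: "N = [:- v, 1:] * N1" using Nv(1) by (auto simp: poly_eq_0_iff_dvd)
  have N1v: "poly N1 v = poly (pderiv N) v" by (simp only: N1 pderiv_mult) (simp add: pderiv_pCons)
  have N1z: "poly N1 z \<noteq> 0" if "z \<in> wedge \<alpha>" for z
    using Nz[OF that] N1 N1v Nv(2) by (cases "z = v") auto
  define A where "A = smult (- ?x) ([:0, 1:] * pderiv q * p1 - smult (of_nat k) (q * p1) - q * ([:0, 1:] * pderiv p1))"
  define M where "M = N1 * p1"
  have B: "[:- v, 1:] * M = N * p1" by (simp only: M_def N1 mult.assoc)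
  have Mz: "poly M z \<noteq> 0" if "z \<in> wedge \<alpha>" for z using p1z[OF that] N1z[OF that] by (simp add: M_def)
  have degA: "degree A + 2 \<le> degree ([:- v, 1:] * M)"
  proof -
    have "degree A \<le> degree q + degree p1"
      unfolding A_def
    proof (rule order_trans[OF degree_smult_le], intro degree_diff_le)
      show "degree ([:0, 1:] * pderiv q * p1) \<le> degree q + degree p1"
        by (intro order_trans[OF degree_mult_le] add_mono degree_times_pderiv_le order_refl)
      show "degree (smult (of_nat k) (q * p1)) \<le> degree q + degree p1"
        by (intro order_trans[OF degree_smult_le] degree_mult_le)
      show "degree (q * ([:0, 1:] * pderiv p1)) \<le> degree q + degree p1"
        by (intro order_trans[OF degree_mult_le] add_mono degree_times_pderiv_le order_refl)
    qed
    moreover have "degree N = degree p"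
      unfolding N diff_conv_add_uminus using deg degp
      by (intro degree_add_eq_left) (auto intro: le_less_trans[OF degree_smult_le])
    moreover have "degree (N * p1) = degree N + degree p1"
      using p1(2) N1 N1v Nv(2) by (intro degree_mult_eq) auto
    ultimately show ?thesis unfolding B using deg degp by simp
  qed
  define g where "g z = poly A z / poly ([:- v, 1:] * M) z" for z
  define f where "f = log_arg P Q x"
  define f' where "f' z = - ?x * ((poly (pderiv q) z * poly p z - poly q z * poly (pderiv p) z) / (poly p z)\<^sup>2)" for z
  have f_eq: "f z = poly N z / poly p z" if "poly p z \<noteq> 0" for z
    using that by (simp add: f_def log_arg_def N p_def q_def diff_divide_distrib)
  have gf: "z * f' z / f z = g z" if z: "z \<in> wedge \<alpha>" "z \<noteq> 0" "z \<noteq> v" for z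
  proof -
    have nz: "poly p z \<noteq> 0" "poly N z \<noteq> 0" "poly p1 z \<noteq> 0" using Pz Nz p1z z by (auto simp: p_def)
    have "z * f' z / f z = - ?x * (z * poly (pderiv q) z * poly p z - poly q z * (z * poly (pderiv p) z)) / (poly p z * poly N z)"
      unfolding f'_def f_eq[OF nz(1)] using nz by (simp add: power2_eq_square divide_simps) (simp add: algebra_simps)
    also have "\<dots> = z ^ k * poly A z / (z ^ k * (poly p1 z * poly N z))"
      unfolding p'_eq p_eq A_def by (simp add: algebra_simps)
    also have "\<dots> = g z" unfolding g_def B using z(2) by (simp add: mult.commute)
    finally show ?thesis .
  qed
  have ray: "z \<in> wedge \<alpha> \<and> z \<noteq> 0 \<and> z \<noteq> v" if "z \<in> open_ray \<theta>" "\<theta> \<in> {0, \<alpha>}" for z \<theta>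
  proof -
    obtain t where t: "t > 0" "z = of_real t * cis \<theta>" using \<open>z \<in> open_ray \<theta>\<close> by (auto simp: open_ray_def)
    have "z \<noteq> v" using v t that(2) by (auto simp: mult_ac)
    then show ?thesis using t ray_in_wedge[of t \<theta> \<alpha>] \<alpha> that(2) by auto
  qed
  have der: "(f has_field_derivative f' z) (at z)" if "z \<in> open_ray \<theta>" "\<theta> \<in> {0, \<alpha>}" for z \<theta>
  proof -
    have pz: "poly p z \<noteq> 0" using ray[OF that] Pz by (auto simp: p_def)
    show ?thesis
      unfolding f_def log_arg_def f'_def p_def[symmetric] q_def[symmetric]
      using DERIV_diff[OF DERIV_const[of 1] DERIV_cmult[OF DERIV_divide[OF poly_DERIV[of q] poly_DERIV[of p] pz], of ?x]]
      by (simp add: power2_eq_square mult_ac)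
  qed
  have cont: "continuous_on (open_ray \<theta>) f'" if "\<theta> \<in> {0, \<alpha>}" for \<theta>
    unfolding f'_def using ray[OF _ that] Pz by (intro continuous_intros) (auto simp: p_def)
  have nz: "f z \<noteq> 0" if "z \<in> open_ray \<theta>" "\<theta> \<in> {0, \<alpha>}" for z \<theta>
    using ray[OF that] Pz Nz f_eq by (auto simp: p_def)
  have lim: "((\<lambda>s. f (of_real s * cis \<theta>)) \<longlongrightarrow> 1) at_top" for \<theta>
  proof -
    have "filterlim (\<lambda>s. complex_of_real s * cis \<theta>) at_infinity at_top"
      by (rule filterlim_at_infinity_conv_norm_at_top[THEN iffD2]) (simp add: norm_mult, real_asymp)
    then have "((\<lambda>s. poly q (of_real s * cis \<theta>) / poly p (of_real s * cis \<theta>)) \<longlongrightarrow> 0) at_top"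
      using deg degp by (intro filterlim_compose[OF poly_divide_tendsto_0_at_infinity]) auto
    then have "((\<lambda>s. 1 - ?x * (poly q (of_real s * cis \<theta>) / poly p (of_real s * cis \<theta>))) \<longlongrightarrow> 1 - ?x * 0) at_top"
      by (intro tendsto_intros)
    then show ?thesis by (simp add: f_def log_arg_def p_def q_def)
  qed
  have bnd: "\<exists>C\<ge>0. \<forall>z \<in> open_ray \<theta>. norm (z * f' z / f z) \<le> C / (1 + (norm z)\<^sup>2)" if th: "\<theta> \<in> {0, \<alpha>}" for \<theta>
  proof -
    have "poly ([:- v, 1:] * M) (of_real s * cis \<theta>) \<noteq> 0" if s: "s \<ge> 0" for s
    proof -
      have "of_real s * cis \<theta> \<in> wedge \<alpha>" using s th \<alpha> ray_in_wedge[of s \<theta> \<alpha>] by auto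
      moreover have "of_real s * cis \<theta> \<noteq> v" using v s th by (auto simp: mult_ac)
      ultimately show ?thesis using Mz by simp
    qed
    then obtain C where C: "C \<ge> 0" "\<And>s. s \<ge> 0 \<Longrightarrow> norm (g (of_real s * cis \<theta>)) \<le> C / (1 + s\<^sup>2)"
      using poly_ratio_ray_bound[OF degA, of \<theta>] unfolding g_def by blast
    have "norm (z * f' z / f z) \<le> C / (1 + (norm z)\<^sup>2)" if z: "z \<in> open_ray \<theta>" for z
    proof -
      obtain t where t: "t > 0" "z = of_real t * cis \<theta>" using z by (auto simp: open_ray_def)
      then show ?thesis using C(2)[of t] gf ray[OF z th] by (simp add: norm_mult)
    qed
    then show ?thesis using C(1) by blast
  qed
  define L where "L \<theta> = ray_log \<theta> f" for \<theta>
  have ex: "\<exists>L. is_ray_log \<theta> f L" if "\<theta> \<in> {0, \<alpha>}" for \<theta>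
    using bnd[OF that] der nz lim that by (elim exE conjE) (rule ray_log_exists, auto)
  have L: "is_ray_log \<theta> f (L \<theta>)" if "\<theta> \<in> {0, \<alpha>}" for \<theta>
    unfolding L_def ray_log_def using ex[OF that] by (rule someI_ex)
  have res: "continuous_on {0<..} (\<lambda>s. L \<theta> (of_real s * cis \<theta>))"
    "set_integrable lborel {0<..} (\<lambda>s. L \<theta> (of_real s * cis \<theta>))"
    "set_integrable lborel {0<..} (\<lambda>s. g (of_real s * cis \<theta>))"
    "(LINT s:{0<..}|lborel. L \<theta> (of_real s * cis \<theta>)) = - (LINT s:{0<..}|lborel. g (of_real s * cis \<theta>))"
    if th: "\<theta> \<in> {0, \<alpha>}" for \<theta>
  proof -
    obtain C where C: "C \<ge> 0" "\<And>z. z \<in> open_ray \<theta> \<Longrightarrow> norm (z * f' z / f z) \<le> C / (1 + (norm z)\<^sup>2)"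
      using bnd[OF th] by blast
    have eq: "of_real s * cis \<theta> * f' (of_real s * cis \<theta>) / f (of_real s * cis \<theta>) = g (of_real s * cis \<theta>)"
      if "s \<in> {0<..}" for s :: real
    proof -
      have "of_real s * cis \<theta> \<in> open_ray \<theta>" using that by (auto simp: open_ray_def)
      then show ?thesis using gf ray[OF _ th] by blast
    qed
    note facts = der cont nz lim C L th
    show "continuous_on {0<..} (\<lambda>s. L \<theta> (of_real s * cis \<theta>))"
      by (rule ray_log_integral(1)[where f = f and f' = f' and C = C]) (use facts in blast)+
    show "set_integrable lborel {0<..} (\<lambda>s. L \<theta> (of_real s * cis \<theta>))"
      by (rule ray_log_integral(2)[where f = f and f' = f' and C = C]) (use facts in blast)+
    have "set_integrable lborel {0<..} (\<lambda>s. of_real s * cis \<theta> * f' (of_real s * cis \<theta>) / f (of_real s * cis \<theta>))"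
      by (rule ray_log_integral(3)[where f = f and f' = f' and C = C and L = "L \<theta>"]) (use facts in blast)+
    then show "set_integrable lborel {0<..} (\<lambda>s. g (of_real s * cis \<theta>))"
      by (subst (asm) set_integrable_cong[OF refl refl eq])
    have "(LINT s:{0<..}|lborel. L \<theta> (of_real s * cis \<theta>)) =
        - (LINT s:{0<..}|lborel. of_real s * cis \<theta> * f' (of_real s * cis \<theta>) / f (of_real s * cis \<theta>))"
      by (rule ray_log_integral(4)[where f = f and f' = f' and C = C]) (use facts in blast)+
    also have "(LINT s:{0<..}|lborel. of_real s * cis \<theta> * f' (of_real s * cis \<theta>) / f (of_real s * cis \<theta>)) =
        (LINT s:{0<..}|lborel. g (of_real s * cis \<theta>))"
      using eq by (intro set_lebesgue_integral_cong) auto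
    finally show "(LINT s:{0<..}|lborel. L \<theta> (of_real s * cis \<theta>)) = - (LINT s:{0<..}|lborel. g (of_real s * cis \<theta>))" .
  qed
  have g2: "L 0 (gamma2 t) * vector_derivative gamma2 (at t) = L 0 (of_real t * cis 0)" for t
  proof -
    have "(gamma2 has_vector_derivative 1) (at t)"
      unfolding gamma2_def by (auto intro!: derivative_eq_intros simp: has_vector_derivative_def scaleR_conv_of_real)
    then show ?thesis using vector_derivative_at by (force simp: gamma2_def)
  qed
  have g1: "L \<alpha> (gamma1 \<alpha> t) * vector_derivative (gamma1 \<alpha>) (at t)
      = - cis \<alpha> * (L \<alpha> (of_real (1 / t) * cis \<alpha>) / of_real (t\<^sup>2))" if "t > 0" for t
  proof -
    have "((\<lambda>z. cis \<alpha> / z) has_field_derivative - cis \<alpha> / (of_real t)\<^sup>2) (at (complex_of_real t))"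
      using that by (auto intro!: derivative_eq_intros simp: power2_eq_square)
    then have "((\<lambda>t. cis \<alpha> / of_real t) has_vector_derivative - cis \<alpha> / (of_real t)\<^sup>2) (at t)"
      by (rule has_vector_derivative_real_field)
    then have "vector_derivative (gamma1 \<alpha>) (at t) = - cis \<alpha> / (of_real t)\<^sup>2"
      using vector_derivative_at unfolding gamma1_def[abs_def] by blast
    then show ?thesis by (simp add: gamma1_def)
  qed
  note sub = set_integral_inverse_substitution[OF res(1,2), of \<alpha>]
  have i2: "path_integrable gamma2 (L 0)" unfolding path_integrable_def g2 using res(2)[of 0] by simp
  have i1: "path_integrable (gamma1 \<alpha>) (L \<alpha>)"
  proof -
    have "set_integrable lborel {0<..} (\<lambda>t. - cis \<alpha> * (L \<alpha> (of_real (1 / t) * cis \<alpha>) / of_real (t\<^sup>2)))"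
      using sub(1) by (intro set_integrable_mult_right) auto
    then show ?thesis
      unfolding path_integrable_def using g1 by (subst set_integrable_cong[OF refl refl]) auto
  qed
  show "log_integral_exists \<alpha> (log_arg P Q x)"
    unfolding log_integral_exists_def f_def[symmetric] using i1 i2 ex by (auto simp: L_def)
  have "path_int gamma2 (L 0) = - (LINT s:{0<..}|lborel. g (of_real s))"
    unfolding path_int_def g2 using res(4)[of 0] by simp
  moreover have "path_int (gamma1 \<alpha>) (L \<alpha>) = cis \<alpha> * (LINT s:{0<..}|lborel. g (of_real s * cis \<alpha>))"
  proof -
    have "path_int (gamma1 \<alpha>) (L \<alpha>) = (LINT t:{0<..}|lborel. - cis \<alpha> * (L \<alpha> (of_real (1 / t) * cis \<alpha>) / of_real (t\<^sup>2)))"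
      unfolding path_int_def using g1 by (intro set_lebesgue_integral_cong) auto
    also have "\<dots> = - cis \<alpha> * (LINT t:{0<..}|lborel. L \<alpha> (of_real (1 / t) * cis \<alpha>) / of_real (t\<^sup>2))"
      by (rule set_integral_mult_right)
    also have "\<dots> = cis \<alpha> * (LINT s:{0<..}|lborel. g (of_real s * cis \<alpha>))"
      using sub(2) res(4)[of \<alpha>] by simp
    finally show ?thesis .
  qed
  moreover have "(LINT s:{0<..}|lborel. g (of_real s)) - cis \<alpha> * (LINT s:{0<..}|lborel. g (of_real s * cis \<alpha>))
      = 2 * pi * \<i> * (poly A v / poly M v)"
    unfolding g_def by (rule wedge_ray_integral[OF \<alpha> v degA Mz]) (use res(3) in \<open>auto simp: g_def\<close>)
  moreover have "poly A v / poly M v = v"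
  proof -
    have vw: "v \<in> wedge \<alpha>" using v by (simp add: wedge_def)
    have pv: "?x * poly q v = v ^ k * poly p1 v" using Nv(1) p_eq[of v] by (simp add: N)
    have "poly A v = poly p1 v * (- ?x * v * poly (pderiv q) v) + (?x * poly q v) * (of_nat k * poly p1 v + v * poly (pderiv p1) v)"
      by (simp add: A_def algebra_simps)
    also have "\<dots> = poly p1 v * (- ?x * v * poly (pderiv q) v + v * poly (pderiv p) v)"
      unfolding pv p'_eq by (simp add: algebra_simps)
    also have "\<dots> = v * poly M v"
      by (simp add: M_def N1v N pderiv_diff pderiv_smult algebra_simps)
    finally show ?thesis using Mz[OF vw] by simp
  qed
  ultimately show "log_integral \<alpha> (log_arg P Q x) = - 2 * pi * \<i> * v"
    unfolding log_integral_def f_def[symmetric] L_def by (simp add: algebra_simps add_eq_0_iff)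
qed

section \<open>Roots of a polynomial pencil and the sector\<close>

lemma root_parameter_bound:
  fixes p q :: "complex poly"
  assumes deg: "degree q < degree p"
  obtains B where "\<And>z w. norm z \<le> m \<Longrightarrow> poly p w = z * poly q w \<Longrightarrow> norm w \<le> B"
proof -
  have p0: "p \<noteq> 0" using deg by auto
  obtain b0 where b0: "\<And>w. poly p w = 0 \<Longrightarrow> norm w \<le> b0"
    using finite_imp_bounded[OF poly_roots_finite[OF p0]] unfolding bounded_iff by auto
  have "((\<lambda>w. norm (poly q w / poly p w)) \<longlongrightarrow> 0) at_infinity"
    using tendsto_norm[OF poly_divide_tendsto_0_at_infinity[OF deg]] by simp
  then have "\<forall>\<^sub>F w in at_infinity. norm (poly q w / poly p w) < 1 / (1 + \<bar>m\<bar>)"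
    by (rule order_tendstoD) (simp add: add_pos_nonneg)
  then obtain b1 where b1: "\<And>w. norm w \<ge> b1 \<Longrightarrow> norm (poly q w / poly p w) < 1 / (1 + \<bar>m\<bar>)"
    by (auto simp: eventually_at_infinity)
  have "norm w \<le> max b0 b1" if "norm z \<le> m" "poly p w = z * poly q w" for z w
  proof (rule ccontr)
    assume "\<not> norm w \<le> max b0 b1"
    then have w: "norm w > b0" "norm w \<ge> b1" by auto
    then have nz: "poly p w \<noteq> 0" using b0[of w] by auto
    then have "norm z * norm (poly q w / poly p w) = 1" using that(2) by (simp flip: norm_mult)
    moreover have "norm z * norm (poly q w / poly p w) \<le> \<bar>m\<bar> * (1 / (1 + \<bar>m\<bar>))"
      using that(1) b1[OF w(2)] by (intro mult_mono) auto
    moreover have "\<bar>m\<bar> * (1 / (1 + \<bar>m\<bar>)) < 1" by (simp add: divide_less_eq)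
    ultimately show False by linarith
  qed
  then show ?thesis using that by blast
qed

lemma root_limit:
  fixes p q :: "complex poly"
  assumes deg: "degree q < degree p" and T: "closed T"
    and z: "Z \<longlonglongrightarrow> z" and w: "\<And>n. W n \<in> T" "\<And>n. poly p (W n) = Z n * poly q (W n)"
  obtains w r where "strict_mono (r :: nat \<Rightarrow> nat)" "(W \<circ> r) \<longlonglongrightarrow> w" "w \<in> T" "poly p w = z * poly q w"
proof -
  obtain m where m: "\<And>n. norm (Z n) \<le> m"
    using convergent_imp_Bseq[of Z] z by (auto simp: convergent_def Bseq_def)
  obtain B where B: "\<And>z w. norm z \<le> m \<Longrightarrow> poly p w = z * poly q w \<Longrightarrow> norm w \<le> B"
    using root_parameter_bound[OF deg, of m] by metis
  have "W n \<in> cball 0 B" for n using B[OF m w(2)] by simp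
  then obtain l r where r: "strict_mono (r :: nat \<Rightarrow> nat)" "(W \<circ> r) \<longlonglongrightarrow> l"
    using compact_cball[of "0::complex" B] unfolding compact_def by metis
  have "l \<in> T" using T r(2) w(1) unfolding closed_sequential_limits by (metis comp_apply)
  have "(\<lambda>n. poly p ((W \<circ> r) n)) \<longlonglongrightarrow> poly p l" by (intro tendsto_intros r)
  moreover have "(\<lambda>n. (Z \<circ> r) n * poly q ((W \<circ> r) n)) \<longlonglongrightarrow> z * poly q l"
    by (intro tendsto_intros r LIMSEQ_subseq_LIMSEQ[OF z])
  ultimately have "poly p l = z * poly q l" using w(2) by (simp add: LIMSEQ_unique)
  then show ?thesis using that r \<open>l \<in> T\<close> by blast
qed

text \<open>
  The projection of the curve \<open>p(w) = z q(w)\<close> to the \<open>z\<close>-plane is proper, since roots remain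
  bounded; hence it maps closed sets to closed sets.
\<close>

lemma closed_root_parameters:
  fixes p q :: "complex poly"
  assumes deg: "degree q < degree p" and T: "closed T"
  shows "closed {z. \<exists>w\<in>T. poly p w = z * poly q w}"
  unfolding closed_sequential_limits
proof safe
  fix Z z assume Z: "\<forall>n. Z n \<in> {z. \<exists>w\<in>T. poly p w = z * poly q w}" "Z \<longlonglongrightarrow> z"
  then obtain W where "\<And>n. W n \<in> T" "\<And>n. poly p (W n) = Z n * poly q (W n)"
    unfolding mem_Collect_eq Bex_def by metis
  then show "\<exists>w\<in>T. poly p w = z * poly q w" using root_limit[OF deg T Z(2)] by metis
qed

lemma no_roots_near:
  fixes p q :: "complex poly"
  assumes deg: "degree q < degree p" and T: "closed T" and K: "compact K"
    and no: "\<And>z w. z \<in> K \<Longrightarrow> w \<in> T \<Longrightarrow> poly p w \<noteq> z * poly q w"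
  obtains d where "d > 0" "\<And>z z0 w. z0 \<in> K \<Longrightarrow> dist z0 z < d \<Longrightarrow> w \<in> T \<Longrightarrow> poly p w \<noteq> z * poly q w"
proof -
  let ?Z = "{z. \<exists>w\<in>T. poly p w = z * poly q w}"
  have "K \<inter> ?Z = {}" using no by auto
  then obtain d where d: "d > 0" "\<And>x y. x \<in> K \<Longrightarrow> y \<in> ?Z \<Longrightarrow> d \<le> dist x y"
    using separate_compact_closed[OF K closed_root_parameters[OF deg T]] by blast
  show ?thesis by (rule that[OF d(1)]) (use d(2) in force)
qed

text \<open>
  For \<open>z\<close> near \<open>z0\<close> there are no roots on a suitable small circle around \<open>r\<close>. So a continuous choice of
  roots over a connected set near \<open>z0\<close> that has one value inside the circle has all its values inside. The radius \<open>e'\<close>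
  avoids the finitely many distances from \<open>r\<close> to the roots over \<open>z0\<close>.
\<close>

lemma branch_stays_near_root:
  fixes p q :: "complex poly"
  assumes deg: "degree q < degree p" and e: "e > 0"
  obtains d e' where "d > 0" "0 < e'" "e' \<le> e"
    "\<And>w S. S \<subseteq> ball z0 d \<Longrightarrow> connected S \<Longrightarrow> continuous_on S w \<Longrightarrow>
      (\<And>z. z \<in> S \<Longrightarrow> poly p (w z) = z * poly q (w z)) \<Longrightarrow>
      \<exists>z\<in>S. dist r (w z) < e' \<Longrightarrow> \<forall>z\<in>S. dist r (w z) < e"
proof -
  have "degree (- smult z0 q) < degree p" using deg degree_smult_le[of z0 q] by simp
  then have "degree (p - smult z0 q) = degree p" unfolding diff_conv_add_uminus by (rule degree_add_eq_left)
  then have "p - smult z0 q \<noteq> 0" using deg by auto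
  then have "finite ((\<lambda>w. dist r w) ` {w. poly (p - smult z0 q) w = 0})" (is "finite ?D")
    using poly_roots_finite by blast
  then have "infinite ({0<..<e} - ?D)" using e by (intro Diff_infinite_finite) auto
  then obtain e' where e': "0 < e'" "e' < e" "e' \<notin> ?D" by (metis Diff_iff ex_in_conv finite.emptyI greaterThanLessThan_iff)
  have "poly p w \<noteq> z * poly q w" if "z \<in> {z0}" "w \<in> sphere r e'" for z w
    using that e'(3) by (auto simp: image_iff)
  then obtain d where d: "d > 0" "\<And>z w. dist z0 z < d \<Longrightarrow> w \<in> sphere r e' \<Longrightarrow> poly p w \<noteq> z * poly q w"
    using no_roots_near[OF deg closed_sphere compact_sing, of z0 r e'] by (metis singletonI)
  show ?thesis
  proof (rule that[OF d(1) e'(1) less_imp_le[OF e'(2)]])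
    fix w S
    assume S: "S \<subseteq> ball z0 d" "connected S" "continuous_on S w"
      and root: "\<And>z. z \<in> S \<Longrightarrow> poly p (w z) = z * poly q (w z)"
      and ex: "\<exists>z\<in>S. dist r (w z) < e'"
    have "connected (w ` S)" using S by (intro connected_continuous_image)
    moreover have "w ` S \<inter> ball r e' \<noteq> {}" using ex by auto
    moreover have "w ` S \<inter> frontier (ball r e') = {}"
    proof -
      have "w z \<notin> sphere r e'" if "z \<in> S" for z
        using d(2)[of z "w z"] root[OF that] S(1) that by auto
      then show ?thesis using e'(1) by (auto simp: frontier_ball)
    qed
    ultimately have "w ` S - ball r e' = {}" using connected_Int_frontier by blast
    then show "\<forall>z\<in>S. dist r (w z) < e" using e'(2) by force
  qed
qed

text \<open>
  Near a simple root the equation \<open>p(w) = z q(w)\<close> is solved by a local inverse of \<open>p / q\<close>.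
\<close>

lemma simple_root_continuation:
  fixes p q :: "complex poly"
  assumes root: "poly p r = z0 * poly q r" and q: "poly q r \<noteq> 0"
    and simple: "poly (pderiv (p - smult z0 q)) r \<noteq> 0"
  obtains g d e where "d > 0" "e > 0" "g holomorphic_on ball z0 d"
    "\<And>z w. z \<in> ball z0 d \<Longrightarrow> w \<in> ball r e \<Longrightarrow> poly p w = z * poly q w \<Longrightarrow> g z = w"
proof -
  define f where "f w = poly p w / poly q w" for w
  define U where "U = {w. poly q w \<noteq> 0}"
  have U: "open U" unfolding U_def by (intro open_Collect_neq continuous_intros)
  have r: "r \<in> U" using q by (simp add: U_def)
  have f: "f holomorphic_on U" unfolding f_def U_def by (intro holomorphic_intros) auto
  have fr: "f r = z0" using root q by (simp add: f_def)
  have "(f has_field_derivative (poly (pderiv p) r * poly q r - poly p r * poly (pderiv q) r) / (poly q r * poly q r)) (at r)"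
    unfolding f_def by (intro DERIV_divide poly_DERIV q)
  then have "deriv f r = (poly (pderiv p) r * poly q r - poly p r * poly (pderiv q) r) / (poly q r * poly q r)"
    by (rule DERIV_imp_deriv)
  also have "\<dots> = poly (pderiv (p - smult z0 q)) r / poly q r"
    using q by (simp add: root pderiv_diff pderiv_smult field_simps)
  finally have "deriv f r \<noteq> 0" using simple q by simp
  then obtain e where e: "e > 0" "ball r e \<subseteq> U" "open (f ` ball r e)" "inj_on f (ball r e)"
    using has_complex_derivative_locally_invertible[OF f r U] by metis
  obtain g where g: "g holomorphic_on (f ` ball r e)" "\<And>w. w \<in> ball r e \<Longrightarrow> g (f w) = w"
    using holomorphic_has_inverse[OF holomorphic_on_subset[OF f e(2)] open_ball e(4)] by metis
  have "z0 \<in> f ` ball r e" using fr e(1) by (intro image_eqI[of _ _ r]) auto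
  then obtain d where d: "d > 0" "ball z0 d \<subseteq> f ` ball r e" using e(3) openE by blast
  have "g z = w" if "w \<in> ball r e" "poly p w = z * poly q w" for z w
  proof -
    have "f w = z" using that e(2) by (auto simp: f_def U_def)
    then show ?thesis using g(2) that by blast
  qed
  then show ?thesis using that[OF d(1) e(1)] holomorphic_on_subset[OF g(1) d(2)] by blast
qed

lemma size_le_roots_in_set:
  assumes "p \<noteq> 0" and "\<And>a. count M a \<le> order a p" and "set_mset M \<subseteq> S"
  shows "size M \<le> size (filter_mset (\<lambda>w. w \<in> S) (proots p))"
proof (rule size_mset_mono, rule mset_subset_eqI)
  fix a show "count M a \<le> count (filter_mset (\<lambda>w. w \<in> S) (proots p)) a"
    using assms by (cases "a \<in> S") (auto simp: not_in_iff)
qed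

lemma order_ge_2:
  fixes p :: "'a :: field_char_0 poly"
  assumes "p \<noteq> 0" "poly p a = 0" "poly (pderiv p) a = 0"
  shows "order a p \<ge> 2"
proof -
  have o: "order a p \<noteq> 0" using assms order_root by blast
  have "pderiv p \<noteq> 0"
  proof
    assume "pderiv p = 0"
    then have "degree p = 0" by (simp add: pderiv_eq_0_iff)
    then show False using assms by (metis degree_eq_zeroE poly_const_conv pCons_0_0)
  qed
  then have "order a (pderiv p) \<noteq> 0" using assms(3) order_root by blast
  then show ?thesis using order_pderiv[of p a] o assms by linarith
qed

lemma two_roots_in_set:
  fixes p :: "complex poly"
  assumes p: "p \<noteq> 0" and two: "size (filter_mset (\<lambda>w. w \<in> S) (proots p)) = 2"
  shows two_roots_exists: "\<exists>a\<in>S. poly p a = 0"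
    and two_roots_only: "\<And>a b c. \<lbrakk>a \<in> S; b \<in> S; c \<in> S; poly p a = 0; poly p b = 0; poly p c = 0; a \<noteq> b\<rbrakk> \<Longrightarrow> c = a \<or> c = b"
    and two_roots_simple: "\<And>a b. \<lbrakk>a \<in> S; b \<in> S; poly p a = 0; poly p b = 0; a \<noteq> b\<rbrakk> \<Longrightarrow> poly (pderiv p) a \<noteq> 0"
proof -
  have "filter_mset (\<lambda>w. w \<in> S) (proots p) \<noteq> {#}"
  proof
    assume *: "filter_mset (\<lambda>w. w \<in> S) (proots p) = {#}"
    show False using two unfolding * by simp
  qed
  then obtain a where "a \<in># filter_mset (\<lambda>w. w \<in> S) (proots p)" by blast
  then show "\<exists>a\<in>S. poly p a = 0" using p by auto
next
  fix a b c assume S: "a \<in> S" "b \<in> S" "c \<in> S" "poly p a = 0" "poly p b = 0" "poly p c = 0" "a \<noteq> b"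
  show "c = a \<or> c = b"
  proof (rule ccontr)
    assume "\<not> (c = a \<or> c = b)"
    moreover have "order a p \<ge> 1" "order b p \<ge> 1" "order c p \<ge> 1"
      using S p order_root[of p] by (auto simp: Suc_le_eq)
    ultimately have "size {#a, b, c#} \<le> size (filter_mset (\<lambda>w. w \<in> S) (proots p))"
      using S by (intro size_le_roots_in_set p) auto
    then show False using two by simp
  qed
next
  fix a b assume S: "a \<in> S" "b \<in> S" "poly p a = 0" "poly p b = 0" "a \<noteq> b"
  show "poly (pderiv p) a \<noteq> 0"
  proof
    assume "poly (pderiv p) a = 0"
    then have "order a p \<ge> 2" using p S by (intro order_ge_2)
    moreover have "order b p \<ge> 1" using S p order_root[of p b] by (auto simp: Suc_le_eq)
    ultimately have "size {#a, a, b#} \<le> size (filter_mset (\<lambda>w. w \<in> S) (proots p))"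
      using S by (intro size_le_roots_in_set p) auto
    then show False using two by simp
  qed
qed

lemma sector_eq:
  assumes \<alpha>: "0 < \<alpha>" "\<alpha> \<le> pi / 2"
  shows "sector \<alpha> = {z. cos \<alpha> * \<bar>Im z\<bar> \<le> sin \<alpha> * Re z}"
proof (intro set_eqI iffI)
  fix z assume "z \<in> sector \<alpha>"
  then obtain t s where ts: "z = of_real t * cis s" "t \<ge> 0" "- \<alpha> \<le> s" "s \<le> \<alpha>" by (auto simp: sector_def)
  have "sin (\<alpha> - s) \<ge> 0" "sin (\<alpha> + s) \<ge> 0" using ts \<alpha> by (auto intro!: sin_ge_zero)
  then have "t * sin (\<alpha> - s) \<ge> 0" "t * sin (\<alpha> + s) \<ge> 0" using ts by auto
  then show "z \<in> {z. cos \<alpha> * \<bar>Im z\<bar> \<le> sin \<alpha> * Re z}"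
    using ts by (auto simp: sin_diff sin_add abs_if algebra_simps)
next
  fix z assume "z \<in> {z. cos \<alpha> * \<bar>Im z\<bar> \<le> sin \<alpha> * Re z}"
  then have z: "cos \<alpha> * \<bar>Im z\<bar> \<le> sin \<alpha> * Re z" by simp
  have s: "sin \<alpha> > 0" using \<alpha> pi_gt_zero by (intro sin_gt_zero) auto
  have "cos \<alpha> \<ge> 0" using \<alpha> by (intro cos_ge_zero) auto
  then have "sin \<alpha> * Re z \<ge> 0" using z by (meson abs_ge_zero mult_nonneg_nonneg order_trans)
  then have re: "Re z \<ge> 0" using s by (simp add: zero_le_mult_iff)
  show "z \<in> sector \<alpha>"
  proof (cases "z = 0")
    case True
    then show ?thesis using \<alpha> by (auto simp: sector_def intro!: exI[of _ 0])
  next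
    case False
    define \<theta> where "\<theta> = Arg z"
    have zc: "z = of_real (norm z) * cis \<theta>"
      using rcis_cmod_Arg[of z] by (simp add: rcis_def \<theta>_def)
    have th: "\<bar>\<theta>\<bar> \<le> pi / 2" unfolding \<theta>_def using re Arg_Re_nonneg by blast
    have "\<bar>Im z\<bar> = norm z * sin \<bar>\<theta>\<bar>" "Re z = norm z * cos \<bar>\<theta>\<bar>"
    proof -
      have "\<bar>Im z\<bar> = norm z * \<bar>sin \<theta>\<bar>" by (subst zc) (simp add: abs_mult)
      moreover have "sin \<bar>\<theta>\<bar> \<ge> 0" using th by (intro sin_ge_zero) auto
      then have "\<bar>sin \<theta>\<bar> = sin \<bar>\<theta>\<bar>" by (cases "\<theta> \<ge> 0") auto
      ultimately show "\<bar>Im z\<bar> = norm z * sin \<bar>\<theta>\<bar>" by simp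
      show "Re z = norm z * cos \<bar>\<theta>\<bar>" by (subst zc) simp
    qed
    then have "0 \<le> norm z * sin (\<alpha> - \<bar>\<theta>\<bar>)" using z by (simp add: sin_diff algebra_simps)
    then have "0 \<le> sin (\<alpha> - \<bar>\<theta>\<bar>)" using False by (simp add: zero_le_mult_iff)
    moreover have "sin (\<alpha> - \<bar>\<theta>\<bar>) < 0" if "\<alpha> < \<bar>\<theta>\<bar>"
      using sin_gt_zero[of "\<bar>\<theta>\<bar> - \<alpha>"] th \<alpha> that sin_minus[of "\<bar>\<theta>\<bar> - \<alpha>"] by simp
    ultimately have "\<bar>\<theta>\<bar> \<le> \<alpha>" by linarith
    then show ?thesis
      unfolding sector_def mem_Collect_eq
      by (intro exI[of _ "norm z"] exI[of _ \<theta>] conjI zc) auto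
  qed
qed

lemma closed_sector_eq: "closed {z. a * \<bar>Im z\<bar> \<le> b * Re z}"
  by (intro closed_Collect_le continuous_intros)

lemma open_sector_interior: "open {z. a * \<bar>Im z\<bar> < b * Re z}"
  by (intro open_Collect_less continuous_intros)

lemma frontier_sector:
  assumes \<alpha>: "0 < \<alpha>" "\<alpha> \<le> pi / 2"
  shows "frontier (sector \<alpha>) = {z. cos \<alpha> * \<bar>Im z\<bar> = sin \<alpha> * Re z}"
proof -
  have s: "sin \<alpha> > 0" using \<alpha> pi_gt_zero by (intro sin_gt_zero) auto
  have cl: "closed (sector \<alpha>)" unfolding sector_eq[OF \<alpha>] by (rule closed_sector_eq)
  have "interior (sector \<alpha>) = {z. cos \<alpha> * \<bar>Im z\<bar> < sin \<alpha> * Re z}"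
  proof (rule interior_unique)
    show "{z. cos \<alpha> * \<bar>Im z\<bar> < sin \<alpha> * Re z} \<subseteq> sector \<alpha>" unfolding sector_eq[OF \<alpha>] by auto
    show "open {z. cos \<alpha> * \<bar>Im z\<bar> < sin \<alpha> * Re z}" by (rule open_sector_interior)
    fix T assume T: "T \<subseteq> sector \<alpha>" "open T"
    show "T \<subseteq> {z. cos \<alpha> * \<bar>Im z\<bar> < sin \<alpha> * Re z}"
    proof
      fix z assume "z \<in> T"
      then obtain e where e: "e > 0" "ball z e \<subseteq> T" using T(2) openE by blast
      have "z - of_real (e / 2) \<in> ball z e" using e(1) by (simp add: dist_norm)
      then have "z - of_real (e / 2) \<in> sector \<alpha>" using e(2) T(1) by blast
      then have "cos \<alpha> * \<bar>Im z\<bar> \<le> sin \<alpha> * (Re z - e / 2)" by (simp add: sector_eq[OF \<alpha>])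
      also have "\<dots> < sin \<alpha> * Re z" using s e(1) by (intro mult_strict_left_mono) auto
      finally show "z \<in> {z. cos \<alpha> * \<bar>Im z\<bar> < sin \<alpha> * Re z}" by simp
    qed
  qed
  then show ?thesis using cl by (auto simp: frontier_def sector_eq[OF \<alpha>])
qed

text \<open>
  The disc is slit along the horizontal radius from its centre \<open>c\<close> to the left (\<open>\<sigma> = 1\<close>) or to the
  right (\<open>\<sigma> = -1\<close>).
\<close>

lemma connected_slit_ball:
  assumes \<sigma>: "\<sigma> = 1 \<or> \<sigma> = -1" and d: "d > 0"
  shows "connected {z \<in> ball (complex_of_real c) d. \<not> (Im z = 0 \<and> \<sigma> * (Re z - c) \<le> 0)}" (is "connected ?S")
proof (rule starlike_imp_connected)
  let ?a = "complex_of_real (c + \<sigma> * d / 2)"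
  show "starlike ?S"
    unfolding starlike_def
  proof (intro bexI[of _ ?a] ballI subsetI)
    have "of_real c - ?a = complex_of_real (- (\<sigma> * d / 2))" by simp
    then have "norm (of_real c - ?a) = \<bar>\<sigma> * d / 2\<bar>" by (simp only: norm_of_real abs_minus_cancel)
    also have "\<dots> = d / 2" using \<sigma> d by auto
    finally have "norm (of_real c - ?a) = d / 2" .
    then have a: "?a \<in> ball (of_real c) d" using d by (simp add: dist_norm)
    moreover have "\<sigma> * (\<sigma> * d / 2) > 0" using \<sigma> d by auto
    ultimately show "?a \<in> ?S" by auto
    fix z y assume z: "z \<in> ?S" and y: "y \<in> closed_segment ?a z"
    have "closed_segment ?a z \<subseteq> ball (of_real c) d"
      using a z by (intro closed_segment_subset) auto
    moreover have "\<not> (Im y = 0 \<and> \<sigma> * (Re y - c) \<le> 0)"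
    proof
      assume yr: "Im y = 0 \<and> \<sigma> * (Re y - c) \<le> 0"
      obtain u where u: "0 \<le> u" "u \<le> 1" "y = (1 - u) *\<^sub>R ?a + u *\<^sub>R z" using y by (auto simp: in_segment)
      have "\<sigma> * (Re y - c) = (1 - u) * (\<sigma> * (\<sigma> * d / 2)) + u * (\<sigma> * (Re z - c))"
        unfolding u(3) by (simp add: field_simps)
      also have "\<sigma> * (\<sigma> * d / 2) = d / 2" using \<sigma> by auto
      finally have eq: "\<sigma> * (Re y - c) = (1 - u) * (d / 2) + u * (\<sigma> * (Re z - c))" .
      show False
      proof (cases "u = 0")
        case True
        then show False using eq yr d by simp
      next
        case False
        then have "Im z = 0" using yr u by simp
        then have "\<sigma> * (Re z - c) > 0" using z by auto
        then have "u * (\<sigma> * (Re z - c)) > 0" using False u by simp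
        moreover have "(1 - u) * (d / 2) \<ge> 0" using u d by simp
        ultimately show False using eq yr by linarith
      qed
    qed
    ultimately show "y \<in> ?S" using y by blast
  qed
qed

section \<open>Stieltjes transforms and their inversion\<close>

text \<open>
  A probability measure carried by the interval \<open>[0, xs]\<close>.
\<close>

locale compact_prob = prob_space \<mu> for \<mu> :: "real measure" +
  fixes xs :: real
  assumes xs_pos: "xs > 0" and sets_borel [measurable_cong]: "sets \<mu> = sets borel"
    and support: "emeasure \<mu> (- {0..xs}) = 0"
begin

text \<open>
  The function \<open>w(z) = z F(z)\<close>, where \<open>F\<close> is the Stieltjes transform of the measure.
\<close>

definition branch :: "complex \<Rightarrow> complex" where "branch z = z * stieltjes \<mu> z"

lemma AE_support: "AE t in \<mu>. 0 \<le> t \<and> t \<le> xs"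
proof (rule AE_I)
  show "{t \<in> space \<mu>. \<not> (0 \<le> t \<and> t \<le> xs)} \<subseteq> - {0..xs}" by auto
qed (use support in auto)

lemma integrable_kernel:
  assumes z: "z \<notin> complex_of_real ` {0..xs}"
  shows "integrable \<mu> (\<lambda>t. 1 / (z - complex_of_real t))"
proof -
  have "compact (complex_of_real ` {0..xs})" by (intro compact_continuous_image continuous_intros) auto
  then obtain d where d: "d > 0" "\<And>y. y \<in> complex_of_real ` {0..xs} \<Longrightarrow> d \<le> dist z y"
    using separate_point_closed[OF compact_imp_closed z] by blast
  show ?thesis
  proof (rule integrable_const_bound[of _ "1 / d"])
    show "AE t in \<mu>. norm (1 / (z - complex_of_real t)) \<le> 1 / d"
      using AE_support
    proof eventually_elim
      case (elim t)
      then have "d \<le> norm (z - of_real t)" using d(2)[of "of_real t"] by (simp add: dist_norm)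
      then show ?case using d(1) by (simp add: norm_divide frac_le)
    qed
    show "(\<lambda>t. 1 / (z - complex_of_real t)) \<in> borel_measurable \<mu>" by measurable
  qed
qed

lemma branch_eq:
  assumes z: "z \<notin> complex_of_real ` {0..xs}"
  shows "integrable \<mu> (\<lambda>t. z / (z - complex_of_real t))" "branch z = (\<integral>t. z / (z - complex_of_real t) \<partial>\<mu>)"
  using integrable_mult_right[OF integrable_kernel[OF z], of z]
    integral_mult_right_zero[of \<mu> z "\<lambda>t. 1 / (z - complex_of_real t)"]
  by (simp_all add: branch_def stieltjes_def)

lemma branch_Im:
  assumes "z \<notin> complex_of_real ` {0..xs}"
  shows "Im (branch z) = (\<integral>t. Im (z / (z - complex_of_real t)) \<partial>\<mu>)"
  unfolding branch_eq(2)[OF assms] using branch_eq(1)[OF assms] by (rule integral_Im[symmetric])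

lemma branch_Re:
  assumes "z \<notin> complex_of_real ` {0..xs}"
  shows "Re (branch z) = (\<integral>t. Re (z / (z - complex_of_real t)) \<partial>\<mu>)"
  unfolding branch_eq(2)[OF assms] using branch_eq(1)[OF assms] by (rule integral_Re[symmetric])

lemma Im_branch_nonpos:
  assumes "Im z > 0"
  shows "Im (branch z) \<le> 0"
proof -
  have z: "z \<notin> complex_of_real ` {0..xs}" using assms by auto
  have "0 \<le> (\<integral>t. - Im (z / (z - complex_of_real t)) \<partial>\<mu>)"
  proof (rule integral_nonneg_AE)
    show "AE t in \<mu>. 0 \<le> - Im (z / (z - complex_of_real t))"
      using AE_support
    proof eventually_elim
      case (elim t)
      have "Im (z / (z - complex_of_real t)) = - (t * Im z) / ((Re z - t)\<^sup>2 + (Im z)\<^sup>2)"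
        by (simp add: Im_divide algebra_simps)
      then show ?case using elim assms by (auto intro!: divide_nonneg_nonneg)
    qed
  qed
  then show ?thesis using branch_Im[OF z] by simp
qed

lemma branch_real:
  assumes "x < 0 \<or> x > xs"
  shows "Im (branch (of_real x)) = 0"
    and "Re (branch (of_real x)) = (\<integral>t. x / (x - t) \<partial>\<mu>)" and "integrable \<mu> (\<lambda>t. x / (x - t))"
proof -
  have x: "complex_of_real x \<notin> complex_of_real ` {0..xs}" using assms xs_pos by (auto simp: image_iff)
  have eq: "of_real x / (of_real x - complex_of_real t) = complex_of_real (x / (x - t))" for t by simp
  show "Im (branch (of_real x)) = 0" unfolding branch_Im[OF x] eq by simp
  show "Re (branch (of_real x)) = (\<integral>t. x / (x - t) \<partial>\<mu>)" unfolding branch_Re[OF x] eq by simp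
  show "integrable \<mu> (\<lambda>t. x / (x - t))"
    using integrable_Re[OF branch_eq(1)[OF x]] unfolding eq by simp
qed

lemma branch_right:
  assumes "x > xs"
  shows "branch (of_real x) = of_real (Re (branch (of_real x)))" "Re (branch (of_real x)) \<ge> 1"
proof -
  have x: "x < 0 \<or> x > xs" using assms by simp
  show "branch (of_real x) = of_real (Re (branch (of_real x)))" using branch_real(1)[OF x] by (simp add: complex_eq_iff)
  have "AE t in \<mu>. 1 \<le> x / (x - t)"
    using AE_support by eventually_elim (use assms xs_pos in \<open>simp add: field_simps\<close>)
  then show "Re (branch (of_real x)) \<ge> 1"
    unfolding branch_real(2)[OF x] by (rule integral_ge_const[OF branch_real(3)[OF x]])
qed

lemma branch_left:
  assumes "y > 0"
  shows "branch (of_real (- y)) = of_real (Re (branch (of_real (- y))))" "0 < Re (branch (of_real (- y)))" "Re (branch (of_real (- y))) \<le> 1"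
proof -
  have y: "- y < 0 \<or> - y > xs" using assms by simp
  show "branch (of_real (- y)) = of_real (Re (branch (of_real (- y))))"
    using branch_real(1)[OF y] by (simp add: complex_eq_iff)
  have "AE t in \<mu>. y / (y + xs) \<le> - y / (- y - t)"
    using AE_support
  proof eventually_elim
    case (elim t)
    have "y / (y + xs) \<le> y / (y + t)" using assms elim xs_pos by (intro divide_left_mono) auto
    also have "\<dots> = - y / (- y - t)" using minus_divide_divide[of y "y + t"] by simp
    finally show ?case .
  qed
  then have "y / (y + xs) \<le> Re (branch (of_real (- y)))"
    unfolding branch_real(2)[OF y] by (rule integral_ge_const[OF branch_real(3)[OF y]])
  then show "0 < Re (branch (of_real (- y)))" using assms xs_pos
    by (meson divide_pos_pos add_pos_pos less_le_trans)
  have "AE t in \<mu>. - y / (- y - t) \<le> 1"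
    using AE_support by eventually_elim (use assms in \<open>simp add: divide_simps\<close>)
  then show "Re (branch (of_real (- y))) \<le> 1"
    unfolding branch_real(2)[OF y] by (rule integral_le_const[OF branch_real(3)[OF y]])
qed

text \<open>
  Together with \<open>w(- y) \<rightarrow> 0\<close> as \<open>y \<rightarrow> 0\<close> this excludes an atom at the origin.
\<close>

lemma atom_le_branch_left: "measure \<mu> {0} \<le> Re (branch (of_real (- y)))" if "y > 0"
proof -
  have y: "- y < 0 \<or> - y > xs" using that by simp
  have "measure \<mu> {0} = (\<integral>t. indicator {0} t \<partial>\<mu>)" by (simp add: Int_absorb1 sets_eq_imp_space_eq[OF sets_borel])
  also have "\<dots> \<le> (\<integral>t. - y / (- y - t) \<partial>\<mu>)"
  proof (rule integral_mono_AE)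
    show "integrable \<mu> (\<lambda>t. - y / (- y - t))" by (rule branch_real(3)[OF y])
    show "AE t in \<mu>. indicator {0} t \<le> - y / (- y - t)"
      using AE_support by eventually_elim (use that in \<open>auto simp: indicator_def divide_simps\<close>)
    show "integrable \<mu> (indicat_real {0})"
      by (intro integrable_real_indicator) (auto simp: emeasure_eq_measure)
  qed
  finally show ?thesis using branch_real(2)[OF y] by simp
qed

lemma Im_stieltjes:
  assumes "\<epsilon> > 0"
  shows "- Im (stieltjes \<mu> (Complex x \<epsilon>)) = (\<integral>t. \<epsilon> / ((x - t)\<^sup>2 + \<epsilon>\<^sup>2) \<partial>\<mu>)"
    and "integrable \<mu> (\<lambda>t. \<epsilon> / ((x - t)\<^sup>2 + \<epsilon>\<^sup>2))"
proof -
  have z: "Complex x \<epsilon> \<notin> complex_of_real ` {0..xs}" using assms by (auto simp: complex_eq_iff)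
  have eq: "Im (1 / (Complex x \<epsilon> - complex_of_real t)) = - (\<epsilon> / ((x - t)\<^sup>2 + \<epsilon>\<^sup>2))" for t
    by (simp add: Im_divide)
  show "- Im (stieltjes \<mu> (Complex x \<epsilon>)) = (\<integral>t. \<epsilon> / ((x - t)\<^sup>2 + \<epsilon>\<^sup>2) \<partial>\<mu>)"
    unfolding stieltjes_def using integral_Im[OF integrable_kernel[OF z]] unfolding eq by simp
  show "integrable \<mu> (\<lambda>t. \<epsilon> / ((x - t)\<^sup>2 + \<epsilon>\<^sup>2))"
    using integrable_Im[OF integrable_kernel[OF z]] unfolding eq by simp
qed

text \<open>
  The imaginary part of the transform is a Poisson integral of the measure, and the integral of the
  Poisson kernel over an interval is a difference of arctangents.
\<close>

lemma nn_integral_Poisson: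
  assumes e: "\<epsilon> > 0" and ab: "a \<le> b"
  shows "(\<integral>\<^sup>+x. ennreal (- Im (stieltjes \<mu> (Complex x \<epsilon>)) / pi) * indicator {a..b} x \<partial>lborel) =
    (\<integral>\<^sup>+t. ennreal ((arctan ((b - t) / \<epsilon>) - arctan ((a - t) / \<epsilon>)) / pi) \<partial>\<mu>)"
proof -
  interpret pair_sigma_finite lborel \<mu> ..
  have den: "(x - t)\<^sup>2 + \<epsilon>\<^sup>2 > 0" for x t using e by (simp add: add_nonneg_pos)
  define k where "k x t = \<epsilon> / ((x - t)\<^sup>2 + \<epsilon>\<^sup>2) / pi" for x t
  have k0: "k x t \<ge> 0" for x t unfolding k_def using e by simp
  have "ennreal (- Im (stieltjes \<mu> (Complex x \<epsilon>)) / pi) = (\<integral>\<^sup>+t. ennreal (k x t) \<partial>\<mu>)" for x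
  proof -
    have "integrable \<mu> (k x)"
      unfolding k_def by (intro integrable_divide_zero Im_stieltjes(2) e)
    then have "(\<integral>\<^sup>+t. ennreal (k x t) \<partial>\<mu>) = ennreal (\<integral>t. k x t \<partial>\<mu>)"
      using k0 by (intro nn_integral_eq_integral) auto
    also have "(\<integral>t. k x t \<partial>\<mu>) = - Im (stieltjes \<mu> (Complex x \<epsilon>)) / pi"
      unfolding k_def integral_divide_zero Im_stieltjes(1)[OF e] ..
    finally show ?thesis ..
  qed
  then have "(\<integral>\<^sup>+x. ennreal (- Im (stieltjes \<mu> (Complex x \<epsilon>)) / pi) * indicator {a..b} x \<partial>lborel) =
     (\<integral>\<^sup>+x. (\<integral>\<^sup>+t. ennreal (k x t) * indicator {a..b} x \<partial>\<mu>) \<partial>lborel)"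
    by (simp add: nn_integral_multc k_def)
  also have "\<dots> = (\<integral>\<^sup>+t. (\<integral>\<^sup>+x. ennreal (k x t) * indicator {a..b} x \<partial>lborel) \<partial>\<mu>)"
    unfolding k_def by (intro Fubini'[symmetric]) measurable
  also have "\<dots> = (\<integral>\<^sup>+t. ennreal ((arctan ((b - t) / \<epsilon>) - arctan ((a - t) / \<epsilon>)) / pi) \<partial>\<mu>)"
  proof (rule nn_integral_cong)
    fix t
    have "((\<lambda>x. arctan ((x - t) / \<epsilon>) / pi) has_real_derivative k x t) (at x)" for x
    proof -
      have "((\<lambda>x. (x - t) / \<epsilon>) has_real_derivative 1 / \<epsilon>) (at x)"
        using e by (auto intro!: derivative_eq_intros)
      then have "((\<lambda>x. arctan ((x - t) / \<epsilon>)) has_real_derivative inverse (1 + ((x - t) / \<epsilon>)\<^sup>2) * (1 / \<epsilon>)) (at x)"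
        by (rule DERIV_chain2[OF DERIV_arctan])
      moreover have "inverse (1 + (u / \<epsilon>)\<^sup>2) * (1 / \<epsilon>) = \<epsilon> / (u\<^sup>2 + \<epsilon>\<^sup>2)" for u
      proof -
        have "1 + (u / \<epsilon>)\<^sup>2 = (u\<^sup>2 + \<epsilon>\<^sup>2) / \<epsilon>\<^sup>2"
          using e by (simp add: power_divide add_divide_distrib)
        then show ?thesis using e by (simp add: power2_eq_square)
      qed
      ultimately show ?thesis unfolding k_def by (intro DERIV_cdivide) simp
    qed
    then have "(\<integral>\<^sup>+x. ennreal (k x t) * indicator {a..b} x \<partial>lborel)
        = ennreal (arctan ((b - t) / \<epsilon>) / pi - arctan ((a - t) / \<epsilon>) / pi)"
      using k0 ab by (intro nn_integral_FTC_Icc) (auto simp: k_def)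
    then show "(\<integral>\<^sup>+x. ennreal (k x t) * indicator {a..b} x \<partial>lborel)
        = ennreal ((arctan ((b - t) / \<epsilon>) - arctan ((a - t) / \<epsilon>)) / pi)"
      by (simp add: diff_divide_distrib)
  qed
  finally show ?thesis .
qed

lemma arctan_scaled_limit: "(\<lambda>n. arctan (c * real (Suc n))) \<longlonglongrightarrow> pi / 2 * sgn c"
proof -
  have pos: "(\<lambda>n. arctan (c * real (Suc n))) \<longlonglongrightarrow> pi / 2" if "c > 0" for c
    by (rule filterlim_compose[OF tendsto_arctan_at_top]) (use that in real_asymp)
  show ?thesis
  proof (cases c "0 :: real" rule: linorder_cases)
    case less
    then show ?thesis using tendsto_minus[OF pos[of "- c"]] by (simp add: arctan_minus)
  qed (use pos in auto)
qed

text \<open>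
  For \<open>a < b\<close> the right-hand side is the measure of the open interval plus half the masses of its end
  points; the sign function is \<open>0\<close> at \<open>0\<close>.
\<close>

lemma stieltjes_inversion_interval:
  fixes D :: "real \<Rightarrow> real"
  assumes a: "0 < a" "a \<le> b"
    and bound: "\<And>x \<epsilon>. a \<le> x \<Longrightarrow> x \<le> b \<Longrightarrow> 0 < \<epsilon> \<Longrightarrow> \<epsilon> \<le> 1 \<Longrightarrow> norm (stieltjes \<mu> (Complex x \<epsilon>)) \<le> B"
    and meas: "D \<in> borel_measurable borel"
    and lim: "AE x in lborel. a \<le> x \<longrightarrow> x \<le> b \<longrightarrow>
      (\<lambda>n. - Im (stieltjes \<mu> (Complex x (1 / real (Suc n)))) / pi) \<longlonglongrightarrow> D x"
  shows "(\<integral>\<^sup>+x. ennreal (D x) * indicator {a..b} x \<partial>lborel) = (\<integral>\<^sup>+t. ennreal ((sgn (b - t) - sgn (a - t)) / 2) \<partial>\<mu>)"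
proof (rule LIMSEQ_unique)
  define f where "f n x = - Im (stieltjes \<mu> (Complex x (1 / real (Suc n)))) / pi" for n x
  have [measurable]: "f n \<in> borel_measurable borel" for n
    unfolding f_def stieltjes_def
    by (simp add: Complex_eq) (measurable)
  have fB: "f n x \<le> B" "f n x \<ge> 0" if "a \<le> x" "x \<le> b" for n x
  proof -
    define y where "y = - Im (stieltjes \<mu> (Complex x (1 / real (Suc n))))"
    have "y \<le> B"
      using abs_Im_le_cmod[of "stieltjes \<mu> (Complex x (1 / real (Suc n)))"]
        bound[OF that, of "1 / real (Suc n)"] by (simp add: y_def)
    moreover have "y \<ge> 0"
      unfolding y_def by (subst Im_stieltjes(1)) (auto intro!: integral_nonneg_AE)
    moreover have "y / pi \<le> y / 1"
      using \<open>y \<ge> 0\<close> pi_ge_two by (intro divide_left_mono) auto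
    moreover have "f n x = y / pi" by (simp only: f_def y_def)
    ultimately show "f n x \<le> B" "f n x \<ge> 0" by auto
  qed
  show "(\<lambda>n. \<integral>\<^sup>+x. ennreal (f n x) * indicator {a..b} x \<partial>lborel) \<longlonglongrightarrow> (\<integral>\<^sup>+x. ennreal (D x) * indicator {a..b} x \<partial>lborel)"
  proof (rule nn_integral_dominated_convergence[where w = "\<lambda>x. ennreal B * indicator {a..b} x"])
    show "(\<integral>\<^sup>+x. ennreal B * indicator {a..b} x \<partial>lborel) < \<infinity>"
      using a by (simp add: nn_integral_cmult ennreal_mult_less_top)
    show "AE x in lborel. ennreal (f n x) * indicator {a..b} x \<le> ennreal B * indicator {a..b} x" for n
      using fB by (intro always_eventually allI) (auto simp: indicator_def intro!: ennreal_leI)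
    show "AE x in lborel. (\<lambda>n. ennreal (f n x) * indicator {a..b} x) \<longlonglongrightarrow> ennreal (D x) * indicator {a..b} x"
      using lim
    proof eventually_elim
      case (elim x)
      then show ?case by (cases "x \<in> {a..b}") (auto simp: f_def intro!: tendsto_ennrealI)
    qed
  qed (use meas in measurable)
  have "(\<lambda>n. \<integral>\<^sup>+t. ennreal ((arctan ((b - t) * real (Suc n)) - arctan ((a - t) * real (Suc n))) / pi) \<partial>\<mu>)
     \<longlonglongrightarrow> (\<integral>\<^sup>+t. ennreal ((sgn (b - t) - sgn (a - t)) / 2) \<partial>\<mu>)"
  proof (rule nn_integral_dominated_convergence[where w = "\<lambda>t. 1"])
    show "AE t in \<mu>. ennreal ((arctan ((b - t) * real (Suc n)) - arctan ((a - t) * real (Suc n))) / pi) \<le> 1" for n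
    proof (intro always_eventually allI)
      fix t
      have "arctan ((b - t) * real (Suc n)) < pi / 2" "arctan ((a - t) * real (Suc n)) > - (pi / 2)"
        using arctan_ubound arctan_lbound by auto
      then show "ennreal ((arctan ((b - t) * real (Suc n)) - arctan ((a - t) * real (Suc n))) / pi) \<le> 1"
        by (simp add: divide_le_eq)
    qed
    show "AE t in \<mu>. (\<lambda>n. ennreal ((arctan ((b - t) * real (Suc n)) - arctan ((a - t) * real (Suc n))) / pi))
       \<longlonglongrightarrow> ennreal ((sgn (b - t) - sgn (a - t)) / 2)"
    proof (intro always_eventually allI tendsto_ennrealI)
      fix t
      have "(\<lambda>n. (arctan ((b - t) * real (Suc n)) - arctan ((a - t) * real (Suc n))) / pi)
        \<longlonglongrightarrow> (pi / 2 * sgn (b - t) - pi / 2 * sgn (a - t)) / pi"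
        by (intro tendsto_intros arctan_scaled_limit) auto
      also have "(pi / 2 * sgn (b - t) - pi / 2 * sgn (a - t)) / pi = (sgn (b - t) - sgn (a - t)) / 2"
        by (simp add: field_simps)
      finally show "(\<lambda>n. (arctan ((b - t) * real (Suc n)) - arctan ((a - t) * real (Suc n))) / pi)
        \<longlonglongrightarrow> (sgn (b - t) - sgn (a - t)) / 2" .
    qed
    show "(\<integral>\<^sup>+t. 1 \<partial>\<mu>) < \<infinity>" using emeasure_space_1 by simp
  qed measurable
  then show "(\<lambda>n. \<integral>\<^sup>+x. ennreal (f n x) * indicator {a..b} x \<partial>lborel) \<longlonglongrightarrow> (\<integral>\<^sup>+t. ennreal ((sgn (b - t) - sgn (a - t)) / 2) \<partial>\<mu>)"
    using nn_integral_Poisson[OF _ a(2), of "1 / real (Suc n)" for n] unfolding f_def by simp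
qed

text \<open>
  Stieltjes inversion for measures on the half-line. The half-lines \<open>{x<..}\<close> with \<open>x \<ge> 0\<close> are exhausted
  by intervals whose end points move strictly, so the masses of the end points do not matter. Boundedness of
  the transform is needed only away from the origin; the point \<open>0\<close> is dealt with by the assumption on the
  atom.
\<close>

lemma stieltjes_inversion:
  fixes D :: "real \<Rightarrow> real"
  assumes atom: "measure \<mu> {0} = 0"
    and bound: "\<And>a b. 0 < a \<Longrightarrow> \<exists>B. \<forall>x \<epsilon>. a \<le> x \<longrightarrow> x \<le> b \<longrightarrow> 0 < \<epsilon> \<longrightarrow> \<epsilon> \<le> 1 \<longrightarrow>
      norm (stieltjes \<mu> (Complex x \<epsilon>)) \<le> B"
    and meas: "D \<in> borel_measurable borel"
    and neg: "\<And>x. x \<le> 0 \<Longrightarrow> D x = 0"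
    and lim: "AE x in lborel. 0 < x \<longrightarrow>
      (\<lambda>n. - Im (stieltjes \<mu> (Complex x (1 / real (Suc n)))) / pi) \<longlonglongrightarrow> D x"
  shows "\<mu> = density lborel (\<lambda>x. ennreal (D x))"
proof (rule measure_eqI_lessThan)
  have pos: "emeasure \<mu> {x<..} = emeasure (density lborel (\<lambda>x. ennreal (D x))) {x<..}" if x: "x \<ge> 0" for x
  proof -
    define a where "a n = x + 1 / real (Suc n)" for n
    define b where "b n = x + 1 + real n" for n
    have ab: "0 < a n" "a n \<le> b n" for n
    proof -
      have "0 < 1 / real (Suc n)" "1 / real (Suc n) \<le> 1" by simp_all
      then show "0 < a n" "a n \<le> b n" using x unfolding a_def b_def by linarith+
    qed
    have "decseq a" unfolding a_def by (intro decseq_SucI) (simp add: frac_le)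
    have "incseq b" unfolding b_def by (intro incseq_SucI) simp
    have eq: "(\<integral>\<^sup>+x. ennreal (D x) * indicator {a n..b n} x \<partial>lborel) =
        (\<integral>\<^sup>+t. ennreal ((sgn (b n - t) - sgn (a n - t)) / 2) \<partial>\<mu>)" for n
    proof -
      obtain B where B: "\<And>x \<epsilon>. a n \<le> x \<Longrightarrow> x \<le> b n \<Longrightarrow> 0 < \<epsilon> \<Longrightarrow> \<epsilon> \<le> 1 \<Longrightarrow>
          norm (stieltjes \<mu> (Complex x \<epsilon>)) \<le> B"
        using bound[OF ab(1), of n "b n"] by blast
      show ?thesis
      proof (rule stieltjes_inversion_interval[OF ab B meas])
        show "AE y in lborel. a n \<le> y \<longrightarrow> y \<le> b n \<longrightarrow>
            (\<lambda>n. - Im (stieltjes \<mu> (Complex y (1 / real (Suc n)))) / pi) \<longlonglongrightarrow> D y"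
          using lim by eventually_elim (use ab(1)[of n] in auto)
      qed auto
    qed
    have a_lim: "a \<longlonglongrightarrow> x" unfolding a_def by real_asymp
    have b_lim: "filterlim b at_top sequentially" unfolding b_def by real_asymp
    have ev: "\<forall>\<^sub>F n in sequentially. (b n > t \<and> (if t > x then a n < t else a n > t))" for t
    proof -
      have "\<forall>\<^sub>F n in sequentially. b n > t" using b_lim by (simp add: filterlim_at_top_dense)
      moreover have "\<forall>\<^sub>F n in sequentially. (if t > x then a n < t else a n > t)"
      proof (cases "t > x")
        case True
        then show ?thesis using order_tendstoD(2)[OF a_lim True] by simp
      next
        case False
        have "a n > t" for n
          proof -
            have "0 < 1 / real (Suc n)" by simp
            then show ?thesis using False unfolding a_def by linarith
          qed
        then show ?thesis using False by simp
      qed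
      ultimately show ?thesis by eventually_elim simp
    qed
    have "(\<lambda>n. \<integral>\<^sup>+x. ennreal (D x) * indicator {a n..b n} x \<partial>lborel)
        \<longlonglongrightarrow> (\<integral>\<^sup>+y. ennreal (D y) * indicator {x<..} y \<partial>lborel)"
    proof (rule nn_integral_LIMSEQ)
      show "incseq (\<lambda>n y. ennreal (D y) * indicator {a n..b n} y)"
      proof (intro incseq_SucI le_funI mult_left_mono)
        fix n y
        have "a (Suc n) \<le> a n" "b n \<le> b (Suc n)"
          using decseq_SucD[OF \<open>decseq a\<close>] incseq_SucD[OF \<open>incseq b\<close>] by auto
        then show "indicator {a n..b n} y \<le> (indicator {a (Suc n)..b (Suc n)} y :: ennreal)"
          by (auto simp: indicator_def)
      qed simp
      show "(\<lambda>n. ennreal (D y) * indicator {a n..b n} y) \<longlonglongrightarrow> ennreal (D y) * indicator {x<..} y" for y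
        by (rule tendsto_eventually)
          (use ev[of y] in eventually_elim, auto simp: indicator_def split: if_splits)
    qed (use meas in measurable)
    moreover have "(\<lambda>n. \<integral>\<^sup>+t. ennreal ((sgn (b n - t) - sgn (a n - t)) / 2) \<partial>\<mu>)
        \<longlonglongrightarrow> (\<integral>\<^sup>+t. indicator {x<..} t \<partial>\<mu>)"
    proof (rule nn_integral_LIMSEQ)
      have "mono (sgn :: real \<Rightarrow> real)" by (auto simp: mono_def sgn_if)
      then have "(sgn (b m - t) - sgn (a m - t)) / 2 \<le> (sgn (b n - t) - sgn (a n - t)) / 2" if "m \<le> n" for m n t
        using monoD[OF \<open>mono sgn\<close>, of "b m - t" "b n - t"] monoD[OF \<open>mono sgn\<close>, of "a n - t" "a m - t"]
          decseqD[OF \<open>decseq a\<close> that] incseqD[OF \<open>incseq b\<close> that] by simp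
      then show "incseq (\<lambda>n t. ennreal ((sgn (b n - t) - sgn (a n - t)) / 2))"
        unfolding incseq_def le_fun_def by (auto intro!: ennreal_leI)
      show "(\<lambda>n. ennreal ((sgn (b n - t) - sgn (a n - t)) / 2)) \<longlonglongrightarrow> indicator {x<..} t" for t
        by (rule tendsto_eventually)
          (use ev[of t] in eventually_elim, auto simp: indicator_def sgn_if split: if_splits)
    qed measurable
    ultimately have "(\<integral>\<^sup>+y. ennreal (D y) * indicator {x<..} y \<partial>lborel) = (\<integral>\<^sup>+t. indicator {x<..} t \<partial>\<mu>)"
      unfolding eq by (rule LIMSEQ_unique)
    then show ?thesis using meas by (simp add: emeasure_density)
  qed
  show "emeasure \<mu> {x<..} = emeasure (density lborel (\<lambda>x. ennreal (D x))) {x<..}" for x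
  proof (cases "x \<ge> 0")
    case False
    have "emeasure \<mu> {x<..} = emeasure \<mu> {0<..}"
    proof (rule emeasure_eq_AE)
      have "{0} \<in> null_sets \<mu>" using atom by (auto simp: null_sets_def emeasure_eq_measure)
      then have "AE t in \<mu>. t \<notin> {0}" by (rule AE_not_in)
      then show "AE t in \<mu>. (t \<in> {x<..}) = (t \<in> {0<..})"
        using AE_support by eventually_elim (use False in auto)
    qed auto
    also have "\<dots> = emeasure (density lborel (\<lambda>x. ennreal (D x))) {0<..}" by (rule pos) simp
    also have "\<dots> = emeasure (density lborel (\<lambda>x. ennreal (D x))) {x<..}"
      using meas False neg by (simp add: emeasure_density) (auto intro!: nn_integral_cong simp: indicator_def)
    finally show ?thesis .
  qed (rule pos)
  show "emeasure \<mu> {x<..} < \<infinity>" for x by (simp add: emeasure_eq_measure)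
qed (simp_all add: sets_borel)

end

section \<open>Boundary values of the algebraic branch\<close>

lemma cpoly_of_real: "poly (cpoly P) (complex_of_real s) = of_real (poly P s)"
  by (induction P) (simp_all add: map_poly_pCons)

lemma cpoly_cnj_root: "poly (cpoly P) (cnj z) = 0 \<longleftrightarrow> poly (cpoly P) z = 0"
  by (intro real_poly_cnj_root_iff) (simp add: coeff_map_poly)

lemma cpoly_diff_smult: "cpoly (P - smult x Q) = cpoly P - smult (of_real x) (cpoly Q)"
  by (intro poly_eqI) (simp add: coeff_map_poly)

text \<open>
  The branch \<open>w\<close> solves \<open>P(w) = z Q(w)\<close> off the cut, whose end points are branch points, and for
  every \<open>x > 0\<close> the polynomial \<open>P - x Q\<close> has two roots in the sector and none on its boundary.
\<close>

locale algebraic_branch = compact_prob \<mu> xs for \<mu> :: "real measure" and xs :: real +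
  fixes P Q :: "real poly" and \<alpha> :: real
  assumes cut: "algebraic_with_cut P Q xs branch"
    and coprime_PQ: "coprime P Q"
    and P_pos: "\<And>t. 0 < t \<Longrightarrow> t \<le> 1 \<Longrightarrow> poly P t > 0"
    and deg: "degree P \<ge> degree Q + 2"
    and lim: "filterlim (\<lambda>t. poly P t / poly Q t) at_top at_top"
    and \<alpha>_range: "0 < \<alpha>" "\<alpha> \<le> pi / 2"
    and two_roots: "\<And>x. x > 0 \<Longrightarrow>
          size (filter_mset (\<lambda>w. w \<in> sector \<alpha>) (proots (cpoly (P - smult x Q)))) = 2"
    and no_frontier_roots: "\<And>x w. x > 0 \<Longrightarrow> w \<in> frontier (sector \<alpha>) \<Longrightarrow>
          poly (cpoly (P - smult x Q)) w \<noteq> 0"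
    and no_ray_roots: "\<And>z. z \<in> open_ray \<alpha> \<Longrightarrow> poly (cpoly P) z \<noteq> 0"
begin

abbreviation p where "p \<equiv> cpoly P"
abbreviation q where "q \<equiv> cpoly Q"
abbreviation C where "C \<equiv> complex_of_real ` {0..xs}"

lemma branch_holomorphic: "branch holomorphic_on (- C)"
  and branch_root: "z \<notin> C \<Longrightarrow> poly p (branch z) = z * poly q (branch z)"
  and branch_point_xs: "branch_point C branch (of_real xs)"
  using cut by (auto simp: algebraic_with_cut_def Let_def)

lemma branch_continuous: "continuous_on (- C) branch"
  by (rule holomorphic_on_imp_continuous_on[OF branch_holomorphic])

lemma branch_isCont: "z \<notin> C \<Longrightarrow> isCont branch z"
proof -
  assume z: "z \<notin> C"
  have "compact C" by (intro compact_continuous_image continuous_intros) auto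
  then have "open (- C)" by (intro open_Compl compact_imp_closed)
  then show ?thesis using branch_continuous z by (simp add: continuous_on_eq_continuous_at)
qed

lemma deg_pq: "degree q < degree p"
  using deg by (simp add: degree_map_poly)

lemma root_iff: "poly (cpoly (P - smult x Q)) w = 0 \<longleftrightarrow> poly p w = of_real x * poly q w"
  by (simp add: cpoly_diff_smult)

lemma cpoly_nonzero: "cpoly (P - smult x Q) \<noteq> 0"
proof -
  have "degree (- smult x Q) < degree P" using deg degree_smult_le[of x Q] by simp
  then have "degree (P - smult x Q) = degree P" unfolding diff_conv_add_uminus by (rule degree_add_eq_left)
  then have "degree (cpoly (P - smult x Q)) \<noteq> 0" using deg by (simp add: degree_map_poly)
  then show ?thesis by auto
qed

lemma sin_pos: "sin \<alpha> > 0"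
  using \<alpha>_range pi_gt_zero by (intro sin_gt_zero) auto

lemma cos_nonneg: "cos \<alpha> \<ge> 0"
  using \<alpha>_range by (intro cos_ge_zero) auto

lemma closed_sector: "closed (sector \<alpha>)"
  unfolding sector_eq[OF \<alpha>_range] by (rule closed_sector_eq)

lemma cnj_sector: "cnj z \<in> sector \<alpha> \<longleftrightarrow> z \<in> sector \<alpha>"
  by (simp add: sector_eq[OF \<alpha>_range])

lemma sector_Re_nonneg: "z \<in> sector \<alpha> \<Longrightarrow> Re z \<ge> 0"
proof -
  assume "z \<in> sector \<alpha>"
  then have "cos \<alpha> * \<bar>Im z\<bar> \<le> sin \<alpha> * Re z" by (simp add: sector_eq[OF \<alpha>_range])
  moreover have "cos \<alpha> * \<bar>Im z\<bar> \<ge> 0" using cos_nonneg by simp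
  ultimately have "sin \<alpha> * Re z \<ge> 0" by linarith
  then show ?thesis using sin_pos by (simp add: zero_le_mult_iff)
qed

lemma positive_in_sector: "s \<ge> 0 \<Longrightarrow> of_real s \<in> sector \<alpha>"
  using sin_pos by (simp add: sector_eq[OF \<alpha>_range])

lemma sector_root_interior:
  assumes "x > 0" "u \<in> sector \<alpha>" "poly p u = of_real x * poly q u"
  shows "cos \<alpha> * \<bar>Im u\<bar> < sin \<alpha> * Re u"
proof -
  have "u \<notin> frontier (sector \<alpha>)" using no_frontier_roots[OF assms(1), of u] assms(3) root_iff by blast
  then have "cos \<alpha> * \<bar>Im u\<bar> \<noteq> sin \<alpha> * Re u" unfolding frontier_sector[OF \<alpha>_range] by simp
  then show ?thesis using assms(2) by (simp add: sector_eq[OF \<alpha>_range])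
qed

lemma sector_root_Re_pos:
  assumes "x > 0" "u \<in> sector \<alpha>" "poly p u = of_real x * poly q u"
  shows "Re u > 0"
proof -
  have "cos \<alpha> * \<bar>Im u\<bar> \<ge> 0" using cos_nonneg by simp
  then have "sin \<alpha> * Re u > 0" using sector_root_interior[OF assms] by linarith
  then show ?thesis using sin_pos by (simp add: zero_less_mult_iff)
qed

lemma cnj_root:
  "poly p (cnj u) = of_real x * poly q (cnj u) \<longleftrightarrow> poly p u = of_real x * poly q u"
  using cpoly_cnj_root[of "P - smult x Q" u] unfolding root_iff .

text \<open>
  A disc around a point \<open>c\<close> of the real axis, slit along a radius. For \<open>c = 0\<close>, \<open>\<sigma> = -1\<close> and for
  \<open>c = xs\<close>, \<open>\<sigma> = 1\<close> it is a disc around an end point of the cut, minus the cut, provided that \<open>d \<le> xs\<close>.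
\<close>

definition slit :: "real \<Rightarrow> real \<Rightarrow> real \<Rightarrow> complex set" where
  "slit \<sigma> c d = {z \<in> ball (of_real c) d. \<not> (Im z = 0 \<and> \<sigma> * (Re z - c) \<le> 0)}"

lemma slit_end:
  assumes "\<sigma> = -1 \<and> c = 0 \<or> \<sigma> = 1 \<and> c = xs"
  shows "slit \<sigma> c d \<subseteq> - C" and "d \<le> xs \<Longrightarrow> slit \<sigma> c d = ball (of_real c) d - C"
proof -
  show sub: "slit \<sigma> c d \<subseteq> - C" using assms by (auto simp: slit_def)
  assume d: "d \<le> xs"
  have "z \<in> C" if "z \<in> ball (of_real c) d" "Im z = 0" "\<sigma> * (Re z - c) \<le> 0" for z
  proof -
    have "\<bar>Re z - c\<bar> < d"
      using that(1) abs_Re_le_cmod[of "z - of_real c"] by (simp add: dist_norm norm_minus_commute)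
    then have "0 \<le> Re z" "Re z \<le> xs" using assms that(3) d by auto
    moreover have "z = of_real (Re z)" using that(2) by (simp add: complex_eq_iff)
    ultimately show ?thesis by (metis atLeastAtMost_iff image_eqI)
  qed
  then show "slit \<sigma> c d = ball (of_real c) d - C" using sub by (auto simp: slit_def)
qed

text \<open>
  The branch is continuous at an end point of the cut: one sequential limit is a limit.
\<close>

lemma branch_limit_at_end:
  assumes c: "\<sigma> = -1 \<and> c = 0 \<or> \<sigma> = 1 \<and> c = xs"
    and Z: "Z \<longlonglongrightarrow> of_real c" "\<And>n. \<not> (Im (Z n) = 0 \<and> \<sigma> * (Re (Z n) - c) \<le> 0)"
    and W: "(\<lambda>n. branch (Z n)) \<longlonglongrightarrow> r"
    and e: "e > 0"
  obtains d where "d > 0" "d \<le> xs" "\<And>z. z \<in> slit \<sigma> c d \<Longrightarrow> dist r (branch z) < e"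
proof -
  obtain d e' where d: "d > 0" "0 < e'" "e' \<le> e"
    and near: "\<And>w S. S \<subseteq> ball (of_real c) d \<Longrightarrow> connected S \<Longrightarrow> continuous_on S w \<Longrightarrow>
      (\<And>z. z \<in> S \<Longrightarrow> poly p (w z) = z * poly q (w z)) \<Longrightarrow>
      \<exists>z\<in>S. dist r (w z) < e' \<Longrightarrow> \<forall>z\<in>S. dist r (w z) < e"
  proof (rule branch_stays_near_root[OF deg_pq e, of "of_real c" r])
    fix d e' :: real
    assume "d > 0" "0 < e'" "e' \<le> e"
      "\<And>w S. S \<subseteq> ball (of_real c) d \<Longrightarrow> connected S \<Longrightarrow> continuous_on S w \<Longrightarrow>
        (\<And>z. z \<in> S \<Longrightarrow> poly p (w z) = z * poly q (w z)) \<Longrightarrow>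
        \<exists>z\<in>S. dist r (w z) < e' \<Longrightarrow> \<forall>z\<in>S. dist r (w z) < e"
    then show thesis by (rule that[of d e'])
  qed
  define d' where "d' = min d xs"
  have d': "d' > 0" "d' \<le> d" "d' \<le> xs" using d xs_pos by (auto simp: d'_def)
  have sub: "slit \<sigma> c d' \<subseteq> - C" by (rule slit_end(1)[OF c])
  have "\<forall>z\<in>slit \<sigma> c d'. dist r (branch z) < e"
  proof (rule near)
    show "slit \<sigma> c d' \<subseteq> ball (of_real c) d" using d'(2) by (auto simp: slit_def)
    show "connected (slit \<sigma> c d')"
      unfolding slit_def using c d'(1) by (intro connected_slit_ball) auto
    show "continuous_on (slit \<sigma> c d') branch" using branch_continuous sub by (rule continuous_on_subset)
    show "poly p (branch z) = z * poly q (branch z)" if "z \<in> slit \<sigma> c d'" for z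
      using branch_root sub that by blast
    have "\<forall>\<^sub>F n in sequentially. dist (Z n) (of_real c) < d'" using Z(1) d'(1) by (rule tendstoD)
    moreover have "\<forall>\<^sub>F n in sequentially. dist (branch (Z n)) r < e'" using W d(2) by (rule tendstoD)
    ultimately have "\<forall>\<^sub>F n in sequentially. Z n \<in> slit \<sigma> c d' \<and> dist r (branch (Z n)) < e'"
      by eventually_elim (use Z(2) in \<open>auto simp: slit_def dist_commute\<close>)
    then obtain n where "Z n \<in> slit \<sigma> c d' \<and> dist r (branch (Z n)) < e'"
      by (metis (mono_tags, lifting) eventually_sequentially order_refl)
    then show "\<exists>z\<in>slit \<sigma> c d'. dist r (branch z) < e'" by blast
  qed
  then show ?thesis by (intro that[OF d'(1,3)]) (rule bspec)
qed

text \<open>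
  On the negative axis the values of the branch lie in \<open>(0, 1]\<close>. A limit of them at the origin is a
  zero of \<open>P\<close> in \<open>[0, 1]\<close>, and the only possible one is \<open>0\<close>.
\<close>

lemma left_limit:
  obtains Z where "Z \<longlonglongrightarrow> 0" "\<And>n. Im (Z n) = 0 \<and> Re (Z n) < 0" "(\<lambda>n. branch (Z n)) \<longlonglongrightarrow> 0"
    and "poly P 0 = 0" "poly Q 0 < 0" "measure \<mu> {0} = 0"
proof -
  define Y where "Y n = 1 / real (Suc n)" for n
  define Z where "Z n = complex_of_real (- Y n)" for n
  have Y0: "Y n > 0" for n by (simp add: Y_def)
  have Yl: "Y \<longlonglongrightarrow> 0" unfolding Y_def by real_asymp
  have Zl: "Z \<longlonglongrightarrow> 0" unfolding Z_def using tendsto_of_real[OF tendsto_minus[OF Yl]] by simp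
  define V where "V n = Re (branch (Z n))" for n
  have V: "branch (Z n) = of_real (V n)" "0 < V n" "V n \<le> 1" "measure \<mu> {0} \<le> V n" for n
    unfolding V_def Z_def using branch_left[OF Y0] atom_le_branch_left[OF Y0] by auto
  have nC: "Z n \<notin> C" for n using Y0[of n] by (auto simp: Z_def simp del: of_real_minus)
  have "compact (complex_of_real ` {0..1})" by (intro compact_continuous_image continuous_intros) auto
  then obtain l r where r: "strict_mono (r :: nat \<Rightarrow> nat)" "((\<lambda>n. branch (Z n)) \<circ> r) \<longlonglongrightarrow> l"
      "l \<in> complex_of_real ` {0..1}" "poly p l = 0 * poly q l"
    using root_limit[OF deg_pq compact_imp_closed Zl, of "complex_of_real ` {0..1}" "\<lambda>n. branch (Z n)"]
      V branch_root[OF nC] by (metis (no_types, lifting) atLeastAtMost_iff image_eqI less_imp_le)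
  obtain s where s: "0 \<le> s" "s \<le> 1" "l = of_real s" using r(3) by auto
  have "poly P s = 0" using r(4) by (simp add: s cpoly_of_real)
  then have s0: "s = 0" using P_pos[of s] s by force
  then have P0: "poly P 0 = 0" using \<open>poly P s = 0\<close> by simp
  have Vl: "(\<lambda>n. V (r n)) \<longlonglongrightarrow> 0"
  proof -
    have "(\<lambda>n. Re (branch (Z (r n)))) \<longlonglongrightarrow> Re l" using tendsto_Re[OF r(2)] by (simp add: o_def)
    then show ?thesis by (simp add: V_def s s0)
  qed
  have "measure \<mu> {0} \<le> 0" by (rule tendsto_lowerbound[OF Vl]) (simp_all add: V(4))
  then have m0: "measure \<mu> {0} = 0" by (simp add: measure_le_0_iff)
  have "poly Q (V n) < 0" for n
  proof -
    have "of_real (poly P (V n)) = complex_of_real (- Y n * poly Q (V n))"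
      using branch_root[OF nC[of n]] V(1)[of n] by (simp add: cpoly_of_real Z_def)
    then have "poly P (V n) = - Y n * poly Q (V n)" using of_real_eq_iff by blast
    moreover have "poly P (V n) > 0" using P_pos V by blast
    ultimately have "Y n * poly Q (V n) < 0" by linarith
    then show ?thesis using Y0[of n] by (simp add: mult_less_0_iff)
  qed
  moreover have "(\<lambda>n. poly Q (V (r n))) \<longlonglongrightarrow> poly Q 0" by (intro tendsto_intros Vl)
  ultimately have "poly Q 0 \<le> 0" by (intro tendsto_upperbound[OF \<open>(\<lambda>n. poly Q (V (r n))) \<longlonglongrightarrow> poly Q 0\<close>]) (simp_all add: less_imp_le)
  moreover have "poly Q 0 \<noteq> 0"
  proof
    assume "poly Q 0 = 0"
    then have "[:0, 1:] dvd P" "[:0, 1:] dvd Q" using P0 by (simp_all add: poly_eq_0_iff_dvd)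
    then have "is_unit [:0, 1 :: real:]" using coprime_PQ by (rule coprime_common_divisor[rotated])
    then show False by (simp add: is_unit_poly_iff)
  qed
  ultimately have "poly Q 0 < 0" by simp
  have "(Z \<circ> r) \<longlonglongrightarrow> 0" by (rule LIMSEQ_subseq_LIMSEQ[OF Zl r(1)])
  then show ?thesis
    using that[of "Z \<circ> r"] r(2) Y0 P0 \<open>poly Q 0 < 0\<close> m0 by (simp add: o_def Z_def s s0)
qed

text \<open>
  Just above the positive axis the branch takes values in the sector. The segment from \<open>a + i\<epsilon>\<close> to
  \<open>b + i\<epsilon>\<close> with \<open>b > xs\<close> is so close to the axis that no root over it lies on the boundary of the
  sector; at the right end the branch is close to the positive number \<open>w(b)\<close>.
\<close>

lemma branch_in_sector:
  assumes a: "a > 0"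
  obtains \<epsilon>0 where "\<epsilon>0 > 0" "\<And>\<epsilon>. 0 < \<epsilon> \<Longrightarrow> \<epsilon> < \<epsilon>0 \<Longrightarrow> branch (Complex a \<epsilon>) \<in> sector \<alpha>"
proof -
  define b where "b = a + xs + 1"
  have b: "a < b" "xs < b" using a xs_pos by (auto simp: b_def)
  let ?K = "complex_of_real ` {a..b}"
  have K: "compact ?K" by (intro compact_continuous_image continuous_intros) auto
  have "poly p w \<noteq> z * poly q w" if "z \<in> ?K" "w \<in> frontier (sector \<alpha>)" for z w
  proof -
    obtain s where s: "z = of_real s" "a \<le> s" using \<open>z \<in> ?K\<close> by auto
    then show ?thesis using no_frontier_roots[of s w] a that(2) root_iff[of s w] by simp
  qed
  then obtain d where d: "d > 0"
    "\<And>z z0 w. z0 \<in> ?K \<Longrightarrow> dist z0 z < d \<Longrightarrow> w \<in> frontier (sector \<alpha>) \<Longrightarrow> poly p w \<noteq> z * poly q w"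
    using no_roots_near[OF deg_pq frontier_closed K, of "sector \<alpha>"] by metis
  have bC: "complex_of_real b \<notin> C" using b by auto
  let ?I = "{z. cos \<alpha> * \<bar>Im z\<bar> < sin \<alpha> * Re z}"
  have "branch (of_real b) \<in> ?I" using branch_right[OF b(2)] sin_pos branch_real(1)[of b] b(2) by simp
  then have "\<forall>\<^sub>F z in at (of_real b). branch z \<in> ?I"
    using branch_isCont[OF bC] open_sector_interior unfolding isCont_def by (intro topological_tendstoD)
  then obtain d' where d': "d' > 0" "\<And>z. z \<noteq> of_real b \<Longrightarrow> dist z (of_real b) < d' \<Longrightarrow> branch z \<in> ?I"
    unfolding eventually_at by blast
  show ?thesis
  proof (rule that[of "min d d'"])
    fix \<epsilon> assume e: "0 < \<epsilon>" "\<epsilon> < min d d'"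
    let ?S = "(\<lambda>s. Complex s \<epsilon>) ` {a..b}"
    have eq: "Complex s \<epsilon> - of_real s = \<i> * of_real \<epsilon>" for s by (simp add: complex_eq_iff)
    have dist: "dist (of_real s) (Complex s \<epsilon>) = \<epsilon>" for s
      using e(1) by (subst dist_commute) (simp add: dist_norm eq norm_mult)
    have SC: "?S \<subseteq> - C" using e(1) by (auto simp: complex_eq_iff)
    have conn: "connected ?S" by (intro connected_continuous_image) (auto simp: Complex_eq intro!: continuous_intros)
    have "connected (branch ` ?S)"
      by (rule connected_continuous_image[OF continuous_on_subset[OF branch_continuous SC] conn])
    moreover have "branch ` ?S \<inter> sector \<alpha> \<noteq> {}"
    proof -
      have "branch (Complex b \<epsilon>) \<in> ?I" using d'(2)[of "Complex b \<epsilon>"] dist[of b] e by (auto simp: dist_commute complex_eq_iff)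
      then have "branch (Complex b \<epsilon>) \<in> sector \<alpha>" by (simp add: sector_eq[OF \<alpha>_range])
      moreover have "Complex b \<epsilon> \<in> ?S" using b by auto
      ultimately show ?thesis by blast
    qed
    moreover have "branch ` ?S \<inter> frontier (sector \<alpha>) = {}"
    proof -
      have "branch (Complex s \<epsilon>) \<notin> frontier (sector \<alpha>)" if "s \<in> {a..b}" for s
      proof -
        have "Complex s \<epsilon> \<notin> C" using SC that by blast
        then have root: "poly p (branch (Complex s \<epsilon>)) = Complex s \<epsilon> * poly q (branch (Complex s \<epsilon>))"
          by (rule branch_root)
        have sK: "of_real s \<in> ?K" using that by blast
        have "dist (of_real s) (Complex s \<epsilon>) < d" unfolding dist using e by simp
        then show ?thesis using d(2)[OF sK] root by blast
      qed
      then show ?thesis by auto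
    qed
    ultimately have "branch ` ?S - sector \<alpha> = {}"
      using connected_Int_frontier[of "branch ` ?S" "sector \<alpha>"] by (metis (full_types))
    then show "branch (Complex a \<epsilon>) \<in> sector \<alpha>" using b by auto
  qed (use d d' in auto)
qed

text \<open>
  The root in question is a limit of \<open>w(x + i\<epsilon>)\<close> as \<open>\<epsilon> \<rightarrow> 0\<close>, and \<open>w\<close> is small near the origin.
  It is not real, because \<open>P > 0 > Q\<close> on an interval \<open>(0, e]\<close>.
\<close>

lemma small_nonreal_roots:
  assumes \<eta>: "\<eta> > 0"
  obtains x0 where "x0 > 0" "\<And>x. 0 < x \<Longrightarrow> x < x0 \<Longrightarrow>
    \<exists>u\<in>sector \<alpha>. poly p u = of_real x * poly q u \<and> Im u \<noteq> 0 \<and> norm u < \<eta>"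
proof -
  obtain Z where Z: "Z \<longlonglongrightarrow> 0" "\<And>n. Im (Z n) = 0 \<and> Re (Z n) < 0" "(\<lambda>n. branch (Z n)) \<longlonglongrightarrow> 0"
    and Q0: "poly Q 0 < 0" using left_limit by metis
  have "\<forall>\<^sub>F t in at 0. poly Q t < 0"
    using Q0 by (intro order_tendstoD(2)[of _ "poly Q 0"] isContD) (auto intro: poly_isCont)
  then obtain e1 where e1: "e1 > 0" "\<And>t. t \<noteq> 0 \<Longrightarrow> \<bar>t\<bar> < e1 \<Longrightarrow> poly Q t < 0"
    unfolding eventually_at by (auto simp: dist_real_def)
  define e where "e = Min {\<eta> / 2, e1 / 2, 1 / 2}"
  have e: "e > 0" "e < \<eta>" "e < e1" "e < 1" using \<eta> e1(1) by (auto simp: e_def min_less_iff_disj)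
  obtain d where d: "d > 0" "\<And>z. z \<in> slit (-1) 0 d \<Longrightarrow> dist 0 (branch z) < e"
  proof (rule branch_limit_at_end[of "-1" 0 Z 0 e])
    show "\<not> (Im (Z n) = 0 \<and> - 1 * (Re (Z n) - 0) \<le> 0)" for n using Z(2)[of n] by simp
  qed (use Z e in auto)
  show ?thesis
  proof (rule that[OF d(1)])
    fix x assume x: "0 < x" "x < d"
    obtain \<epsilon>0 where \<epsilon>0: "\<epsilon>0 > 0" "\<And>\<epsilon>. 0 < \<epsilon> \<Longrightarrow> \<epsilon> < \<epsilon>0 \<Longrightarrow> branch (Complex x \<epsilon>) \<in> sector \<alpha>"
      using branch_in_sector[OF x(1)] by metis
    define m where "m = min \<epsilon>0 (d - x)"
    have m: "m > 0" "m \<le> \<epsilon>0" "m \<le> d - x" using \<epsilon>0 x by (auto simp: m_def)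
    \<comment> \<open>The denominator \<open>n + 2\<close> keeps \<open>E n\<close> strictly below \<open>m\<close>.\<close>
    define E where "E n = m / real (n + 2)" for n :: nat
    have E: "0 < E n" "E n < m" for n using m(1) by (auto simp: E_def divide_less_eq)
    have El: "E \<longlonglongrightarrow> 0" unfolding E_def by real_asymp
    define Y where "Y n = Complex x (E n)" for n
    have Yl: "Y \<longlonglongrightarrow> of_real x"
      unfolding Y_def Complex_eq using tendsto_add[OF tendsto_const tendsto_mult[OF tendsto_const tendsto_of_real[OF El]], of "of_real x" \<i>] by simp
    have YC: "Y n \<notin> C" for n using E(1)[of n] by (auto simp: Y_def complex_eq_iff)
    have Ysec: "branch (Y n) \<in> sector \<alpha>" for n
      using \<epsilon>0(2)[of "E n"] E[of n] m by (auto simp: Y_def)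
    have Ye: "branch (Y n) \<in> cball 0 e" for n
    proof -
      have "norm (Y n) \<le> \<bar>x\<bar> + \<bar>E n\<bar>" using cmod_le[of "Y n"] by (simp add: Y_def)
      then have "Y n \<in> slit (-1) 0 d" using E[of n] m x by (simp add: slit_def Y_def)
      then show ?thesis using d(2) by force
    qed
    obtain u r where u: "u \<in> sector \<alpha> \<inter> cball 0 e" "poly p u = of_real x * poly q u"
      using root_limit[OF deg_pq closed_Int[OF closed_sector closed_cball] Yl, of "\<lambda>n. branch (Y n)" 0 e]
        branch_root[OF YC] Ysec Ye by (metis IntI)
    have "Im u \<noteq> 0"
    proof
      assume "Im u = 0"
      then have ur: "u = of_real (Re u)" by (simp add: complex_eq_iff)
      have s: "Re u > 0" by (rule sector_root_Re_pos[OF x(1)]) (use u in auto)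
      have "norm u \<le> e" using u(1) by simp
      then have "Re u \<le> e" using complex_Re_le_cmod[of u] by linarith
      then have "poly P (Re u) > 0" "poly Q (Re u) < 0" using P_pos s e e1(2) by auto
      moreover have "poly P (Re u) = x * poly Q (Re u)"
      proof -
        have "complex_of_real (poly P (Re u)) = of_real (x * poly Q (Re u))"
          using u(2) ur by (metis cpoly_of_real of_real_mult)
        then show ?thesis using of_real_eq_iff by blast
      qed
      ultimately show False using x(1) by (simp add: zero_less_mult_iff)
    qed
    moreover have "norm u < \<eta>" using u(1) e(2) by simp
    ultimately show "\<exists>u\<in>sector \<alpha>. poly p u = of_real x * poly q u \<and> Im u \<noteq> 0 \<and> norm u < \<eta>"
      using u by blast
  qed
qed

lemma root_near_zero_of_P:
  assumes z0: "poly p z0 = 0" and r: "r > 0"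
  obtains x0 where "x0 > 0" "\<And>x. 0 < x \<Longrightarrow> x < x0 \<Longrightarrow> \<exists>w. dist z0 w < r \<and> poly p w = of_real x * poly q w"
proof (cases "poly q z0 = 0")
  case True
  \<comment> \<open>A common zero of \<open>P\<close> and \<open>Q\<close> is a root of \<open>P - x Q\<close> for every \<open>x\<close>.\<close>
  show ?thesis by (rule that[of 1]) (use True z0 r in \<open>auto intro!: exI[of _ z0]\<close>)
next
  case False
  define f where "f w = poly p w / poly q w" for w
  have "open {w. poly q w \<noteq> 0}" by (intro open_Collect_neq continuous_intros)
  then obtain s where s: "s > 0" "ball z0 s \<subseteq> {w. poly q w \<noteq> 0}" using False openE by blast
  let ?B = "ball z0 (min r s)"
  have q: "poly q w \<noteq> 0" if "w \<in> ?B" for w using s(2) that by auto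
  have hol: "f holomorphic_on ?B" unfolding f_def using q by (intro holomorphic_intros) auto
  have z0B: "z0 \<in> ?B" using r s by simp
  have "\<not> f constant_on ?B"
  proof
    assume "f constant_on ?B"
    then have "f w = f z0" if "w \<in> ?B" for w using that z0B unfolding constant_on_def by metis
    then have "?B \<subseteq> {w. poly p w = 0}" using z0 q by (auto simp: f_def)
    moreover have "finite {w. poly p w = 0}" using deg_pq by (intro poly_roots_finite) auto
    ultimately have "finite ?B" by (rule finite_subset)
    then show False using r s finite_imp_not_open[of ?B] z0B by blast
  qed
  then have "open (f ` ?B)" by (intro open_mapping_thm[OF hol]) auto
  moreover have "0 \<in> f ` ?B" using z0 z0B by (intro image_eqI[of _ _ z0]) (auto simp: f_def)
  ultimately obtain x0 where x0: "x0 > 0" "ball 0 x0 \<subseteq> f ` ?B" using openE by blast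
  have "\<exists>w. dist z0 w < r \<and> poly p w = of_real x * poly q w" if "0 < x" "x < x0" for x
  proof -
    have "of_real x \<in> f ` ?B" using x0(2) that by auto
    then obtain w where w: "w \<in> ?B" "f w = of_real x" by auto
    then have "poly p w = of_real x * poly q w" using q[OF w(1)] by (simp add: f_def field_simps)
    then show ?thesis using w(1) by auto
  qed
  then show ?thesis using that x0(1) by blast
qed

text \<open>
  A further zero \<open>z0\<close> of \<open>P\<close> in the sector would, for small \<open>x > 0\<close>, give a root of \<open>P - x Q\<close> near \<open>z0\<close>,
  in addition to the conjugate pair of roots near the origin.
\<close>

lemma P_nonzero_in_sector:
  assumes z0: "z0 \<in> sector \<alpha>" "z0 \<noteq> 0"
  shows "poly p z0 \<noteq> 0"
proof
  assume root: "poly p z0 = 0"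
  let ?I = "{z. cos \<alpha> * \<bar>Im z\<bar> < sin \<alpha> * Re z}"
  have z0I: "z0 \<in> ?I"
  proof (rule ccontr)
    assume "z0 \<notin> ?I"
    then have eq: "cos \<alpha> * \<bar>Im z0\<bar> = sin \<alpha> * Re z0" using z0(1) by (simp add: sector_eq[OF \<alpha>_range])
    define t where "t = \<bar>Im z0\<bar> / sin \<alpha>"
    have t: "\<bar>Im z0\<bar> = t * sin \<alpha>" "Re z0 = t * cos \<alpha>"
      using eq sin_pos by (simp_all add: t_def field_simps)
    have "t \<noteq> 0" using t z0(2) by (auto simp: complex_eq_iff)
    moreover have "t \<ge> 0" using sin_pos by (simp add: t_def)
    ultimately have "t > 0" by simp
    moreover have "of_real t * cis \<alpha> = z0 \<or> of_real t * cis \<alpha> = cnj z0"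
      using t by (cases "Im z0 \<ge> 0") (auto simp: complex_eq_iff)
    ultimately have "z0 \<in> open_ray \<alpha> \<or> cnj z0 \<in> open_ray \<alpha>" unfolding open_ray_def by (metis (mono_tags, lifting) mem_Collect_eq)
    then show False using no_ray_roots root cpoly_cnj_root by blast
  qed
  then obtain s where s: "s > 0" "ball z0 s \<subseteq> ?I" using open_sector_interior openE by blast
  define r where "r = min s (norm z0 / 2)"
  have r: "r > 0" using s(1) z0(2) by (simp add: r_def)
  obtain x0 where x0: "x0 > 0" "\<And>x. 0 < x \<Longrightarrow> x < x0 \<Longrightarrow> \<exists>w. dist z0 w < r \<and> poly p w = of_real x * poly q w"
    using root_near_zero_of_P[OF root r] by metis
  obtain x1 where x1: "x1 > 0" "\<And>x. 0 < x \<Longrightarrow> x < x1 \<Longrightarrow>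
    \<exists>u\<in>sector \<alpha>. poly p u = of_real x * poly q u \<and> Im u \<noteq> 0 \<and> norm u < norm z0 / 2"
    using small_nonreal_roots[of "norm z0 / 2"] z0(2) by (metis half_gt_zero zero_less_norm_iff)
  define x where "x = min x0 x1 / 2"
  have x: "0 < x" "x < x0" "x < x1" using x0(1) x1(1) by (auto simp: x_def)
  obtain w where w: "dist z0 w < r" "poly p w = of_real x * poly q w" using x0(2) x by blast
  obtain u where u: "u \<in> sector \<alpha>" "poly p u = of_real x * poly q u" "Im u \<noteq> 0" "norm u < norm z0 / 2"
    using x1(2) x by blast
  have "w \<in> ball z0 s" using w(1) by (simp add: r_def)
  then have "w \<in> sector \<alpha>" using s(2) by (auto simp: sector_eq[OF \<alpha>_range])
  moreover have "norm w > norm z0 / 2"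
    using w(1) norm_triangle_ineq2[of z0 "z0 - w"] norm_triangle_ineq2[of z0 w] by (simp add: dist_norm r_def)
  moreover have "u \<noteq> cnj u" using u(3) by (simp add: complex_eq_iff)
  ultimately show False
    using two_roots_only[OF cpoly_nonzero two_roots[OF x(1)], of u "cnj u" w] u w cnj_sector cnj_root root_iff
    by auto
qed

lemma P_pos_axis:
  assumes "t > 0"
  shows "poly P t > 0"
proof (rule ccontr)
  assume neg: "\<not> poly P t > 0"
  have nz: "poly P s \<noteq> 0" if "s > 0" for s
    using P_nonzero_in_sector[OF positive_in_sector[of s]] that by (auto simp: cpoly_of_real)
  have "t > 1" using neg P_pos[of t] assms by force
  moreover have "poly P t < 0" using neg nz[OF assms] by linarith
  ultimately obtain s where "s > 1" "poly P s = 0" using poly_IVT_neg[of 1 t P] P_pos[of 1] by auto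
  then show False using nz by simp
qed

text \<open>
  A positive root \<open>t\<close> for \<open>x < xs\<close> makes \<open>P - xs Q\<close> negative at \<open>t\<close>, while this polynomial is
  positive at \<open>0\<close> and near infinity. Its two distinct roots on the positive axis are then all its roots in the
  sector, and they are simple. As \<open>w\<close> tends to one of them at \<open>xs\<close>, it extends holomorphically across
  \<open>xs\<close>, which is not possible at a branch point.
\<close>

lemma no_positive_root:
  assumes x: "0 < x" "x < xs" and t: "t > 0"
  shows "poly P t \<noteq> x * poly Q t"
proof
  assume root: "poly P t = x * poly Q t"
  obtain Q0: "poly P 0 = 0" "poly Q 0 < 0" using left_limit by metis
  define h where "h = P - smult xs Q"
  have "x * poly Q t > 0" using P_pos_axis[OF t] root by simp
  then have "poly Q t > 0" using x(1) by (simp add: zero_less_mult_iff)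
  then have "poly h t < 0" using x(2) root by (simp add: h_def)
  moreover have "poly h 0 > 0" using Q0 xs_pos by (simp add: h_def mult_pos_neg)
  ultimately obtain a where a: "0 < a" "a < t" "poly h a = 0" using poly_IVT_neg[OF t, of h] by auto
  \<comment> \<open>The polynomial \<open>h\<close> is positive at \<open>0\<close>, negative at \<open>t\<close> and positive near infinity.\<close>
  have "\<forall>\<^sub>F T in at_top. poly P T / poly Q T > xs" using lim by (simp add: filterlim_at_top_dense)
  then have "\<forall>\<^sub>F T in at_top. T > t \<and> poly h T > 0"
    using eventually_gt_at_top[of t]
  proof eventually_elim
    case (elim T)
    have "poly P T > 0" using P_pos_axis elim t by simp
    moreover have "poly P T / poly Q T > 0" using elim xs_pos by simp
    ultimately have "poly Q T > 0" by (simp add: zero_less_divide_iff)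
    then show ?case using elim by (simp add: h_def pos_less_divide_eq)
  qed
  then obtain T where T: "T > t" "poly h T > 0" by (metis (mono_tags, lifting) eventually_at_top_linorder order_refl)
  obtain b where b: "t < b" "poly h b = 0" using poly_IVT_pos[OF T(1) \<open>poly h t < 0\<close> T(2)] by auto
  have ab: "a \<noteq> b" using a b by simp
  have hroot: "poly (cpoly h) (of_real s) = 0" if "poly h s = 0" for s
    using that by (simp only: cpoly_of_real of_real_0)
  note facts = cpoly_nonzero[of xs, folded h_def] two_roots[OF xs_pos, folded h_def]
  define Z where "Z n = complex_of_real (xs + 1 / real (Suc n))" for n
  have Zx: "xs + 1 / real (Suc n) > xs" for n by simp
  have Zl: "Z \<longlonglongrightarrow> of_real xs" unfolding Z_def by (intro tendsto_of_real) real_asymp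
  have ZC: "Z n \<notin> C" for n using Zx[of n] by (auto simp: Z_def simp del: of_real_add)
  let ?T = "{z. Im z = 0} \<inter> {z. Re z \<ge> 1}"
  have "closed ?T" by (intro closed_Int closed_Collect_eq closed_Collect_le continuous_intros)
  moreover have "branch (Z n) \<in> ?T" for n
    using branch_right(2)[OF Zx[of n]] branch_real(1)[of "xs + 1 / real (Suc n)"] Zx[of n] unfolding Z_def by blast
  ultimately obtain r k where r: "strict_mono (k :: nat \<Rightarrow> nat)" "((\<lambda>n. branch (Z n)) \<circ> k) \<longlonglongrightarrow> r" "r \<in> ?T"
      "poly p r = of_real xs * poly q r"
    using root_limit[OF deg_pq _ Zl, of ?T "\<lambda>n. branch (Z n)"] branch_root[OF ZC] by metis
  have rr: "r = of_real (Re r)" "Re r \<ge> 1" using r(3) by (auto simp: complex_eq_iff)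
  have rS: "r \<in> sector \<alpha>" using rr positive_in_sector[of "Re r"] by simp
  have rh: "poly (cpoly h) r = 0" unfolding h_def root_iff by (rule r(4))
  have simple: "poly (pderiv (p - smult (of_real xs) q)) r \<noteq> 0"
  proof -
    have aS: "of_real a \<in> sector \<alpha>" and bS: "of_real b \<in> sector \<alpha>" using a b t by (auto intro!: positive_in_sector)
    obtain c where c: "c \<in> sector \<alpha>" "poly (cpoly h) c = 0" "c \<noteq> r"
      using aS bS hroot[OF a(3)] hroot[OF b(2)] ab by (metis of_real_eq_iff)
    then have "poly (pderiv (cpoly h)) r \<noteq> 0" using two_roots_simple[OF facts rS c(1) rh] by blast
    then show ?thesis by (simp add: h_def cpoly_diff_smult)
  qed
  have qr: "poly q r \<noteq> 0"
  proof
    assume "poly q r = 0"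
    then have "poly p r = 0" using r(4) by simp
    moreover have "r \<noteq> 0" using rr(2) by auto
    ultimately show False using P_nonzero_in_sector[OF rS] by simp
  qed
  obtain g d e where g: "d > 0" "e > 0" "g holomorphic_on ball (of_real xs) d"
    "\<And>z w. z \<in> ball (of_real xs) d \<Longrightarrow> w \<in> ball r e \<Longrightarrow> poly p w = z * poly q w \<Longrightarrow> g z = w"
    using simple_root_continuation[OF r(4) qr simple] by metis
  obtain d' where d': "d' > 0" "d' \<le> xs" "\<And>z. z \<in> slit 1 xs d' \<Longrightarrow> dist r (branch z) < e"
  proof (rule branch_limit_at_end[of 1 xs "Z \<circ> k" r e])
    show "(Z \<circ> k) \<longlonglongrightarrow> of_real xs" by (rule LIMSEQ_subseq_LIMSEQ[OF Zl r(1)])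
    show "\<not> (Im ((Z \<circ> k) n) = 0 \<and> 1 * (Re ((Z \<circ> k) n) - xs) \<le> 0)" for n by (simp add: Z_def)
    show "(\<lambda>n. branch ((Z \<circ> k) n)) \<longlonglongrightarrow> r" using r(2) by (simp add: o_def)
  qed (use g in auto)
  define \<rho> where "\<rho> = min d d'"
  have \<rho>: "\<rho> > 0" "\<rho> \<le> d" "\<rho> \<le> d'" "\<rho> \<le> xs" using g(1) d' by (auto simp: \<rho>_def)
  have "g holomorphic_on ball (of_real xs) \<rho> - {of_real xs}"
    using \<rho> by (intro holomorphic_on_subset[OF g(3)]) auto
  moreover have "g z = branch z" if "z \<in> ball (of_real xs) \<rho> - C" for z
  proof (rule g(4))
    show "z \<in> ball (of_real xs) d" using that \<rho> by auto
    have "z \<in> slit 1 xs d'" using that \<rho> slit_end(2)[of 1 xs d'] d' by auto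
    then show "branch z \<in> ball r e" using d'(3) by simp
    show "poly p (branch z) = z * poly q (branch z)" using that branch_root by blast
  qed
  ultimately show False using branch_point_xs \<rho>(1) unfolding branch_point_def by blast
qed

lemma conjugate_pair:
  assumes x: "0 < x" "x < xs"
  obtains v where "v \<in> sector \<alpha>" "Im v > 0" "poly p v = of_real x * poly q v"
    "\<forall>u\<in>sector \<alpha>. poly p u = of_real x * poly q u \<longrightarrow> u = v \<or> u = cnj v"
    "poly (pderiv (cpoly (P - smult x Q))) v \<noteq> 0"
proof -
  note facts = cpoly_nonzero[of x] two_roots[OF x(1)]
  obtain u where u: "u \<in> sector \<alpha>" "poly p u = of_real x * poly q u"
    using two_roots_exists[OF facts] root_iff by blast
  have "Im u \<noteq> 0"
  proof
    assume "Im u = 0"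
    then have ur: "u = of_real (Re u)" by (simp add: complex_eq_iff)
    have "complex_of_real (poly P (Re u)) = of_real (x * poly Q (Re u))"
      using u(2) ur by (metis cpoly_of_real of_real_mult)
    then have "poly P (Re u) = x * poly Q (Re u)" using of_real_eq_iff by blast
    then show False using no_positive_root[OF x sector_root_Re_pos[OF x(1) u]] by simp
  qed
  define v where "v = (if Im u > 0 then u else cnj u)"
  have v: "v \<in> sector \<alpha>" "Im v > 0" "poly p v = of_real x * poly q v"
    using u \<open>Im u \<noteq> 0\<close> cnj_sector cnj_root by (auto simp: v_def)
  have ne: "v \<noteq> cnj v" using v(2) by (auto simp: complex_eq_iff)
  have cv: "cnj v \<in> sector \<alpha>" "poly p (cnj v) = of_real x * poly q (cnj v)"
    using v cnj_sector cnj_root by auto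
  show ?thesis
  proof (rule that[OF v])
    show "\<forall>u\<in>sector \<alpha>. poly p u = of_real x * poly q u \<longrightarrow> u = v \<or> u = cnj v"
      using two_roots_only[OF facts v(1) cv(1)] v(3) cv(2) ne root_iff by blast
    show "poly (pderiv (cpoly (P - smult x Q))) v \<noteq> 0"
      using two_roots_simple[OF facts v(1) cv(1)] v(3) cv(2) ne root_iff by blast
  qed
qed

lemma density_from_root:
  assumes x: "0 < x" "x < xs"
    and v: "v \<in> sector \<alpha>" "Im v > 0" "poly p v = of_real x * poly q v"
    and only: "\<forall>u\<in>sector \<alpha>. poly p u = of_real x * poly q u \<longrightarrow> u = v \<or> u = cnj v"
    and simple: "poly (pderiv (cpoly (P - smult x Q))) v \<noteq> 0"
  shows "log_integral_exists \<alpha> (log_arg P Q x)" and "density_fun P Q \<alpha> x = Im v / (pi * x)"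
proof -
  have wedge_sector: "z \<in> sector \<alpha>" "Im z \<ge> 0" if "z \<in> wedge \<alpha>" for z
    using that by (auto simp: wedge_def sector_eq[OF \<alpha>_range])
  have vin: "cos \<alpha> * Im v < sin \<alpha> * Re v"
    using sector_root_interior[OF x(1) v(1,3)] v(2) by simp
  have v0: "poly (cpoly (P - smult x Q)) v = 0" using v(3) root_iff by blast
  have nz: "poly (cpoly (P - smult x Q)) z \<noteq> 0" if "z \<in> wedge \<alpha>" "z \<noteq> v" for z
  proof
    assume "poly (cpoly (P - smult x Q)) z = 0"
    then have "z = cnj v" using only wedge_sector(1)[OF that(1)] that(2) root_iff by blast
    then show False using wedge_sector(2)[OF that(1)] v(2) by simp
  qed
  have Pz: "poly p z \<noteq> 0" if "z \<in> wedge \<alpha>" "z \<noteq> 0" for z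
    using P_nonzero_in_sector wedge_sector that by blast
  show "log_integral_exists \<alpha> (log_arg P Q x)"
    by (rule log_integral_eq(1)[OF \<alpha>_range deg v(2) vin v0 simple]) (use nz Pz in blast)+
  have "log_integral \<alpha> (log_arg P Q x) = - 2 * pi * \<i> * v"
    by (rule log_integral_eq(2)[OF \<alpha>_range deg v(2) vin v0 simple]) (use nz Pz in blast)+
  then show "density_fun P Q \<alpha> x = Im v / (pi * x)"
    using x(1) by (simp add: density_fun_def power2_eq_square)
qed

text \<open>
  Just above \<open>x\<close> the branch takes values in the sector and in the closed lower half-plane, and there \<open>cnj v\<close>
  is the only root over \<open>x\<close>.
\<close>

lemma branch_boundary_value:
  assumes x: "0 < x" "x < xs"
    and v: "v \<in> sector \<alpha>" "Im v > 0" "poly p v = of_real x * poly q v"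
    and only: "\<forall>u\<in>sector \<alpha>. poly p u = of_real x * poly q u \<longrightarrow> u = v \<or> u = cnj v"
  shows "(\<lambda>n. branch (Complex x (1 / real (Suc n)))) \<longlonglongrightarrow> cnj v"
proof (rule tendstoI)
  fix e :: real assume e: "e > 0"
  define T where "T = sector \<alpha> \<inter> {z. Im z \<le> 0} \<inter> {z. dist z (cnj v) \<ge> e}"
  have "closed T"
    unfolding T_def by (intro closed_Int closed_sector closed_Collect_le continuous_intros)
  moreover have "poly p u \<noteq> z * poly q u" if "z \<in> {complex_of_real x}" "u \<in> T" for z u
  proof
    assume "poly p u = z * poly q u"
    then have "u = v \<or> u = cnj v" using that only by (auto simp: T_def)
    then show False using that(2) v(2) e by (auto simp: T_def)
  qed
  ultimately obtain d where d: "d > 0"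
      "\<And>z u. dist (complex_of_real x) z < d \<Longrightarrow> u \<in> T \<Longrightarrow> poly p u \<noteq> z * poly q u"
    using no_roots_near[OF deg_pq _ compact_sing[of "complex_of_real x"], of T] by (metis singletonI)
  obtain \<epsilon>0 where \<epsilon>0: "\<epsilon>0 > 0" "\<And>\<epsilon>. 0 < \<epsilon> \<Longrightarrow> \<epsilon> < \<epsilon>0 \<Longrightarrow> branch (Complex x \<epsilon>) \<in> sector \<alpha>"
    using branch_in_sector[OF x(1)] by metis
  have "(\<lambda>n. 1 / real (Suc n)) \<longlonglongrightarrow> 0" by real_asymp
  then have "\<forall>\<^sub>F n in sequentially. 1 / real (Suc n) < min d \<epsilon>0"
    using d(1) \<epsilon>0(1) by (intro order_tendstoD) auto
  then show "\<forall>\<^sub>F n in sequentially. dist (branch (Complex x (1 / real (Suc n)))) (cnj v) < e"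
  proof eventually_elim
    case (elim n)
    define \<epsilon> where "\<epsilon> = 1 / real (Suc n)"
    have \<epsilon>: "0 < \<epsilon>" "\<epsilon> < d" "\<epsilon> < \<epsilon>0" using elim by (auto simp: \<epsilon>_def)
    let ?z = "Complex x \<epsilon>"
    have "?z \<notin> C" using \<epsilon>(1) by (auto simp: complex_eq_iff)
    then have root: "poly p (branch ?z) = ?z * poly q (branch ?z)" by (rule branch_root)
    have "?z - of_real x = \<i> * of_real \<epsilon>" by (simp add: complex_eq_iff)
    then have "dist (of_real x) ?z = \<epsilon>" using \<epsilon>(1) by (subst dist_commute) (simp add: dist_norm norm_mult)
    then have "branch ?z \<notin> T" using d(2) root \<epsilon>(2) by metis
    moreover have "branch ?z \<in> sector \<alpha>" using \<epsilon>0(2) \<epsilon> by blast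
    moreover have "Im (branch ?z) \<le> 0" using \<epsilon>(1) by (intro Im_branch_nonpos) simp
    ultimately show ?case unfolding T_def \<epsilon>_def by simp
  qed
qed

lemma stieltjes_boundary_value:
  assumes x: "x \<noteq> 0" and lim: "(\<lambda>n. branch (Complex x (1 / real (Suc n)))) \<longlonglongrightarrow> l"
  shows "(\<lambda>n. - Im (stieltjes \<mu> (Complex x (1 / real (Suc n)))) / pi) \<longlonglongrightarrow> - Im l / (pi * x)"
proof -
  have st: "stieltjes \<mu> (Complex x (1 / real (Suc n))) = branch (Complex x (1 / real (Suc n))) / Complex x (1 / real (Suc n))" for n
  proof -
    have "Complex x (1 / real (Suc n)) \<noteq> 0" using x by (auto simp: complex_eq_iff)
    then show ?thesis by (simp add: branch_def)
  qed
  have "(\<lambda>n. Complex x (1 / real (Suc n))) \<longlonglongrightarrow> Complex x 0"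
    by (intro tendsto_Complex tendsto_const) real_asymp
  then have "(\<lambda>n. stieltjes \<mu> (Complex x (1 / real (Suc n)))) \<longlonglongrightarrow> l / Complex x 0"
    unfolding st using x by (intro tendsto_divide lim) (auto simp: complex_eq_iff)
  then have "(\<lambda>n. - Im (stieltjes \<mu> (Complex x (1 / real (Suc n)))) / pi) \<longlonglongrightarrow> - Im (l / Complex x 0) / pi"
    by (intro tendsto_intros) auto
  also have "- Im (l / Complex x 0) / pi = - Im l / (pi * x)"
    using x by (simp add: Complex_eq_0 complex_of_real_def[symmetric] mult.commute)
  finally show ?thesis .
qed

lemma stieltjes_bound:
  assumes "0 < a"
  shows "\<exists>B. \<forall>x \<epsilon>. a \<le> x \<longrightarrow> x \<le> b \<longrightarrow> 0 < \<epsilon> \<longrightarrow> \<epsilon> \<le> 1 \<longrightarrow> norm (stieltjes \<mu> (Complex x \<epsilon>)) \<le> B"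
proof -
  obtain B where B: "\<And>z w. norm z \<le> b + 1 \<Longrightarrow> poly p w = z * poly q w \<Longrightarrow> norm w \<le> B"
    using root_parameter_bound[OF deg_pq, of "b + 1"] by metis
  have "norm (stieltjes \<mu> (Complex x \<epsilon>)) \<le> B / a" if "a \<le> x" "x \<le> b" "0 < \<epsilon>" "\<epsilon> \<le> 1" for x \<epsilon>
  proof -
    let ?z = "Complex x \<epsilon>"
    have "?z \<notin> C" using that by (auto simp: complex_eq_iff)
    moreover have "norm ?z \<le> b + 1" using cmod_le[of ?z] that assms by simp
    ultimately have "norm (branch ?z) \<le> B" using B branch_root by blast
    moreover have za: "norm ?z \<ge> a" using complex_Re_le_cmod[of ?z] that by simp
    moreover have "norm (branch ?z) = norm ?z * norm (stieltjes \<mu> ?z)" by (simp add: branch_def norm_mult)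
    moreover have "a * norm (stieltjes \<mu> ?z) \<le> norm ?z * norm (stieltjes \<mu> ?z)"
      using za by (intro mult_right_mono) auto
    ultimately have "a * norm (stieltjes \<mu> ?z) \<le> B" by linarith
    then show ?thesis using assms by (simp add: pos_le_divide_eq mult.commute)
  qed
  then show ?thesis by blast
qed

lemma boundary_density:
  assumes x: "x > 0" "x \<noteq> xs"
  shows "(\<lambda>n. - Im (stieltjes \<mu> (Complex x (1 / real (Suc n)))) / pi)
    \<longlonglongrightarrow> density_fun P Q \<alpha> x * indicator {0<..<xs} x"
proof (cases "x < xs")
  case True
  obtain v where v: "v \<in> sector \<alpha>" "Im v > 0" "poly p v = of_real x * poly q v"
    "\<forall>u\<in>sector \<alpha>. poly p u = of_real x * poly q u \<longrightarrow> u = v \<or> u = cnj v"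
    "poly (pderiv (cpoly (P - smult x Q))) v \<noteq> 0"
    using conjugate_pair[OF x(1) True] by metis
  have "density_fun P Q \<alpha> x = - Im (cnj v) / (pi * x)"
    using density_from_root(2)[OF x(1) True v] by simp
  then show ?thesis
    using stieltjes_boundary_value[OF _ branch_boundary_value[OF x(1) True v(1-4)]] x True by simp
next
  case False
  then have xC: "complex_of_real x \<notin> C" using x by auto
  have "(\<lambda>n. Complex x (1 / real (Suc n))) \<longlonglongrightarrow> Complex x 0"
    by (intro tendsto_Complex tendsto_const) real_asymp
  then have "(\<lambda>n. branch (Complex x (1 / real (Suc n)))) \<longlonglongrightarrow> branch (of_real x)"
    by (intro isCont_tendsto_compose[OF branch_isCont[OF xC]]) (simp only: complex_of_real_def)
  moreover have "Im (branch (of_real x)) = 0" using branch_real(1)[of x] False x by simp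
  ultimately show ?thesis using stieltjes_boundary_value[of x] x False by fastforce
qed

lemma measure_eq_density:
  defines "D \<equiv> (\<lambda>x. density_fun P Q \<alpha> x * indicator {0<..<xs} x)"
  shows "D \<in> borel_measurable borel" and "\<mu> = density lborel (\<lambda>x. ennreal (D x))"
proof -
  define f where "f n x = - Im (stieltjes \<mu> (Complex x (1 / real (Suc n)))) / pi * indicator {0<..<xs} x" for n x
  have "f n \<in> borel_measurable borel" for n
    unfolding f_def stieltjes_def by (simp add: Complex_eq) measurable
  moreover have "(\<lambda>n. f n x) \<longlonglongrightarrow> D x" for x
    using boundary_density[of x] by (cases "0 < x \<and> x < xs") (auto simp: f_def D_def)
  ultimately show meas: "D \<in> borel_measurable borel" by (rule borel_measurable_LIMSEQ_real[rotated])
  show "\<mu> = density lborel (\<lambda>x. ennreal (D x))"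
  proof (rule stieltjes_inversion[OF _ stieltjes_bound meas])
    show "measure \<mu> {0} = 0" using left_limit by metis
    have "AE x in lborel. x \<noteq> xs" by (rule AE_lborel_singleton)
    then show "AE x in lborel. 0 < x \<longrightarrow>
      (\<lambda>n. - Im (stieltjes \<mu> (Complex x (1 / real (Suc n)))) / pi) \<longlonglongrightarrow> D x"
      unfolding D_def by eventually_elim (use boundary_density in blast)
  qed (auto simp: D_def)
qed

lemma density_formula:
  assumes x: "0 < x" "x < xs"
  shows "log_integral_exists \<alpha> (log_arg P Q x)" and "density_fun P Q \<alpha> x > 0"
proof -
  obtain v where v: "v \<in> sector \<alpha>" "Im v > 0" "poly p v = of_real x * poly q v"
    "\<forall>u\<in>sector \<alpha>. poly p u = of_real x * poly q u \<longrightarrow> u = v \<or> u = cnj v"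
    "poly (pderiv (cpoly (P - smult x Q))) v \<noteq> 0"
    using conjugate_pair[OF x] by metis
  show "log_integral_exists \<alpha> (log_arg P Q x)" by (rule density_from_root(1)[OF x v])
  show "density_fun P Q \<alpha> x > 0"
    unfolding density_from_root(2)[OF x v] using v(2) x(1) by simp
qed

end

section \<open>The density formula\<close>

theorem theorem2p1:
  fixes xs \<alpha> :: real and \<mu> :: "real measure" and P Q :: "real poly"
  assumes xs_pos: "xs > 0"
    and prob: "prob_space \<mu>" and borel: "sets \<mu> = sets borel"
    and supp: "emeasure \<mu> (- {0..xs}) = 0"
    and cut: "algebraic_with_cut P Q xs (\<lambda>z. z * stieltjes \<mu> z)"
    and gcd1: "coprime P Q"
    and P_pos: "\<And>t. 0 < t \<Longrightarrow> t \<le> 1 \<Longrightarrow> poly P t > 0"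
    and Q'_pos: "poly (pderiv Q) 1 > 0"
    and deg: "degree P \<ge> degree Q + 2"
    and lim: "filterlim (\<lambda>t. poly P t / poly Q t) at_top at_top"
    and \<alpha>_range: "0 < \<alpha>" "\<alpha> \<le> pi / 2"
    and two_roots: "\<And>x. x > 0 \<Longrightarrow>
          size (filter_mset (\<lambda>w. w \<in> sector \<alpha>) (proots (cpoly (P - smult x Q)))) = 2"
    and no_frontier_roots: "\<And>x w. x > 0 \<Longrightarrow> w \<in> frontier (sector \<alpha>) \<Longrightarrow>
          poly (cpoly (P - smult x Q)) w \<noteq> 0"
    and no_ray_roots: "\<And>z. z \<in> open_ray \<alpha> \<Longrightarrow> poly (cpoly P) z \<noteq> 0"
  shows "absolutely_continuous lborel \<mu> \<and>
         (\<forall>x. 0 < x \<and> x < xs \<longrightarrow> log_integral_exists \<alpha> (log_arg P Q x)) \<and>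
         (\<forall>x. 0 < x \<and> x < xs \<longrightarrow> density_fun P Q \<alpha> x > 0) \<and>
         (\<lambda>x. density_fun P Q \<alpha> x * indicator {0<..<xs} x) \<in> borel_measurable borel \<and>
         \<mu> = density lborel (\<lambda>x. ennreal (density_fun P Q \<alpha> x * indicator {0<..<xs} x))"
proof -
  interpret prob_space \<mu> by (rule prob)
  interpret compact_prob \<mu> xs by unfold_locales (rule xs_pos borel supp)+
  have "branch = (\<lambda>z. z * stieltjes \<mu> z)" by (simp add: branch_def fun_eq_iff)
  then interpret algebraic_branch \<mu> xs P Q \<alpha>
    using cut gcd1 P_pos deg lim \<alpha>_range two_roots no_frontier_roots no_ray_roots
    by unfold_locales auto
  note D = measure_eq_density
  have "absolutely_continuous lborel \<mu>"
    by (subst D(2)) (rule absolutely_continuousI_density, use D(1) in measurable)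
  then show ?thesis using D density_formula by blast
qed

end
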